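(* Let $I^2=(0,1)\times(0,1)$, let $\varphi\in L^2(I^2)$, regarded as a function on $\mathbb{R}^2$ that is odd and $2$-periodic in each variable, and for $m,n\in\mathbb{N}$ let $\varphi_{m,n}(x,y)=\varphi(mx,ny)$. Then the following assertions hold: (1) The system $\{\varphi_{m,n}\}_{m,n}$ is a Bessel sequence in $L^2(I^2)$ if and only if $S\varphi\in\mathcal{M}_2$. (2) The system $\{\varphi_{m,n}\}_{m,n}$ satisfies the lower frame bound in $L^2(I^2)$ if and only if $1/S\varphi\in\mathcal{M}_2$.
   Context: All spaces are over $\mathbb{C}$. Let $e_n(x)=\sqrt2\sin(\pi nx)$ and $e_{m,n}(x,y)=e_m(x)e_n(y)$; $\{e_{m,n}\}_{m,n\ge1}$ is an orthonormal basis of $L^2(I^2)$. A double Dirichlet series is a formal series $\sum_{m,n\ge1}a_{m,n}m^{-s}n^{-t}$ with $a_{m,n}\in\mathbb{C}$; these form an algebra under the product $*$ determined by $(m^{-s}n^{-t})*(k^{-s}l^{-t})=(mk)^{-s}(nl)^{-t}$, in which an element is invertible iff $a_{1,1}\ne0$. $\mathcal{H}^2_2$ is the Hilbert space of double Dirichlet series with $\big(\sum_{m,n}|a_{m,n}|^2\big)^{1/2}<\infty$ as norm. $S:L^2(I^2)\to\mathcal{H}^2_2$ is the isometric isomorphism with $S e_{m,n}=m^{-s}n^{-t}$. $\mathcal{M}_2$ is the set of multipliers of $\mathcal{H}^2_2$: the double Dirichlet series $D$ such that $D*E\in\mathcal{H}^2_2$ for every $E\in\mathcal{H}^2_2$ (equivalently,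 $E\mapsto D*E$ is a bounded operator on $\mathcal{H}^2_2$). "$1/S\varphi\in\mathcal{M}_2$" means that $S\varphi$ is invertible in the algebra of formal double Dirichlet series and its inverse belongs to $\mathcal{M}_2$. A countable system $\{g_j\}$ in a Hilbert space $H$ is a Bessel sequence if there is $B>0$ with $\sum_j|\langle f,g_j\rangle|^2\le B\|f\|^2$ for all $f\in H$; it satisfies the lower frame bound if there is $A>0$ with $A\|f\|^2\le\sum_j|\langle f,g_j\rangle|^2$ for all $f\in H$ (the sum may be $+\infty$). *)

theory Defs
  imports "HOL-Analysis.Analysis"
begin

section \<open>The space $L^2(I^2)$\<close>

definition I2 :: "(real \<times> real) set" where
  "I2 = {0<..<1} \<times> {0<..<1}"

text \<open>Elements of $L^2(I^2)$ are represented by functions on the plane that are Borel on \<open>I2\<close>; only the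
  values on \<open>I2\<close> matter, and every class of Lebesgue measurable functions modulo null sets has such a
  representative.\<close>

definition L2 :: "(real \<times> real \<Rightarrow> complex) set" where
  "L2 = {f \<in> borel_measurable (restrict_space lborel I2).
           integrable (restrict_space lborel I2) (\<lambda>z. (cmod (f z))\<^sup>2)}"

definition L2_inner :: "(real \<times> real \<Rightarrow> complex) \<Rightarrow> (real \<times> real \<Rightarrow> complex) \<Rightarrow> complex" where
  "L2_inner f g = (LINT z | restrict_space lborel I2. f z * cnj (g z))"

definition L2_norm :: "(real \<times> real \<Rightarrow> complex) \<Rightarrow> real" where
  "L2_norm f = sqrt (LINT z | restrict_space lborel I2. (cmod (f z))\<^sup>2)"

definition basis_fun :: "nat \<Rightarrow> nat \<Rightarrow> real \<times> real \<Rightarrow> complex" where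
  "basis_fun m n = (\<lambda>(x, y). complex_of_real
     ((sqrt 2 * sin (pi * real m * x)) * (sqrt 2 * sin (pi * real n * y))))"

section \<open>Odd 2-periodic extension and dilations\<close>

text \<open>The representative of \<open>x\<close> modulo 2 in $[-1,1)$.\<close>

definition red2 :: "real \<Rightarrow> real" where
  "red2 x = x - 2 * of_int \<lfloor>(x + 1) / 2\<rfloor>"

text \<open>On the lines where \<open>x\<close> or \<open>y\<close> is an integer, oddness and periodicity force the value 0.\<close>

definition odd_periodic_ext :: "(real \<times> real \<Rightarrow> complex) \<Rightarrow> real \<times> real \<Rightarrow> complex" where
  "odd_periodic_ext f = (\<lambda>(x, y).
     if (\<bar>red2 x\<bar>, \<bar>red2 y\<bar>) \<in> I2
     then complex_of_real (sgn (red2 x) * sgn (red2 y)) * f (\<bar>red2 x\<bar>, \<bar>red2 y\<bar>)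
     else 0)"

lemma red2_periodic: "red2 (x + 2) = red2 x"
proof -
  have "(x + 2 + 1) / 2 = (x + 1) / 2 + 1"
    by (simp add: field_simps)
  then have "\<lfloor>(x + 2 + 1) / 2\<rfloor> = \<lfloor>(x + 1) / 2\<rfloor> + 1"
    by (metis floor_add_int of_int_1)
  then show ?thesis
    unfolding red2_def by (simp only: of_int_add of_int_1) (simp add: algebra_simps)
qed

lemma red2_bounds: "-1 \<le> red2 x" "red2 x < 1"
  using floor_correct[of "(x + 1) / 2"] unfolding red2_def by (auto simp: field_simps)

lemma red2_eq: "red2 x = x" if "-1 \<le> x" "x < 1"
proof -
  have "\<lfloor>(x + 1) / 2\<rfloor> = 0"
    using that by (simp add: floor_eq_iff)
  then show ?thesis
    by (simp add: red2_def)
qed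

lemma red2_minus: "red2 (- x) = (if red2 x = -1 then -1 else - red2 x)"
proof (cases "red2 x = -1")
  case True
  then have "(- x + 1) / 2 = of_int (1 - \<lfloor>(x + 1) / 2\<rfloor>)"
    unfolding red2_def by simp
  then have "\<lfloor>(- x + 1) / 2\<rfloor> = 1 - \<lfloor>(x + 1) / 2\<rfloor>"
    by (metis floor_of_int)
  then show ?thesis
    using True by (simp add: red2_def)
next
  case False
  have "\<lfloor>(- x + 1) / 2\<rfloor> = - \<lfloor>(x + 1) / 2\<rfloor>"
    using False red2_bounds[of x] unfolding red2_def floor_eq_iff by simp
  then show ?thesis
    using False by (simp add: red2_def)
qed

lemma odd_periodic_ext_on_I2: "z \<in> I2 \<Longrightarrow> odd_periodic_ext f z = f z"
  by (auto simp: odd_periodic_ext_def I2_def red2_eq)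

lemma odd_periodic_ext_periodic:
  "odd_periodic_ext f (x + 2, y) = odd_periodic_ext f (x, y)"
  "odd_periodic_ext f (x, y + 2) = odd_periodic_ext f (x, y)"
  by (simp_all add: odd_periodic_ext_def red2_periodic)

lemma odd_periodic_ext_odd:
  "odd_periodic_ext f (- x, y) = - odd_periodic_ext f (x, y)"
  "odd_periodic_ext f (x, - y) = - odd_periodic_ext f (x, y)"
  by (auto simp: odd_periodic_ext_def red2_minus I2_def sgn_minus)

definition dilation :: "(real \<times> real \<Rightarrow> complex) \<Rightarrow> nat \<times> nat \<Rightarrow> real \<times> real \<Rightarrow> complex" where
  "dilation f = (\<lambda>(m, n) (x, y). odd_periodic_ext f (real m * x, real n * y))"

section \<open>Bessel sequences and the lower frame bound\<close>

text \<open>The sums are taken in \<open>ennreal\<close>, where they always exist, possibly with the value \<open>\<infinity>\<close>.\<close>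

definition bessel_sequence :: "'i set \<Rightarrow> ('i \<Rightarrow> real \<times> real \<Rightarrow> complex) \<Rightarrow> bool" where
  "bessel_sequence J g \<longleftrightarrow> (\<forall>j\<in>J. g j \<in> L2) \<and>
     (\<exists>B>0. \<forall>f\<in>L2. (\<Sum>\<^sub>\<infinity>j\<in>J. ennreal ((cmod (L2_inner f (g j)))\<^sup>2)) \<le> ennreal (B * (L2_norm f)\<^sup>2))"

definition lower_frame_bound :: "'i set \<Rightarrow> ('i \<Rightarrow> real \<times> real \<Rightarrow> complex) \<Rightarrow> bool" where
  "lower_frame_bound J g \<longleftrightarrow> (\<forall>j\<in>J. g j \<in> L2) \<and>
     (\<exists>A>0. \<forall>f\<in>L2. ennreal (A * (L2_norm f)\<^sup>2) \<le> (\<Sum>\<^sub>\<infinity>j\<in>J. ennreal ((cmod (L2_inner f (g j)))\<^sup>2)))"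

section \<open>Formal double Dirichlet series\<close>

text \<open>A series is given by its coefficients at indices \<open>m, n \<ge> 1\<close>; the junk coefficients at index 0
  are normalised to 0, so that equality of series is equality of coefficients.\<close>

typedef dirichlet2 = "{a :: nat \<Rightarrow> nat \<Rightarrow> complex. \<forall>m n. m = 0 \<or> n = 0 \<longrightarrow> a m n = 0}"
  morphisms coeff2 Dirichlet2
  by (rule exI[of _ "\<lambda>_ _. 0"]) simp

setup_lifting type_definition_dirichlet2

lemma dirichlet2_eqI: "(\<And>m n. coeff2 D m n = coeff2 E m n) \<Longrightarrow> D = E"
  by (metis coeff2_inject ext)

lemma coeff2_0 [simp]: "coeff2 D 0 n = 0" "coeff2 D m 0 = 0"
  using coeff2[of D] by auto

definition fact2 :: "nat \<Rightarrow> nat \<Rightarrow> ((nat \<times> nat) \<times> (nat \<times> nat)) set" where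
  "fact2 m n = {((k, l), (k', l')). k * k' = m \<and> l * l' = n}"

lemma mem_fact2: "((k, l), (k', l')) \<in> fact2 m n \<longleftrightarrow> k * k' = m \<and> l * l' = n"
  by (simp add: fact2_def)

lemma finite_fact2 [simp]: "m > 0 \<Longrightarrow> n > 0 \<Longrightarrow> finite (fact2 m n)"
  by (rule finite_subset[of _ "({..m} \<times> {..n}) \<times> ({..m} \<times> {..n})"]) (auto simp: fact2_def)

instantiation dirichlet2 :: comm_ring_1
begin

lift_definition zero_dirichlet2 :: dirichlet2 is "\<lambda>_ _. 0" by simp

lift_definition one_dirichlet2 :: dirichlet2 is "\<lambda>m n. if m = 1 \<and> n = 1 then 1 else 0" by auto

lift_definition plus_dirichlet2 :: "dirichlet2 \<Rightarrow> dirichlet2 \<Rightarrow> dirichlet2"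
  is "\<lambda>a b m n. a m n + b m n" by simp

lift_definition minus_dirichlet2 :: "dirichlet2 \<Rightarrow> dirichlet2 \<Rightarrow> dirichlet2"
  is "\<lambda>a b m n. a m n - b m n" by simp

lift_definition uminus_dirichlet2 :: "dirichlet2 \<Rightarrow> dirichlet2"
  is "\<lambda>a m n. - a m n" by simp

lift_definition times_dirichlet2 :: "dirichlet2 \<Rightarrow> dirichlet2 \<Rightarrow> dirichlet2"
  is "\<lambda>a b m n. if m = 0 \<or> n = 0 then 0
        else (\<Sum>((k, l), (k', l')) \<in> fact2 m n. a k l * b k' l')" by simp

instance
proof
  fix a b c :: dirichlet2
  show "a + b + c = a + (b + c)" "a + b = b + a" "0 + a = a" "- a + a = 0" "a - b = a + - b"
    by (transfer; simp add: algebra_simps)+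
  show "(0::dirichlet2) \<noteq> 1"
    by transfer (metis one_neq_zero)
  show "(a + b) * c = a * c + b * c"
    by (rule dirichlet2_eqI)
      (simp add: times_dirichlet2.rep_eq plus_dirichlet2.rep_eq case_prod_unfold distrib_right sum.distrib)
  have "(\<Sum>z\<in>fact2 m n. coeff2 a (fst (fst z)) (snd (fst z)) * coeff2 b (fst (snd z)) (snd (snd z)))
      = (\<Sum>z\<in>fact2 m n. coeff2 b (fst (fst z)) (snd (fst z)) * coeff2 a (fst (snd z)) (snd (snd z)))"
    for m n
    by (rule sum.reindex_bij_witness[of _ prod.swap prod.swap]) (auto simp: fact2_def)
  then show "a * b = b * a"
    by (intro dirichlet2_eqI) (simp only: times_dirichlet2.rep_eq case_prod_unfold)
  show "1 * a = a"
  proof (rule dirichlet2_eqI)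
    fix m n
    show "coeff2 (1 * a) m n = coeff2 a m n"
    proof (cases "m = 0 \<or> n = 0")
      case False
      then have "coeff2 (1 * a) m n =
          (\<Sum>z\<in>fact2 m n. coeff2 1 (fst (fst z)) (snd (fst z)) * coeff2 a (fst (snd z)) (snd (snd z)))"
        by (simp add: times_dirichlet2.rep_eq case_prod_unfold)
      also have "\<dots> = (\<Sum>z\<in>fact2 m n. if z = ((1, 1), (m, n)) then coeff2 a m n else 0)"
      proof (rule sum.cong)
        fix z assume "z \<in> fact2 m n"
        then obtain k l k' l' where z: "z = ((k, l), (k', l'))" "k * k' = m" "l * l' = n"
          by (auto simp: fact2_def)
        show "coeff2 1 (fst (fst z)) (snd (fst z)) * coeff2 a (fst (snd z)) (snd (snd z)) =
            (if z = ((1, 1), (m, n)) then coeff2 a m n else 0)"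
        proof (cases "k = 1 \<and> l = 1")
          case True
          then show ?thesis using z by (simp add: one_dirichlet2.rep_eq)
        next
          case False
          then show ?thesis by (auto simp: one_dirichlet2.rep_eq z(1))
        qed
      qed simp
      also have "\<dots> = coeff2 a m n"
        using False by (subst sum.delta) (auto simp: mem_fact2)
      finally show ?thesis .
    qed auto
  qed
  show "a * b * c = a * (b * c)"
  proof (rule dirichlet2_eqI)
    fix m n
    show "coeff2 (a * b * c) m n = coeff2 (a * (b * c)) m n"
    proof (cases "m = 0 \<or> n = 0")
      case False
      let ?f = "\<lambda>p q r. coeff2 a (fst p) (snd p) * coeff2 b (fst q) (snd q) * coeff2 c (fst r) (snd r)"
      have *: "fst p > 0 \<and> snd p > 0 \<and> fst q > 0 \<and> snd q > 0" if "(p, q) \<in> fact2 m n" for p q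
        using False that by (cases p; cases q) (auto simp: fact2_def intro!: Nat.gr0I)
      have "coeff2 (a * b * c) m n =
          (\<Sum>z\<in>fact2 m n. coeff2 (a * b) (fst (fst z)) (snd (fst z)) * coeff2 c (fst (snd z)) (snd (snd z)))"
        using False by (simp add: times_dirichlet2.rep_eq[of "a * b" c] case_prod_unfold)
      also have "\<dots> = (\<Sum>z\<in>fact2 m n. \<Sum>w\<in>fact2 (fst (fst z)) (snd (fst z)). ?f (fst w) (snd w) (snd z))"
      proof (rule sum.cong)
        fix z assume "z \<in> fact2 m n"
        then have "fst (fst z) \<noteq> 0 \<and> snd (fst z) \<noteq> 0"
          using *[of "fst z" "snd z"] by simp
        then show "coeff2 (a * b) (fst (fst z)) (snd (fst z)) * coeff2 c (fst (snd z)) (snd (snd z)) =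
            (\<Sum>w\<in>fact2 (fst (fst z)) (snd (fst z)). ?f (fst w) (snd w) (snd z))"
          by (simp add: times_dirichlet2.rep_eq case_prod_unfold sum_distrib_right)
      qed simp
      also have "\<dots> = (\<Sum>(z, w)\<in>Sigma (fact2 m n) (\<lambda>z. fact2 (fst (fst z)) (snd (fst z))).
          ?f (fst w) (snd w) (snd z))"
        using False * by (subst sum.Sigma) (auto simp del: split_paired_All)
      also have "\<dots> = (\<Sum>(z, w)\<in>Sigma (fact2 m n) (\<lambda>z. fact2 (fst (snd z)) (snd (snd z))).
          ?f (fst z) (fst w) (snd w))"
        by (rule sum.reindex_bij_witness[of _
              "\<lambda>((p, _), (q, r)). (((fst p * fst q, snd p * snd q), r), (p, q))"
              "\<lambda>((_, r), (p, q)). ((p, (fst q * fst r, snd q * snd r)), (q, r))"])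
          (auto simp: fact2_def mult.assoc)
      also have "\<dots> = (\<Sum>z\<in>fact2 m n. \<Sum>w\<in>fact2 (fst (snd z)) (snd (snd z)).
          ?f (fst z) (fst w) (snd w))"
        using False * by (subst sum.Sigma) auto
      also have "\<dots> = (\<Sum>z\<in>fact2 m n. coeff2 a (fst (fst z)) (snd (fst z)) * coeff2 (b * c) (fst (snd z)) (snd (snd z)))"
      proof (rule sum.cong)
        fix z assume "z \<in> fact2 m n"
        then have "fst (snd z) \<noteq> 0 \<and> snd (snd z) \<noteq> 0"
          using *[of "fst z" "snd z"] by simp
        then show "(\<Sum>w\<in>fact2 (fst (snd z)) (snd (snd z)). ?f (fst z) (fst w) (snd w)) =
            coeff2 a (fst (fst z)) (snd (fst z)) * coeff2 (b * c) (fst (snd z)) (snd (snd z))"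
          by (simp add: times_dirichlet2.rep_eq case_prod_unfold sum_distrib_left mult.assoc)
      qed simp
      also have "\<dots> = coeff2 (a * (b * c)) m n"
        using False by (simp add: times_dirichlet2.rep_eq[of a "b * c"] case_prod_unfold)
      finally show ?thesis .
    qed auto
  qed
qed

end

definition H22 :: "dirichlet2 set" where
  "H22 = {D. (\<lambda>(m, n). (cmod (coeff2 D m n))\<^sup>2) summable_on ({1..} \<times> {1..})}"

definition multipliers2 :: "dirichlet2 set" where
  "multipliers2 = {D. \<forall>E\<in>H22. D * E \<in> H22}"

text \<open>The isometric isomorphism $L^2(I^2) \to \mathcal{H}^2_2$ with $e_{m,n} \mapsto m^{-s}n^{-t}$:
  it sends \<open>f\<close>, whose expansion is $\sum \langle f, e_{m,n}\rangle e_{m,n}$, to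
  $\sum \langle f, e_{m,n}\rangle m^{-s}n^{-t}$.\<close>

lift_definition S_map :: "(real \<times> real \<Rightarrow> complex) \<Rightarrow> dirichlet2"
  is "\<lambda>f m n. if m = 0 \<or> n = 0 then 0 else L2_inner f (basis_fun m n)" by simp

end

theory Submission
  imports Defs "HOL-Computational_Algebra.Primes"
begin

text \<open>By Parseval everything takes place on coefficients. With \<open>a = S \<phi>\<close>, the dilation \<open>\<phi>\<^sub>q\<close> has
  as coefficients the column \<open>q\<close> of the matrix of multiplication by \<open>a\<close>, so the analysis map
  \<open>f \<mapsto> (\<langle>f, \<phi>\<^sub>q\<rangle>)\<^sub>q\<close> is formally the adjoint of that multiplication. The Bessel property says that the
  adjoint is bounded, equivalently that multiplication by \<open>a\<close> is bounded, equivalently (closed graph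
  theorem) that \<open>a\<close> is a multiplier.

  If the lower frame bound holds, the adjoint is bounded below on each finite-dimensional space of
  coefficients supported on a divisor-closed set. Its inverse there is the adjoint of multiplication by
  \<open>1/a\<close>, which is therefore bounded. Conversely, if \<open>d = 1/a\<close> is a multiplier, its Fejer means
  \<open>d\<^sub>R\<close> with respect to a completely additive weight are finitely supported and bounded by the multiplier
  norm of \<open>d\<close>, and \<open>a * d\<^sub>R * E \<longrightarrow> E\<close> weakly for finitely supported \<open>E\<close>; pairing with \<open>f\<close> bounds
  \<open>\<langle>f, E\<rangle>\<close> by the analysis sequence of \<open>f\<close>.\<close>

text \<open>In the direction from \<open>1/a\<close> to the lower frame bound, \<phi> is only square
  integrable, so multiplication by \<open>a\<close>, and with it the analysis map, may be unbounded.
  Cutting \<open>1/a\<close> off sharply would make the sums finite, but sharp truncations of a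
  multiplier need not be uniformly bounded. Fejer means are, because they average compressions of
  the operator to windows of weights. This requires a weight that is integer-valued, additive over
  products, and has only finitely many pairs below each bound.

  Every norm is handled through finite index sets, and operator bounds come from pairing a finite
  vector with itself and moving the multiplication to the other side. This stays finite because
  multiplication is triangular with respect to divisibility: its adjoint maps a vector supported on
  a finite set to one supported on the divisors of that set.\<close>

definition pos_pairs :: "(nat \<times> nat) set" where
  "pos_pairs = {1..} \<times> {1..}"

lemma mem_pos_pairs: "p \<in> pos_pairs \<longleftrightarrow> 0 < fst p \<and> 0 < snd p"
  by (cases p) (auto simp: pos_pairs_def)

definition coeff_at :: "dirichlet2 \<Rightarrow> nat \<times> nat \<Rightarrow> complex" where
  "coeff_at D p = coeff2 D (fst p) (snd p)"

lift_definition dseries :: "(nat \<times> nat \<Rightarrow> complex) \<Rightarrow> dirichlet2"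
  is "\<lambda>f m n. if m = 0 \<or> n = 0 then 0 else f (m, n)" by simp

lemma coeff_at_dseries [simp]: "p \<in> pos_pairs \<Longrightarrow> coeff_at (dseries f) p = f p"
  by (auto simp: mem_pos_pairs coeff_at_def dseries.rep_eq)

lemma coeff_at_notin: "p \<notin> pos_pairs \<Longrightarrow> coeff_at D p = 0"
  by (auto simp: mem_pos_pairs coeff_at_def)

lemma coeff_at_eqI: "(\<And>p. p \<in> pos_pairs \<Longrightarrow> coeff_at D p = coeff_at E p) \<Longrightarrow> D = E"
  by (rule dirichlet2_eqI) (metis coeff_at_notin coeff_at_def fst_conv snd_conv)

lemma coeff_at_add [simp]: "coeff_at (D + E) p = coeff_at D p + coeff_at E p"
  and coeff_at_diff [simp]: "coeff_at (D - E) p = coeff_at D p - coeff_at E p"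
  and coeff_at_zero [simp]: "coeff_at 0 p = 0"
  by (simp_all add: coeff_at_def plus_dirichlet2.rep_eq minus_dirichlet2.rep_eq zero_dirichlet2.rep_eq)

lemma coeff_at_one: "coeff_at 1 p = (if p = (1, 1) then 1 else 0)"
  by (cases p) (auto simp: coeff_at_def one_dirichlet2.rep_eq)

section \<open>Divisibility of index pairs and the matrix of a multiplication\<close>

definition dvd2 :: "nat \<times> nat \<Rightarrow> nat \<times> nat \<Rightarrow> bool" where
  "dvd2 q p \<longleftrightarrow> fst q dvd fst p \<and> snd q dvd snd p"

definition quot2 :: "nat \<times> nat \<Rightarrow> nat \<times> nat \<Rightarrow> nat \<times> nat" where
  "quot2 p q = (fst p div fst q, snd p div snd q)"

definition mult2 :: "nat \<times> nat \<Rightarrow> nat \<times> nat \<Rightarrow> nat \<times> nat" where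
  "mult2 q p = (fst q * fst p, snd q * snd p)"

lemma dvd2_refl [simp]: "dvd2 p p"
  by (simp add: dvd2_def)

lemma dvd2_in_pos_pairs: "dvd2 q p \<Longrightarrow> p \<in> pos_pairs \<Longrightarrow> q \<in> pos_pairs"
  by (auto simp: mem_pos_pairs dvd2_def intro!: Nat.gr0I)

lemma finite_dvd2: "p \<in> pos_pairs \<Longrightarrow> finite {q. dvd2 q p}"
  by (rule finite_subset[of _ "{..fst p} \<times> {..snd p}"]) (auto simp: mem_pos_pairs dvd2_def intro: dvd_imp_le)

lemma quot2_in_pos_pairs: "dvd2 q p \<Longrightarrow> p \<in> pos_pairs \<Longrightarrow> quot2 p q \<in> pos_pairs"
  by (auto simp: mem_pos_pairs dvd2_def quot2_def elim!: dvdE)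

lemma mult2_in_pos_pairs: "q \<in> pos_pairs \<Longrightarrow> p \<in> pos_pairs \<Longrightarrow> mult2 q p \<in> pos_pairs"
  by (simp add: mem_pos_pairs mult2_def)

lemma dvd2_mult2 [simp]: "dvd2 q (mult2 q p)"
  by (simp add: dvd2_def mult2_def)

lemma mult2_quot2: "dvd2 q p \<Longrightarrow> mult2 q (quot2 p q) = p"
  by (simp add: dvd2_def mult2_def quot2_def)

lemma quot2_mult2: "q \<in> pos_pairs \<Longrightarrow> quot2 (mult2 q p) q = p"
  by (simp add: mem_pos_pairs quot2_def mult2_def)

text \<open>The matrix of multiplication by \<open>D\<close> in the monomial basis, with row
  \<open>p\<close> and column \<open>q\<close>; it is triangular for divisibility.\<close>

definition dmat :: "dirichlet2 \<Rightarrow> nat \<times> nat \<Rightarrow> nat \<times> nat \<Rightarrow> complex" where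
  "dmat D p q = (if dvd2 q p then coeff_at D (quot2 p q) else 0)"

lemma coeff_at_times_divisors:
  assumes "p \<in> pos_pairs"
  shows "coeff_at (D * E) p = (\<Sum>q | dvd2 q p. dmat D p q * coeff_at E q)"
proof -
  obtain m n where p: "p = (m, n)" "m > 0" "n > 0"
    using assms by (cases p) (auto simp: mem_pos_pairs)
  have "coeff_at (D * E) p = (\<Sum>z\<in>fact2 m n. coeff_at D (fst z) * coeff_at E (snd z))"
    using p by (simp add: coeff_at_def times_dirichlet2.rep_eq case_prod_unfold)
  also have "\<dots> = (\<Sum>q | dvd2 q p. coeff_at D (quot2 p q) * coeff_at E q)"
    by (rule sum.reindex_bij_witness[of _ "\<lambda>q. (quot2 p q, q)" snd])
      (use p in \<open>auto simp: fact2_def dvd2_def quot2_def\<close>)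
  also have "\<dots> = (\<Sum>q | dvd2 q p. dmat D p q * coeff_at E q)"
    by (rule sum.cong) (auto simp: dmat_def)
  finally show ?thesis .
qed

text \<open>Enlarging the index set is harmless because \<open>dmat\<close> vanishes off the
  divisors. Several rows can thus share one finite set \<open>B\<close>, which makes sums
  exchangeable.\<close>

lemma coeff_at_times:
  assumes "p \<in> pos_pairs" "finite B" "{q. dvd2 q p} \<subseteq> B"
  shows "coeff_at (D * E) p = (\<Sum>q\<in>B. dmat D p q * coeff_at E q)"
  unfolding coeff_at_times_divisors[OF assms(1)]
  by (rule sum.mono_neutral_left) (use assms in \<open>auto simp: dmat_def\<close>)

lemma coeff_at_times_monomial:
  assumes "p \<in> pos_pairs" "r \<in> pos_pairs"
  shows "coeff_at (D * dseries (\<lambda>q. if q = r then c else 0)) p = dmat D p r * c"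
proof -
  have fin: "finite (insert r {q. dvd2 q p})"
    using assms finite_dvd2 by auto
  have "coeff_at (D * dseries (\<lambda>q. if q = r then c else 0)) p
      = (\<Sum>q\<in>insert r {q. dvd2 q p}. dmat D p q * coeff_at (dseries (\<lambda>q. if q = r then c else 0)) q)"
    using fin assms by (intro coeff_at_times) auto
  also have "\<dots> = (\<Sum>q\<in>insert r {q. dvd2 q p}. if q = r then dmat D p r * c else 0)"
    using assms dvd2_in_pos_pairs[OF _ assms(1)] by (intro sum.cong) auto
  also have "\<dots> = dmat D p r * c"
    using fin by (subst sum.delta) auto
  finally show ?thesis .
qed

text \<open>Column \<open>r\<close> is the image of the monomial at \<open>r\<close>, so matrix
  multiplication reduces to associativity in the ring.\<close>

lemma dmat_times:
  assumes "p \<in> pos_pairs" "r \<in> pos_pairs" "finite B" "{q. dvd2 q p} \<subseteq> B" "B \<subseteq> pos_pairs"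
  shows "dmat (D * E) p r = (\<Sum>q\<in>B. dmat D p q * dmat E q r)"
proof -
  let ?X = "dseries (\<lambda>q. if q = r then 1 else 0)"
  have "dmat (D * E) p r = coeff_at (D * (E * ?X)) p"
    using assms coeff_at_times_monomial[of p r "D * E" 1] by (simp add: mult.assoc)
  also have "\<dots> = (\<Sum>q\<in>B. dmat D p q * coeff_at (E * ?X) q)"
    using assms by (intro coeff_at_times) auto
  also have "\<dots> = (\<Sum>q\<in>B. dmat D p q * dmat E q r)"
    using assms coeff_at_times_monomial[of _ r E 1] by (intro sum.cong) auto
  finally show ?thesis .
qed

lemma dmat_one: "p \<in> pos_pairs \<Longrightarrow> dmat 1 p q = (if p = q then 1 else 0)"
proof (cases "dvd2 q p")
  case True
  moreover have "quot2 p p = (1, 1)" if "p \<in> pos_pairs"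
    using that by (simp add: mem_pos_pairs quot2_def)
  moreover have "mult2 q (1, 1) = q"
    by (simp add: mult2_def)
  ultimately show "p \<in> pos_pairs \<Longrightarrow> ?thesis"
    using mult2_quot2[of q p] by (auto simp: dmat_def coeff_at_one)
qed (auto simp: dmat_def)

text \<open>The rows indexed by \<open>A\<close> have all their nonzero entries in these
  columns.\<close>

definition divisors2 :: "(nat \<times> nat) set \<Rightarrow> (nat \<times> nat) set" where
  "divisors2 A = {q. \<exists>p\<in>A. dvd2 q p}"

lemma finite_divisors2: "finite A \<Longrightarrow> A \<subseteq> pos_pairs \<Longrightarrow> finite (divisors2 A)"
proof -
  assume "finite A" "A \<subseteq> pos_pairs"
  moreover have "divisors2 A = (\<Union>p\<in>A. {q. dvd2 q p})"
    by (auto simp: divisors2_def)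
  ultimately show ?thesis
    using finite_dvd2 by auto
qed

lemma divisors2_subset_pos_pairs: "A \<subseteq> pos_pairs \<Longrightarrow> divisors2 A \<subseteq> pos_pairs"
  unfolding divisors2_def using dvd2_in_pos_pairs by blast

lemma subset_divisors2: "A \<subseteq> divisors2 A"
  unfolding divisors2_def using dvd2_refl by blast

section \<open>Norms\<close>

abbreviation norm_on :: "('a \<Rightarrow> complex) \<Rightarrow> 'a set \<Rightarrow> real" where
  "norm_on x A \<equiv> L2_set (\<lambda>p. cmod (x p)) A"

lemma norm_on_power2: "(norm_on x A)\<^sup>2 = (\<Sum>p\<in>A. (cmod (x p))\<^sup>2)"
  by (simp add: L2_set_def sum_nonneg)

lemma norm_on_subset: "finite B \<Longrightarrow> A \<subseteq> B \<Longrightarrow> norm_on x A \<le> norm_on x B"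
  unfolding L2_set_def by (intro real_sqrt_le_mono sum_mono2) auto

lemma norm_on_add: "norm_on (\<lambda>p. x p + y p) A \<le> norm_on x A + norm_on y A"
proof -
  have "norm_on (\<lambda>p. x p + y p) A \<le> L2_set (\<lambda>p. cmod (x p) + cmod (y p)) A"
    by (intro L2_set_mono norm_triangle_ineq norm_ge_zero)
  also have "\<dots> \<le> norm_on x A + norm_on y A"
    by (rule L2_set_triangle_ineq)
  finally show ?thesis .
qed

lemma norm_on_cmult: "norm_on (\<lambda>p. c * x p) A = cmod c * norm_on x A"
  by (simp add: norm_mult L2_set_right_distrib)

lemma norm_on_diff: "norm_on (\<lambda>p. x p - y p) A \<le> norm_on x A + norm_on y A"
  using norm_on_add[of x "\<lambda>p. - y p" A] by simp

lemma norm_on_mult_ineq: "cmod (\<Sum>p\<in>A. x p * y p) \<le> norm_on x A * norm_on y A"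
proof -
  have "cmod (\<Sum>p\<in>A. x p * y p) \<le> (\<Sum>p\<in>A. \<bar>cmod (x p)\<bar> * \<bar>cmod (y p)\<bar>)"
    by (rule order_trans[OF norm_sum]) (simp add: norm_mult)
  also have "\<dots> \<le> norm_on x A * norm_on y A"
    by (rule L2_set_mult_ineq)
  finally show ?thesis .
qed

lemma sum_mult_cnj: "(\<Sum>p\<in>A. x p * cnj (x p)) = complex_of_real ((norm_on x A)\<^sup>2)"
  by (simp add: norm_on_power2 flip: complex_norm_square)

text \<open>The pairing of a vector with itself is its squared norm, so one factor cancels. This
  takes the place of duality in the operator bounds below.\<close>

lemma norm_on_le_of_pairing:
  assumes "cmod (\<Sum>p\<in>A. x p * cnj (x p)) \<le> M * norm_on x A" "0 \<le> M"
  shows "norm_on x A \<le> M"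
proof -
  have "norm_on x A * norm_on x A \<le> M * norm_on x A"
    using assms(1) unfolding sum_mult_cnj norm_of_real by (simp add: power2_eq_square)
  then show ?thesis
    using assms(2) L2_set_nonneg[of "\<lambda>p. cmod (x p)" A]
    by (cases "norm_on x A = 0") (auto simp: mult_le_cancel_right)
qed

text \<open>Bounding finite partial norms only lets the predicate be stated and proved before
  square-summability is known.\<close>

definition norm_le :: "dirichlet2 \<Rightarrow> real \<Rightarrow> bool" where
  "norm_le E K \<longleftrightarrow> (\<forall>A. finite A \<longrightarrow> A \<subseteq> pos_pairs \<longrightarrow> norm_on (coeff_at E) A \<le> K)"

lemma norm_leD: "norm_le E K \<Longrightarrow> finite A \<Longrightarrow> A \<subseteq> pos_pairs \<Longrightarrow> norm_on (coeff_at E) A \<le> K"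
  by (simp add: norm_le_def)

lemma norm_le_nonneg: "norm_le E K \<Longrightarrow> 0 \<le> K"
  using norm_leD[of E K "{}"] by simp

lemma norm_le_mono: "norm_le E K \<Longrightarrow> K \<le> L \<Longrightarrow> norm_le E L"
  unfolding norm_le_def by (meson order_trans)

lemma norm_le_add: "norm_le E K \<Longrightarrow> norm_le F L \<Longrightarrow> norm_le (E + F) (K + L)"
  unfolding norm_le_def coeff_at_add by (intro allI impI order_trans[OF norm_on_add] add_mono) auto

lemma norm_le_finite_support:
  assumes "finite B" "\<And>p. p \<in> pos_pairs \<Longrightarrow> p \<notin> B \<Longrightarrow> coeff_at E p = 0"
  shows "norm_le E (norm_on (coeff_at E) B)"
  unfolding norm_le_def
proof (intro allI impI)
  fix A :: "(nat \<times> nat) set" assume A: "finite A" "A \<subseteq> pos_pairs"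
  have "(\<Sum>p\<in>A. (cmod (coeff_at E p))\<^sup>2) = (\<Sum>p\<in>A \<inter> B. (cmod (coeff_at E p))\<^sup>2)"
    using A assms by (intro sum.mono_neutral_right) auto
  then have "norm_on (coeff_at E) A = norm_on (coeff_at E) (A \<inter> B)"
    by (simp add: L2_set_def)
  also have "\<dots> \<le> norm_on (coeff_at E) B"
    using assms by (intro norm_on_subset) auto
  finally show "norm_on (coeff_at E) A \<le> norm_on (coeff_at E) B" .
qed

lemma H22_iff: "D \<in> H22 \<longleftrightarrow> (\<exists>K. norm_le D K)"
proof
  let ?f = "\<lambda>p. (cmod (coeff_at D p))\<^sup>2"
  have eq: "D \<in> H22 \<longleftrightarrow> ?f summable_on pos_pairs"
    by (simp add: H22_def pos_pairs_def coeff_at_def case_prod_unfold)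
  {
    assume "D \<in> H22"
    then have *: "?f summable_on pos_pairs"
      by (simp add: eq)
    have "norm_le D (sqrt (infsum ?f pos_pairs))"
      unfolding norm_le_def L2_set_def
      using * by (auto intro!: finite_sum_le_infsum)
    then show "\<exists>K. norm_le D K" ..
  }
  assume "\<exists>K. norm_le D K"
  then obtain K where K: "norm_le D K" ..
  have "sum ?f A \<le> K\<^sup>2" if "finite A" "A \<subseteq> pos_pairs" for A
    using power_mono[OF norm_leD[OF K that], of 2] by (simp add: norm_on_power2)
  then have "?f summable_on pos_pairs"
    by (intro nonneg_bdd_above_summable_on) (auto simp: bdd_above_def)
  then show "D \<in> H22"
    by (simp add: eq)
qed

definition mult_bound :: "dirichlet2 \<Rightarrow> real \<Rightarrow> bool" where
  "mult_bound D C \<longleftrightarrow> 0 \<le> C \<and> (\<forall>E K. norm_le E K \<longrightarrow> norm_le (D * E) (C * K))"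

lemma mult_bound_imp_multipliers2: "mult_bound D C \<Longrightarrow> D \<in> multipliers2"
  unfolding multipliers2_def mult_bound_def using H22_iff by blast

section \<open>The closed graph theorem for multipliers\<close>

lemma coeff_at_monomial_times_mult2:
  assumes "k \<in> pos_pairs" "p \<in> pos_pairs"
  shows "coeff_at (dseries (\<lambda>q. if q = k then c else 0) * E) (mult2 k p) = c * coeff_at E p"
  using assms by (subst mult.commute, subst coeff_at_times_monomial)
    (simp_all add: mult2_in_pos_pairs dmat_def quot2_mult2)

lemma coeff_at_monomial_times_not_dvd2:
  assumes "k \<in> pos_pairs" "p \<in> pos_pairs" "\<not> dvd2 k p"
  shows "coeff_at (dseries (\<lambda>q. if q = k then c else 0) * E) p = 0"
  using assms by (subst mult.commute, subst coeff_at_times_monomial) (simp_all add: dmat_def)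

lemma inj_on_mult2: "k \<in> pos_pairs \<Longrightarrow> inj_on (mult2 k) A"
  by (rule inj_onI) (metis quot2_mult2)

lemma norm_le_monomial_times:
  assumes "k \<in> pos_pairs" "norm_le E K"
  shows "norm_le (dseries (\<lambda>q. if q = k then c else 0) * E) (cmod c * K)"
  unfolding norm_le_def
proof (intro allI impI)
  fix A :: "(nat \<times> nat) set" assume A: "finite A" "A \<subseteq> pos_pairs"
  let ?F = "dseries (\<lambda>q. if q = k then c else 0) * E"
  define A' where "A' = (\<lambda>p. quot2 p k) ` {p \<in> A. dvd2 k p}"
  have A': "finite A'" "A' \<subseteq> pos_pairs"
    using A by (auto simp: A'_def intro!: quot2_in_pos_pairs)
  have eq: "{p \<in> A. dvd2 k p} = mult2 k ` A'"
    unfolding A'_def image_image using mult2_quot2 by (auto simp: image_iff)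
  have "(\<Sum>p\<in>A. (cmod (coeff_at ?F p))\<^sup>2) = (\<Sum>p | p \<in> A \<and> dvd2 k p. (cmod (coeff_at ?F p))\<^sup>2)"
    using A by (intro sum.mono_neutral_right)
      (auto intro!: coeff_at_monomial_times_not_dvd2[OF assms(1)])
  also have "\<dots> = (\<Sum>p\<in>A'. (cmod (coeff_at ?F (mult2 k p)))\<^sup>2)"
    unfolding eq using assms by (subst sum.reindex) (auto simp: inj_on_mult2)
  also have "\<dots> = (\<Sum>p\<in>A'. (cmod (c * coeff_at E p))\<^sup>2)"
    using A' assms by (intro sum.cong) (auto simp: coeff_at_monomial_times_mult2)
  finally have "norm_on (coeff_at ?F) A = norm_on (\<lambda>p. c * coeff_at E p) A'"
    by (simp add: L2_set_def)
  also have "\<dots> \<le> cmod c * K"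
    unfolding norm_on_cmult using A' assms by (intro mult_left_mono norm_leD) auto
  finally show "norm_on (coeff_at ?F) A \<le> cmod c * K" .
qed

text \<open>By homogeneity, a violation of the bound \<open>L / \<delta>\<close> can be rescaled to
  an input of norm at most \<delta> whose image exceeds \<open>L\<close>.\<close>

lemma not_mult_bound_witness:
  assumes "\<nexists>C. mult_bound D C" "0 < \<delta>" "0 \<le> L"
  obtains E A where "norm_le E \<delta>" "finite A" "A \<subseteq> pos_pairs" "L < norm_on (coeff_at (D * E)) A"
proof -
  have "\<not> mult_bound D (L / \<delta>)"
    using assms by blast
  then obtain E K where K: "norm_le E K" and "\<not> norm_le (D * E) (L / \<delta> * K)"
    using assms by (auto simp: mult_bound_def)
  then obtain A where A: "finite A" "A \<subseteq> pos_pairs" "L / \<delta> * K < norm_on (coeff_at (D * E)) A"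
    by (auto simp: norm_le_def not_le)
  \<comment> \<open>For \<open>K = 0\<close> the series \<open>E\<close> would vanish, and
    \<open>D * E\<close> could not exceed any bound; so division by \<open>K\<close> is
    legitimate.\<close>
  have "K > 0"
  proof (rule ccontr)
    assume "\<not> K > 0"
    then have "K = 0"
      using norm_le_nonneg[OF K] by simp
    then have "coeff_at E p = 0" if "p \<in> pos_pairs" for p
      using norm_leD[OF K, of "{p}"] that by simp
    then have "E = 0"
      by (intro coeff_at_eqI) auto
    then show False
      using A \<open>K = 0\<close> by (simp add: L2_set_def)
  qed
  \<comment> \<open>The scalar enters as the coefficient of the monomial at \<open>(1, 1)\<close>,
    so that it commutes with \<open>D\<close> by the ring laws.\<close>
  let ?c = "complex_of_real (\<delta> / K)"
  let ?m = "dseries (\<lambda>q. if q = (1, 1) then ?c else 0)"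
  have m: "coeff_at (?m * F) p = ?c * coeff_at F p" if "p \<in> pos_pairs" for F p
  proof -
    have "mult2 (1, 1) p = p"
      by (simp add: mult2_def)
    moreover have "coeff_at (?m * F) (mult2 (1, 1) p) = ?c * coeff_at F p"
      by (rule coeff_at_monomial_times_mult2) (use that in \<open>auto simp: mem_pos_pairs\<close>)
    ultimately show ?thesis
      by simp
  qed
  show thesis
  proof
    show "norm_le (?m * E) \<delta>"
      using norm_le_monomial_times[OF _ K, of "(1, 1)" ?c] \<open>K > 0\<close> assms(2) by (simp add: norm_divide mem_pos_pairs)
    have "norm_on (coeff_at (D * (?m * E))) A = norm_on (\<lambda>p. ?c * coeff_at (D * E) p) A"
      using A m[of _ "D * E"] by (intro L2_set_cong) (auto simp: mult.left_commute[of D])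
    also have "\<dots> = \<delta> / K * norm_on (coeff_at (D * E)) A"
      unfolding norm_on_cmult norm_of_real using \<open>K > 0\<close> assms(2) by simp
    also have "L < \<dots>"
      using A(3) \<open>K > 0\<close> assms(2) by (simp add: field_simps)
    finally show "L < norm_on (coeff_at (D * (?m * E))) A" .
  qed (use A in auto)
qed

text \<open>A gliding hump: if \<open>D\<close> were unbounded, small pieces with large images could
  be added one after another, each leaving the earlier large coefficients untouched. The limit would
  be square-summable while its product with \<open>D\<close> is not.\<close>

lemma multipliers2_mult_bound:
  assumes "D \<in> multipliers2"
  obtains C where "mult_bound D C"
proof (rule ccontr)
  assume "\<not> thesis"
  then have not_bd: "\<nexists>C. mult_bound D C"
    using that by blast
  have mult: "\<exists>L. norm_le (D * E) L" if "norm_le E K" for E K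
  proof -
    have "E \<in> H22"
      using that H22_iff by blast
    then have "D * E \<in> H22"
      using assms by (simp add: multipliers2_def)
    then show ?thesis
      by (simp add: H22_iff)
  qed
  \<comment> \<open>Divisors of \<open>p\<close> have first entry at most \<open>fst p\<close>, so
    once the coefficients with first entry up to \<open>N'\<close> are frozen, the large partial
    norm of \<open>D * x'\<close> on \<open>A\<close> is frozen too.\<close>
  define good where "good n x N x' N' \<longleftrightarrow> N < N' \<and> (\<forall>p\<in>pos_pairs. fst p \<le> N \<longrightarrow> coeff_at x' p = coeff_at x p) \<and>
      (\<exists>A. finite A \<and> A \<subseteq> pos_pairs \<and> (\<forall>p\<in>A. fst p \<le> N') \<and> real n < norm_on (coeff_at (D * x')) A)"
    for n x N x' N'
  \<comment> \<open>The new piece is shifted to multiples of \<open>N + 1\<close>, so that it does not disturb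
    the coefficients of \<open>D * x\<close> that were made large before.\<close>
  have step: "\<exists>x' N'. norm_le x' (2 - (1/2) ^ Suc n) \<and> good n x N x' N'"
    if x: "norm_le x (2 - (1/2) ^ n)" for n N and x :: dirichlet2
  proof -
    obtain L where L: "norm_le (D * x) L"
      using mult x by blast
    \<comment> \<open>The target exceeds \<open>n\<close> by \<open>L\<close> because the old part
      \<open>D * x\<close> may cancel up to \<open>L\<close> of the new piece.\<close>
    have "0 \<le> real n + L"
      using norm_le_nonneg[OF L] by simp
    moreover have "0 < (1/2::real) ^ Suc n"
      by simp
    ultimately obtain E A where E: "norm_le E ((1/2) ^ Suc n)" "finite A" "A \<subseteq> pos_pairs"
      "real n + L < norm_on (coeff_at (D * E)) A"
      using not_mult_bound_witness[OF not_bd] by blast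
    define k where "k = (N + 1, 1 :: nat)"
    have k: "k \<in> pos_pairs"
      by (simp add: k_def mem_pos_pairs)
    define m where "m = dseries (\<lambda>q. if q = k then 1 else 0)"
    let ?A = "mult2 k ` A"
    have A: "finite ?A" "?A \<subseteq> pos_pairs"
      using E by (auto intro!: mult2_in_pos_pairs[OF k])
    obtain N' where N': "N' > N" "\<forall>p\<in>?A. fst p \<le> N'"
    proof
      show "N + 1 + Max (fst ` ?A) > N"
        by simp
      show "\<forall>p\<in>?A. fst p \<le> N + 1 + Max (fst ` ?A)"
      proof
        fix p assume "p \<in> ?A"
        then have "fst p \<le> Max (fst ` ?A)"
          using A by (intro Max_ge) auto
        then show "fst p \<le> N + 1 + Max (fst ` ?A)"
          by simp
      qed
    qed
    have mE: "norm_le (m * E) ((1/2) ^ Suc n)"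
      using norm_le_monomial_times[OF k E(1), of 1] by (simp add: m_def)
    have "norm_on (coeff_at (m * (D * E))) ?A = norm_on (coeff_at (D * E)) A"
    proof -
      have "(\<Sum>p\<in>?A. (cmod (coeff_at (m * (D * E)) p))\<^sup>2) = (\<Sum>p\<in>A. (cmod (coeff_at (m * (D * E)) (mult2 k p)))\<^sup>2)"
        using k by (subst sum.reindex) (auto simp: inj_on_mult2)
      also have "\<dots> = (\<Sum>p\<in>A. (cmod (coeff_at (D * E) p))\<^sup>2)"
        using E k unfolding m_def
        by (intro sum.cong refl) (subst coeff_at_monomial_times_mult2, auto)
      finally show ?thesis
        by (simp add: L2_set_def)
    qed
    then have "real n + L < norm_on (coeff_at (D * (m * E))) ?A"
      using E(4) by (simp add: mult.left_commute)
    also have "coeff_at (D * (m * E)) = (\<lambda>p. coeff_at (D * (x + m * E)) p - coeff_at (D * x) p)"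
      by (simp add: distrib_left)
    also have "norm_on \<dots> ?A \<le> norm_on (coeff_at (D * (x + m * E))) ?A + norm_on (coeff_at (D * x)) ?A"
      by (rule norm_on_diff)
    finally have "real n < norm_on (coeff_at (D * (x + m * E))) ?A"
      using norm_leD[OF L A] by simp
    moreover have "coeff_at (x + m * E) p = coeff_at x p" if "p \<in> pos_pairs" "fst p \<le> N" for p
    proof -
      have "\<not> dvd2 k p"
        using that by (auto simp: dvd2_def k_def mem_pos_pairs dest!: dvd_imp_le)
      then show ?thesis
        unfolding m_def coeff_at_add using k that by (subst coeff_at_monomial_times_not_dvd2) auto
    qed
    ultimately have "good n x N (x + m * E) N'"
      unfolding good_def using N' A by blast
    \<comment> \<open>The budget \<open>2 - (1/2) ^ n\<close> grows by exactly the size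
      \<open>(1/2) ^ Suc n\<close> of the new piece and never exceeds 2.\<close>
    moreover have "norm_le (x + m * E) (2 - (1/2) ^ Suc n)"
      by (rule norm_le_mono[OF norm_le_add[OF x mE]]) simp
    ultimately show ?thesis
      by blast
  qed
  have "norm_le 0 (2 - (1/2) ^ 0)"
    by (simp add: norm_le_def L2_set_def)
  then have "\<exists>f. \<forall>n. norm_le (fst (f n)) (2 - (1/2) ^ n) \<and>
      good n (fst (f n)) (snd (f n)) (fst (f (Suc n))) (snd (f (Suc n)))"
  proof (intro dependent_nat_choice)
    show "\<exists>x :: dirichlet2 \<times> nat. norm_le (fst x) (2 - (1/2) ^ 0)"
      using \<open>norm_le 0 _\<close> by (intro exI[of _ "(0, 0)"]) (simp only: fst_conv)
  next
    fix x :: "dirichlet2 \<times> nat" and n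
    assume "norm_le (fst x) (2 - (1/2) ^ n)"
    then obtain x' N' where "norm_le x' (2 - (1/2) ^ Suc n)" "good n (fst x) (snd x) x' N'"
      using step by blast
    then show "\<exists>y. norm_le (fst y) (2 - (1/2) ^ Suc n) \<and> good n (fst x) (snd x) (fst y) (snd y)"
      by (intro exI[of _ "(x', N')"]) (simp only: fst_conv snd_conv)
  qed
  then obtain f where f: "\<And>n. norm_le (fst (f n)) (2 - (1/2) ^ n)"
    "\<And>n. good n (fst (f n)) (snd (f n)) (fst (f (Suc n))) (snd (f (Suc n)))"
    by blast
  define x N where "x n = fst (f n)" and "N n = snd (f n)" for n
  have "N n < N (Suc n)" for n
    using f(2) by (simp add: good_def N_def)
  then have "strict_mono N"
    by (rule strict_monoI_Suc)
  then have N_ge: "n \<le> N n" for n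
    by (rule strict_mono_imp_increasing)
  have stable: "coeff_at (x (n + j)) p = coeff_at (x n) p" if "p \<in> pos_pairs" "fst p \<le> N n" for n j p
  proof (induction j)
    case (Suc j)
    have "fst p \<le> N (n + j)"
      using that \<open>strict_mono N\<close> by (metis le_add1 order_trans strict_mono_less_eq)
    then have "coeff_at (x (Suc (n + j))) p = coeff_at (x (n + j)) p"
      using f(2)[of "n + j"] that(1) by (auto simp: good_def N_def x_def)
    then show ?case
      using Suc by simp
  qed simp
  \<comment> \<open>Since \<open>n \<le> N n\<close>, the coefficient at \<open>p\<close> no longer
    changes from step \<open>fst p\<close> on, so that step already shows its limit.\<close>
  define X where "X = dseries (\<lambda>p. coeff_at (x (fst p)) p)"
  have X: "coeff_at X p = coeff_at (x n) p" if "p \<in> pos_pairs" "fst p \<le> N n" for n p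
  proof -
    have "coeff_at (x (fst p)) p = coeff_at (x (fst p + n)) p"
      using stable[of p "fst p" n] that N_ge by simp
    also have "\<dots> = coeff_at (x n) p"
      using stable[of p n "fst p"] that by (simp add: add.commute)
    finally show ?thesis
      using that by (simp add: X_def)
  qed
  have "norm_le X 2"
    unfolding norm_le_def
  proof (intro allI impI)
    fix A :: "(nat \<times> nat) set" assume A: "finite A" "A \<subseteq> pos_pairs"
    define n where "n = Max (fst ` A)"
    have le: "fst p \<le> N n" if "p \<in> A" for p
      using A that N_ge[of n] unfolding n_def by (meson Max_ge finite_imageI imageI order_trans)
    then have "norm_on (coeff_at X) A = norm_on (coeff_at (x n)) A"
      using A by (intro L2_set_cong refl arg_cong[of _ _ cmod] X le) auto
    also have "\<dots> \<le> 2 - (1/2) ^ n"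
      using norm_leD[OF f(1) A] by (simp add: x_def)
    also have "\<dots> \<le> 2"
      by simp
    finally show "norm_on (coeff_at X) A \<le> 2" .
  qed
  then obtain L where L: "norm_le (D * X) L"
    using mult by blast
  obtain n where n: "L < real n"
    using reals_Archimedean2 by blast
  obtain A where A: "finite A" "A \<subseteq> pos_pairs" "\<forall>p\<in>A. fst p \<le> N (Suc n)"
    "real n < norm_on (coeff_at (D * x (Suc n))) A"
    using f(2)[of n] by (auto simp: good_def N_def x_def)
  have "coeff_at (D * X) p = coeff_at (D * x (Suc n)) p" if "p \<in> A" for p
  proof -
    have p: "p \<in> pos_pairs"
      using that A by blast
    have "coeff_at X q = coeff_at (x (Suc n)) q" if "dvd2 q p" for q
    proof (rule X)
      show "q \<in> pos_pairs"
        using that p dvd2_in_pos_pairs by blast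
      have "fst q \<le> fst p"
        using that p by (auto simp: dvd2_def mem_pos_pairs intro!: dvd_imp_le)
      then show "fst q \<le> N (Suc n)"
        using A(3) \<open>p \<in> A\<close> by fastforce
    qed
    then show ?thesis
      using p by (simp add: coeff_at_times_divisors)
  qed
  then have "norm_on (coeff_at (D * X)) A = norm_on (coeff_at (D * x (Suc n))) A"
    by (intro L2_set_cong) auto
  then show False
    using A n norm_leD[OF L A(1,2)] by simp
qed

section \<open>A completely additive weight\<close>

text \<open>The sum of the prime factors with multiplicity, in both entries. Counting prime factors
  is additive as well, but its levels are infinite.\<close>

definition weight2 :: "nat \<times> nat \<Rightarrow> nat" where
  "weight2 p = sum_mset (prime_factorization (fst p)) + sum_mset (prime_factorization (snd p))"

lemma weight2_mult2: "p \<in> pos_pairs \<Longrightarrow> q \<in> pos_pairs \<Longrightarrow> weight2 (mult2 p q) = weight2 p + weight2 q"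
  by (simp add: weight2_def mult2_def mem_pos_pairs prime_factorization_mult)

lemma weight2_quot2:
  assumes "p \<in> pos_pairs" "dvd2 q p"
  shows "weight2 p = weight2 (quot2 p q) + weight2 q"
proof -
  have "quot2 p q \<in> pos_pairs" "q \<in> pos_pairs"
    using assms quot2_in_pos_pairs dvd2_in_pos_pairs by blast+
  then show ?thesis
    using weight2_mult2[of q "quot2 p q"] assms by (simp add: mult2_quot2)
qed

text \<open>Each factor satisfies \<open>x \<le> 2 ^ x\<close>. Applied to prime factorizations,
  this makes bounded weight imply bounded entries.\<close>

lemma prod_mset_le_power_sum_mset: "prod_mset M \<le> (2::nat) ^ sum_mset M"
proof (induction M)
  case (add x M)
  have "x * prod_mset M \<le> 2 ^ x * 2 ^ sum_mset M"
    using add by (intro mult_mono) (auto intro: less_imp_le)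
  then show ?case
    by (simp add: power_add)
qed simp

lemma le_power_sum_prime_factorization: "0 < n \<Longrightarrow> n \<le> 2 ^ sum_mset (prime_factorization (n::nat))"
  using prod_mset_le_power_sum_mset[of "prime_factorization n"] by (simp add: prod_mset_prime_factorization_nat)

lemma finite_weight2_le: "finite {p \<in> pos_pairs. weight2 p \<le> R}"
proof (rule finite_subset)
  show "{p \<in> pos_pairs. weight2 p \<le> R} \<subseteq> {..2 ^ R} \<times> {..2 ^ R}"
  proof
    fix p assume "p \<in> {p \<in> pos_pairs. weight2 p \<le> R}"
    then have p: "0 < fst p" "0 < snd p" "weight2 p \<le> R"
      by (auto simp: mem_pos_pairs)
    have "fst p \<le> 2 ^ weight2 p" "snd p \<le> 2 ^ weight2 p"
      unfolding weight2_def
      by (rule order_trans[OF le_power_sum_prime_factorization[OF p(1)] power_increasing]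
               order_trans[OF le_power_sum_prime_factorization[OF p(2)] power_increasing]; simp)+
    moreover have "(2::nat) ^ weight2 p \<le> 2 ^ R"
      using p(3) by (rule power_increasing) simp
    ultimately have "fst p \<le> 2 ^ R" "snd p \<le> 2 ^ R"
      by linarith+
    then show "p \<in> {..2 ^ R} \<times> {..2 ^ R}"
      by (cases p) auto
  qed
qed auto

lemma weight2_pos: "p \<in> pos_pairs \<Longrightarrow> p \<noteq> (1, 1) \<Longrightarrow> 0 < weight2 p"
proof (rule Nat.gr0I)
  assume p: "p \<in> pos_pairs" "p \<noteq> (1, 1)" and "weight2 p = 0"
  then have "sum_mset (prime_factorization (fst p)) = 0" "sum_mset (prime_factorization (snd p)) = 0"
    by (simp_all add: weight2_def del: sum_mset_0_iff)
  then have "fst p \<le> 1" "snd p \<le> 1"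
    using p(1) le_power_sum_prime_factorization[of "fst p"] le_power_sum_prime_factorization[of "snd p"]
    by (simp_all add: mem_pos_pairs del: sum_mset_0_iff)
  then show False
    using p by (cases p) (auto simp: mem_pos_pairs)
qed

section \<open>Inverses of formal series\<close>

text \<open>The weight grades the algebra. As \<open>X\<close> has no coefficient at
  \<open>(1, 1)\<close>, the only pair of weight 0, each further factor raises the least weight by
  at least one.\<close>

lemma coeff_at_power_eq_0:
  assumes "coeff_at X (1, 1) = 0" "p \<in> pos_pairs" "weight2 p < n"
  shows "coeff_at (X ^ n) p = 0"
  using assms(2,3)
proof (induction n arbitrary: p)
  case (Suc n)
  have "dmat X p q * coeff_at (X ^ n) q = 0" if "dvd2 q p" for q
  proof (cases "q = p")
    case True
    then have "quot2 p q = (1, 1)"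
      using Suc.prems by (simp add: quot2_def mem_pos_pairs)
    then show ?thesis
      using assms(1) by (simp add: dmat_def)
  next
    case False
    have "quot2 p q \<in> pos_pairs" "q \<in> pos_pairs"
      using that Suc.prems quot2_in_pos_pairs dvd2_in_pos_pairs by blast+
    moreover have "quot2 p q \<noteq> (1, 1)"
      using mult2_quot2[OF that] False by (auto simp: mult2_def)
    ultimately have "weight2 q < n"
      using weight2_quot2[OF Suc.prems(1) that] weight2_pos[of "quot2 p q"] Suc.prems(2) by simp
    then show ?thesis
      using Suc.IH \<open>q \<in> pos_pairs\<close> by simp
  qed
  then show ?case
    using Suc.prems by (simp only: power_Suc coeff_at_times_divisors) (simp add: sum.neutral)
qed simp

text \<open>A Neumann series: scaling the leading coefficient to 1 gives \<open>1 - X\<close> with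
  \<open>X\<close> of positive weight, and only finitely many powers of \<open>X\<close> reach a
  given coefficient.\<close>

lemma formal_inverse_exists:
  assumes "coeff_at D (1, 1) \<noteq> 0"
  obtains G where "D * G = 1"
proof -
  have one: "(1, 1) \<in> pos_pairs"
    by (simp add: mem_pos_pairs)
  define c where "c = dseries (\<lambda>q. if q = (1, 1) then 1 / coeff_at D (1, 1) else 0)"
  define X where "X = 1 - c * D"
  have c: "coeff_at (c * D) p = 1 / coeff_at D (1, 1) * coeff_at D p" if "p \<in> pos_pairs" for p
    using coeff_at_monomial_times_mult2[OF one that, of "1 / coeff_at D (1, 1)" D] by (simp add: c_def mult2_def)
  have X: "coeff_at X (1, 1) = 0"
    unfolding X_def coeff_at_diff using c[OF one] assms by (simp add: coeff_at_one)
  define S where "S n = (\<Sum>i<n. X ^ i)" for n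
  have S: "coeff_at (S n) p = coeff_at (S (Suc (weight2 p))) p" if "p \<in> pos_pairs" "weight2 p < n" for n p
    using that(2)
  proof (induction n)
    case (Suc n)
    show ?case
    proof (cases "weight2 p = n")
      case False
      then have "coeff_at (S n) p = coeff_at (S (Suc (weight2 p))) p" "coeff_at (X ^ n) p = 0"
        using Suc coeff_at_power_eq_0[OF X that(1)] by simp_all
      then show ?thesis
        by (simp add: S_def)
    qed simp
  qed simp
  \<comment> \<open>At \<open>p\<close> the partial sums are stationary from
    \<open>Suc (weight2 p)\<close> on, so \<open>T\<close> is their coefficientwise limit.\<close>
  define T where "T = dseries (\<lambda>p. coeff_at (S (Suc (weight2 p))) p)"
  have "(1 - X) * T = 1"
  proof (rule coeff_at_eqI)
    fix p assume p: "p \<in> pos_pairs"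
    define n where "n = Suc (weight2 p)"
    have "coeff_at T q = coeff_at (S n) q" if "dvd2 q p" for q
    proof -
      have "q \<in> pos_pairs"
        using that p dvd2_in_pos_pairs by blast
      moreover have "weight2 q < n"
        using weight2_quot2[OF p that] by (simp add: n_def)
      ultimately show ?thesis
        using S[of q n] by (simp add: T_def)
    qed
    then have "coeff_at ((1 - X) * T) p = coeff_at ((1 - X) * S n) p"
      using p by (simp add: coeff_at_times_divisors)
    also have "(1 - X) * S n = 1 - X ^ n"
      unfolding S_def by (rule one_diff_power_eq[symmetric])
    also have "coeff_at \<dots> p = coeff_at 1 p"
      using coeff_at_power_eq_0[OF X p, of n] by (simp add: n_def)
    finally show "coeff_at ((1 - X) * T) p = coeff_at 1 p" .
  qed
  then have "D * (c * T) = 1"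
    by (simp add: X_def mult_ac)
  then show thesis
    by (rule that)
qed

section \<open>Fejer means of a multiplier\<close>

text \<open>Truncated subtraction makes the coefficients vanish at weights at least \<open>R\<close>.\<close>

definition fejer :: "nat \<Rightarrow> dirichlet2 \<Rightarrow> dirichlet2" where
  "fejer R D = dseries (\<lambda>p. complex_of_real (real (R - weight2 p) / real R) * coeff_at D p)"

lemma fejer_support: "p \<in> pos_pairs \<Longrightarrow> R \<le> weight2 p \<Longrightarrow> coeff_at (fejer R D) p = 0"
  by (simp add: fejer_def)

lemma coeff_at_fejer_tendsto: "p \<in> pos_pairs \<Longrightarrow> (\<lambda>R. coeff_at (fejer R D) p) \<longlonglongrightarrow> coeff_at D p"
proof -
  assume p: "p \<in> pos_pairs"
  have "(\<lambda>R. 1 - real (weight2 p) / real R) \<longlonglongrightarrow> 1 - 0"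
    by (intro tendsto_intros lim_const_over_n)
  \<comment> \<open>Starting at \<open>Suc (weight2 p)\<close> makes the truncated subtraction exact
    and keeps \<open>R\<close> nonzero.\<close>
  moreover have "\<forall>\<^sub>F R in sequentially. 1 - real (weight2 p) / real R = real (R - weight2 p) / real R"
    using eventually_ge_at_top[of "Suc (weight2 p)"]
    by eventually_elim (simp add: of_nat_diff field_simps)
  ultimately have "(\<lambda>R. real (R - weight2 p) / real R) \<longlonglongrightarrow> 1"
    by (simp add: filterlim_cong)
  then have "(\<lambda>R. complex_of_real (real (R - weight2 p) / real R) * coeff_at D p) \<longlonglongrightarrow> complex_of_real 1 * coeff_at D p"
    by (intro tendsto_intros)
  then show ?thesis
    using p by (simp add: fejer_def)
qed

lemma coeff_at_fejer_times_tendsto: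
  assumes "p \<in> pos_pairs"
  shows "(\<lambda>R. coeff_at (fejer R D * E) p) \<longlonglongrightarrow> coeff_at (D * E) p"
  unfolding coeff_at_times_divisors[OF assms]
proof (intro tendsto_intros)
  fix q assume "q \<in> {q. dvd2 q p}"
  then show "(\<lambda>R. dmat (fejer R D) p q) \<longlonglongrightarrow> dmat D p q"
    using quot2_in_pos_pairs[of q p, OF _ assms] by (auto simp: dmat_def intro!: coeff_at_fejer_tendsto)
qed

text \<open>With \<open>Q\<^sub>s\<close> the projection to the weights in \<open>[s - R, s)\<close>, the Fejer mean of \<open>D\<close> acts as the
  average \<open>1/R \<Sum>\<^sub>s Q\<^sub>s D Q\<^sub>s\<close>, and each index lies in exactly \<open>R\<close> of these windows.\<close>

lemma mult_bound_fejer: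
  assumes D: "mult_bound D C" and R: "0 < R"
  shows "mult_bound (fejer R D) C"
  unfolding mult_bound_def
proof (intro conjI allI impI)
  show C: "0 \<le> C"
    using D by (simp add: mult_bound_def)
  fix E K assume E: "norm_le E K"
  show "norm_le (fejer R D * E) (C * K)"
    unfolding norm_le_def
  proof (intro allI impI)
    fix A :: "(nat \<times> nat) set" assume A: "finite A" "A \<subseteq> pos_pairs"
    define B where "B = divisors2 A"
    have B: "finite B" "B \<subseteq> pos_pairs" "A \<subseteq> B" "\<And>p. p \<in> A \<Longrightarrow> {q. dvd2 q p} \<subseteq> B"
      unfolding B_def
      by (simp_all add: A finite_divisors2 divisors2_subset_pos_pairs subset_divisors2)
        (auto simp: divisors2_def)
    define y where "y = coeff_at (fejer R D * E)"
    \<comment> \<open>A finite range of window positions that contains every \<open>s\<close> whose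
      window meets \<open>B\<close>.\<close>
    define T where "T = {1..Max (weight2 ` B) + R}"
    have T: "s \<in> T" if "p \<in> B" "weight2 p < s" "s \<le> weight2 p + R" for p s
    proof -
      have "weight2 p \<le> Max (weight2 ` B)"
        using that B by (intro Max_ge) auto
      then show ?thesis
        using that by (simp add: T_def)
    qed
    define win where "win s p \<longleftrightarrow> weight2 p < s \<and> s \<le> weight2 p + R" for s p
    have card_win: "card {s \<in> T. win s p} = R" if "p \<in> B" for p
    proof -
      have "{s \<in> T. win s p} = {weight2 p<..weight2 p + R}"
        using T[OF that] by (auto simp: win_def)
      then show ?thesis
        by simp
    qed
    define x where "x s = dseries (\<lambda>q. if q \<in> B \<and> win s q then coeff_at E q else 0)" for s
    have x_bound: "norm_le (x s) (norm_on (\<lambda>q. if win s q then coeff_at E q else 0) B)" for s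
    proof -
      have "norm_on (coeff_at (x s)) B = norm_on (\<lambda>q. if win s q then coeff_at E q else 0) B"
        using B by (intro L2_set_cong) (auto simp: x_def)
      then show ?thesis
        using norm_le_finite_support[of B "x s"] B(1) by (simp add: x_def)
    qed
    have sum_win: "(\<Sum>s\<in>T. (norm_on (\<lambda>q. if win s q then f q else 0) S)\<^sup>2) = R * (norm_on f S)\<^sup>2"
      if "S \<subseteq> B" for f :: "nat \<times> nat \<Rightarrow> complex" and S
    proof -
      have "(\<Sum>s\<in>T. (norm_on (\<lambda>q. if win s q then f q else 0) S)\<^sup>2)
          = (\<Sum>q\<in>S. \<Sum>s\<in>T. if win s q then (cmod (f q))\<^sup>2 else 0)"
        unfolding norm_on_power2 by (subst sum.swap) (auto intro!: sum.cong)
      also have "\<dots> = (\<Sum>q\<in>S. R * (cmod (f q))\<^sup>2)"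
        using that card_win by (intro sum.cong) (auto simp: T_def simp flip: sum.inter_filter)
      finally show ?thesis
        by (simp add: norm_on_power2 sum_distrib_left)
    qed
    \<comment> \<open>The factor \<open>R\<close> turns the Fejer coefficient into an integer, which
      is then read as a number of common windows.\<close>
    have "R * (\<Sum>p\<in>A. y p * cnj (y p)) = (\<Sum>p\<in>A. \<Sum>q\<in>B. R * dmat (fejer R D) p q * coeff_at E q * cnj (y p))"
    proof -
      have "y p = (\<Sum>q\<in>B. dmat (fejer R D) p q * coeff_at E q)" if "p \<in> A" for p
        unfolding y_def using that A B by (intro coeff_at_times) auto
      then have "y p * cnj (y p) = (\<Sum>q\<in>B. dmat (fejer R D) p q * coeff_at E q) * cnj (y p)" if "p \<in> A" for p
        using that by (intro arg_cong[of _ _ "\<lambda>z. z * cnj (y p)"])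
      then have "(\<Sum>p\<in>A. y p * cnj (y p)) = (\<Sum>p\<in>A. (\<Sum>q\<in>B. dmat (fejer R D) p q * coeff_at E q) * cnj (y p))"
        by (rule sum.cong[OF refl])
      then show ?thesis
        by (simp only: sum_distrib_left sum_distrib_right mult.assoc)
    qed
    also have "\<dots> = (\<Sum>p\<in>A. \<Sum>q\<in>B. \<Sum>s\<in>T. (if win s p \<and> win s q then dmat D p q * coeff_at E q * cnj (y p) else 0))"
    proof (intro sum.cong refl)
      fix p q assume pq: "p \<in> A" "q \<in> B"
      show "R * dmat (fejer R D) p q * coeff_at E q * cnj (y p)
          = (\<Sum>s\<in>T. (if win s p \<and> win s q then dmat D p q * coeff_at E q * cnj (y p) else 0))"
      proof (cases "dvd2 q p")
        case True
        have p: "p \<in> pos_pairs" "p \<in> B"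
          using pq A B by auto
        have w: "weight2 p = weight2 (quot2 p q) + weight2 q"
          using weight2_quot2[OF p(1) True] .
        \<comment> \<open>The windows containing both weights number \<open>R\<close> minus the
          distance of the weights, or none if that distance is at least \<open>R\<close>: precisely
          the Fejer coefficient before division by \<open>R\<close>.\<close>
        have "{s \<in> T. win s p \<and> win s q} = {weight2 p<..weight2 q + R}"
          using T[OF p(2)] w by (auto simp: win_def)
        then have card: "card {s \<in> T. win s p \<and> win s q} = R - weight2 (quot2 p q)"
          using w by simp
        have "R * dmat (fejer R D) p q = complex_of_real (R - weight2 (quot2 p q)) * dmat D p q"
          using True R quot2_in_pos_pairs[OF True p(1)] by (simp add: dmat_def fejer_def)
        then show ?thesis
          using card by (simp add: T_def flip: sum.inter_filter)
      qed (simp add: dmat_def cong: if_cong)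
    qed
    also have "\<dots> = (\<Sum>s\<in>T. \<Sum>p\<in>A. \<Sum>q\<in>B. (if win s p \<and> win s q then dmat D p q * coeff_at E q * cnj (y p) else 0))"
      by (subst sum.swap, subst (2) sum.swap) (rule refl)
    also have "\<dots> = (\<Sum>s\<in>T. \<Sum>p\<in>A. coeff_at (D * x s) p * cnj (if win s p then y p else 0))"
    proof (intro sum.cong refl)
      fix s p assume p: "p \<in> A"
      have "coeff_at (D * x s) p = (\<Sum>q\<in>B. dmat D p q * coeff_at (x s) q)"
        using p A B by (intro coeff_at_times) auto
      also have "\<dots> = (\<Sum>q\<in>B. if win s q then dmat D p q * coeff_at E q else 0)"
        using B by (intro sum.cong) (auto simp: x_def)
      finally show "(\<Sum>q\<in>B. (if win s p \<and> win s q then dmat D p q * coeff_at E q * cnj (y p) else 0))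
          = coeff_at (D * x s) p * cnj (if win s p then y p else 0)"
        by (auto simp: sum_distrib_right intro!: sum.cong)
    qed
    finally have "cmod (R * (\<Sum>p\<in>A. y p * cnj (y p)))
        \<le> (\<Sum>s\<in>T. cmod (\<Sum>p\<in>A. coeff_at (D * x s) p * cnj (if win s p then y p else 0)))"
      by (simp only: norm_sum)
    also have "\<dots> \<le> (\<Sum>s\<in>T. \<bar>C * norm_on (\<lambda>q. if win s q then coeff_at E q else 0) B\<bar> * \<bar>norm_on (\<lambda>q. if win s q then y q else 0) A\<bar>)"
    proof (rule sum_mono)
      fix s assume "s \<in> T"
      have "cmod (\<Sum>p\<in>A. coeff_at (D * x s) p * cnj (if win s p then y p else 0))
          \<le> norm_on (coeff_at (D * x s)) A * norm_on (\<lambda>p. cnj (if win s p then y p else 0)) A"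
        by (rule norm_on_mult_ineq)
      also have "\<dots> = norm_on (coeff_at (D * x s)) A * norm_on (\<lambda>p. if win s p then y p else 0) A"
        by (simp only: complex_mod_cnj)
      also have "norm_on (coeff_at (D * x s)) A \<le> C * norm_on (\<lambda>q. if win s q then coeff_at E q else 0) B"
        using D x_bound[of s] A unfolding mult_bound_def by (intro norm_leD) auto
      finally show "cmod (\<Sum>p\<in>A. coeff_at (D * x s) p * cnj (if win s p then y p else 0))
          \<le> \<bar>C * norm_on (\<lambda>q. if win s q then coeff_at E q else 0) B\<bar> * \<bar>norm_on (\<lambda>q. if win s q then y q else 0) A\<bar>"
        using C by (simp add: mult_right_mono)
    qed
    \<comment> \<open>Cauchy-Schwarz over the windows: both families of squared norms sum to
      \<open>R\<close> times a full norm, so one factor \<open>R\<close> results and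
      cancels.\<close>
    also have "\<dots> \<le> L2_set (\<lambda>s. C * norm_on (\<lambda>q. if win s q then coeff_at E q else 0) B) T
        * L2_set (\<lambda>s. norm_on (\<lambda>q. if win s q then y q else 0) A) T"
      by (rule L2_set_mult_ineq)
    also have "\<dots> = C * sqrt (R * (norm_on (coeff_at E) B)\<^sup>2) * sqrt (R * (norm_on y A)\<^sup>2)"
      by (simp only: L2_set_right_distrib[OF C, symmetric])
        (simp add: L2_set_def[of _ T] sum_win B)
    also have "\<dots> = R * (C * norm_on (coeff_at E) B * norm_on y A)"
      by (simp add: real_sqrt_mult)
    finally have "cmod (\<Sum>p\<in>A. y p * cnj (y p)) \<le> C * norm_on (coeff_at E) B * norm_on y A"
      using R by (simp add: norm_mult)
    also have "\<dots> \<le> C * K * norm_on y A"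
      using norm_leD[OF E B(1,2)] C by (intro mult_right_mono mult_left_mono) auto
    finally show "norm_on (coeff_at (fejer R D * E)) A \<le> C * K"
      unfolding y_def using C norm_le_nonneg[OF E] by (intro norm_on_le_of_pairing) auto
  qed
qed

section \<open>The Hilbert space structure of \<open>L\<^sup>2(I\<^sup>2)\<close>\<close>

abbreviation MI :: "(real \<times> real) measure" where
  "MI \<equiv> restrict_space lborel I2"

lemma open_I2: "open I2"
  unfolding I2_def by (intro open_Times) auto

lemma I2_borel [measurable]: "I2 \<in> sets borel"
  using open_I2 by simp

lemma space_MI [simp]: "space MI = I2"
  by (simp add: space_restrict_space)

interpretation MI: finite_measure MI
proof (rule finite_measureI)
  have "bounded I2"
    unfolding I2_def by (intro bounded_Times) auto
  then have "emeasure lborel I2 < \<infinity>"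
    by (rule emeasure_bounded_finite)
  then show "emeasure MI (space MI) \<noteq> \<infinity>"
    by (simp add: emeasure_restrict_space)
qed

lemma borel_measurable_cnj [measurable]: "cnj \<in> borel_measurable borel"
  by (intro borel_measurable_continuous_onI continuous_intros)

lemma L2D: "f \<in> L2 \<Longrightarrow> f \<in> borel_measurable MI" "f \<in> L2 \<Longrightarrow> integrable MI (\<lambda>z. (cmod (f z))\<^sup>2)"
  by (simp_all add: L2_def)

lemma L2_dominated:
  assumes "f \<in> borel_measurable MI" "integrable MI (\<lambda>z. (w z)\<^sup>2)" "\<And>z. z \<in> I2 \<Longrightarrow> cmod (f z) \<le> w z"
  shows "f \<in> L2"
proof -
  have "integrable MI (\<lambda>z. (cmod (f z))\<^sup>2)"
  proof (rule Bochner_Integration.integrable_bound[OF assms(2)])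
    show "(\<lambda>z. (cmod (f z))\<^sup>2) \<in> borel_measurable MI"
      using assms(1) by measurable
    show "AE z in MI. norm ((cmod (f z))\<^sup>2) \<le> norm ((w z)\<^sup>2)"
      using assms(3) by (intro AE_I2) (auto intro!: power_mono)
  qed
  then show ?thesis
    using assms(1) by (simp add: L2_def)
qed

lemma L2_bounded:
  assumes "f \<in> borel_measurable MI" "\<And>z. z \<in> I2 \<Longrightarrow> cmod (f z) \<le> C"
  shows "f \<in> L2"
  by (rule L2_dominated[of f "\<lambda>_. C"]) (use assms in auto)

lemma L2_inner_integrable:
  assumes "f \<in> L2" "g \<in> L2"
  shows "integrable MI (\<lambda>z. f z * cnj (g z))"
proof (rule Bochner_Integration.integrable_bound)
  show "integrable MI (\<lambda>z. (cmod (f z))\<^sup>2 + (cmod (g z))\<^sup>2)"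
    using assms by (simp add: L2_def)
  show "(\<lambda>z. f z * cnj (g z)) \<in> borel_measurable MI"
    using L2D(1)[OF assms(1)] L2D(1)[OF assms(2)] by measurable
  have "norm (f z * cnj (g z)) \<le> norm ((cmod (f z))\<^sup>2 + (cmod (g z))\<^sup>2)" for z
  proof -
    have "2 * (cmod (f z) * cmod (g z)) \<le> (cmod (f z))\<^sup>2 + (cmod (g z))\<^sup>2"
      using sum_squares_bound[of "cmod (f z)" "cmod (g z)"] by simp
    moreover have "0 \<le> cmod (f z) * cmod (g z)"
      by simp
    ultimately show ?thesis
      unfolding norm_mult complex_mod_cnj real_norm_def by linarith
  qed
  then show "AE z in MI. norm (f z * cnj (g z)) \<le> norm ((cmod (f z))\<^sup>2 + (cmod (g z))\<^sup>2)"
    by simp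
qed

lemma L2_cmult: "f \<in> L2 \<Longrightarrow> (\<lambda>z. c * f z) \<in> L2"
  by (auto simp: L2_def norm_mult power_mult_distrib)

lemma L2_add:
  assumes "f \<in> L2" "g \<in> L2"
  shows "(\<lambda>z. f z + g z) \<in> L2"
proof -
  have *: "integrable MI (\<lambda>z. 2 * (cmod (f z))\<^sup>2 + 2 * (cmod (g z))\<^sup>2)"
    using assms by (simp add: L2_def)
  have "integrable MI (\<lambda>z. (cmod (f z + g z))\<^sup>2)"
  proof (rule Bochner_Integration.integrable_bound[OF *])
    show "(\<lambda>z. (cmod (f z + g z))\<^sup>2) \<in> borel_measurable MI"
      using L2D(1)[OF assms(1)] L2D(1)[OF assms(2)] by measurable
    have "(cmod (f z + g z))\<^sup>2 \<le> 2 * (cmod (f z))\<^sup>2 + 2 * (cmod (g z))\<^sup>2" for z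
    proof -
      have "(cmod (f z + g z))\<^sup>2 \<le> (cmod (f z) + cmod (g z))\<^sup>2"
        by (intro power_mono norm_triangle_ineq norm_ge_zero)
      also have "\<dots> \<le> 2 * (cmod (f z))\<^sup>2 + 2 * (cmod (g z))\<^sup>2"
        using sum_squares_bound[of "cmod (f z)" "cmod (g z)"] by (simp add: power2_sum)
      finally show ?thesis .
    qed
    then show "AE z in MI. norm ((cmod (f z + g z))\<^sup>2) \<le> norm (2 * (cmod (f z))\<^sup>2 + 2 * (cmod (g z))\<^sup>2)"
      by simp
  qed
  then show ?thesis
    using borel_measurable_add[OF L2D(1)[OF assms(1)] L2D(1)[OF assms(2)]] by (simp add: L2_def)
qed

lemma L2_diff: "f \<in> L2 \<Longrightarrow> g \<in> L2 \<Longrightarrow> (\<lambda>z. f z - g z) \<in> L2"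
  using L2_add[OF _ L2_cmult[of g "-1"]] by simp

lemma L2_sum: "finite A \<Longrightarrow> (\<And>i. i \<in> A \<Longrightarrow> f i \<in> L2) \<Longrightarrow> (\<lambda>z. \<Sum>i\<in>A. f i z) \<in> L2"
proof (induction A rule: finite_induct)
  case empty
  then show ?case
    by (simp add: L2_def)
qed (simp add: L2_add)

lemma L2_inner_add_left:
  "f \<in> L2 \<Longrightarrow> g \<in> L2 \<Longrightarrow> h \<in> L2 \<Longrightarrow> L2_inner (\<lambda>z. f z + g z) h = L2_inner f h + L2_inner g h"
  unfolding L2_inner_def by (simp add: distrib_right L2_inner_integrable)

lemma L2_inner_cmult_left: "L2_inner (\<lambda>z. c * f z) h = c * L2_inner f h"
  unfolding L2_inner_def by (simp add: mult.assoc)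

lemma L2_inner_diff_left:
  "f \<in> L2 \<Longrightarrow> g \<in> L2 \<Longrightarrow> h \<in> L2 \<Longrightarrow> L2_inner (\<lambda>z. f z - g z) h = L2_inner f h - L2_inner g h"
  unfolding L2_inner_def by (simp add: left_diff_distrib L2_inner_integrable)

lemma L2_inner_sum_left:
  "(\<And>i. i \<in> A \<Longrightarrow> f i \<in> L2) \<Longrightarrow> h \<in> L2 \<Longrightarrow>
    L2_inner (\<lambda>z. \<Sum>i\<in>A. c i * f i z) h = (\<Sum>i\<in>A. c i * L2_inner (f i) h)"
  unfolding L2_inner_def
  by (simp add: sum_distrib_right mult.assoc L2_inner_integrable Bochner_Integration.integral_sum)

lemma L2_inner_cnj: "L2_inner g f = cnj (L2_inner f g)"
  unfolding L2_inner_def Bochner_Integration.integral_cnj[symmetric]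
  by (simp add: mult.commute del: Bochner_Integration.integral_cnj)

lemma sqrt_2_mult: "(sqrt 2 * a) * (sqrt 2 * b) = 2 * (a * b)"
  by (simp add: mult.assoc mult.left_commute[of a] flip: mult.assoc[of "sqrt 2" "sqrt 2"])

lemma L2_inner_sum_right:
  assumes "\<And>i. i \<in> A \<Longrightarrow> f i \<in> L2" "h \<in> L2"
  shows "L2_inner h (\<lambda>z. \<Sum>i\<in>A. c i * f i z) = (\<Sum>i\<in>A. cnj (c i) * L2_inner h (f i))"
proof -
  have "L2_inner h (\<lambda>z. \<Sum>i\<in>A. c i * f i z) = cnj (\<Sum>i\<in>A. c i * L2_inner (f i) h)"
    using assms by (subst L2_inner_cnj) (simp only: L2_inner_sum_left)
  also have "\<dots> = (\<Sum>i\<in>A. cnj (c i) * L2_inner h (f i))"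
    by (simp add: L2_inner_cnj[of h])
  finally show ?thesis .
qed

lemma L2_norm_nonneg [simp]: "0 \<le> L2_norm f"
  by (simp add: L2_norm_def)

lemma L2_norm_power2: "(L2_norm f)\<^sup>2 = (LINT z|MI. (cmod (f z))\<^sup>2)"
  by (simp add: L2_norm_def)

lemma L2_inner_self: "L2_inner f f = complex_of_real ((L2_norm f)\<^sup>2)"
  unfolding L2_norm_power2 L2_inner_def
  by (simp flip: complex_norm_square of_real_power)

text \<open>Used twice: with variable \<open>c\<close> for the Cauchy-Schwarz inequality, and with
  \<open>c = 1\<close> for the distance to a finite section.\<close>

lemma L2_norm_diff_scaled:
  assumes "f \<in> L2" "g \<in> L2"
  shows "(L2_norm (\<lambda>z. f z - c * g z))\<^sup>2
    = (L2_norm f)\<^sup>2 - 2 * Re (cnj c * L2_inner f g) + (cmod c)\<^sup>2 * (L2_norm g)\<^sup>2"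
proof -
  have L: "(\<lambda>z. c * g z) \<in> L2" "(\<lambda>z. f z - c * g z) \<in> L2"
    using assms by (simp_all add: L2_cmult L2_diff)
  have r: "L2_inner h (\<lambda>z. f z - c * g z) = L2_inner h f - cnj c * L2_inner h g" if "h \<in> L2" for h
    using assms L that
    by (subst (1 2 3) L2_inner_cnj) (simp add: L2_inner_diff_left L2_inner_cmult_left)
  have "complex_of_real ((L2_norm (\<lambda>z. f z - c * g z))\<^sup>2)
      = L2_inner f f - cnj c * L2_inner f g - c * (L2_inner g f - cnj c * L2_inner g g)"
    using assms L unfolding L2_inner_self[symmetric]
    by (simp add: L2_inner_diff_left L2_inner_cmult_left r)
  also have "\<dots> = L2_inner f f - (cnj c * L2_inner f g + cnj (cnj c * L2_inner f g)) + (c * cnj c) * L2_inner g g"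
    by (simp add: L2_inner_cnj[of g f] algebra_simps)
  also have "\<dots> = complex_of_real ((L2_norm f)\<^sup>2 - 2 * Re (cnj c * L2_inner f g) + (cmod c)\<^sup>2 * (L2_norm g)\<^sup>2)"
    by (simp only: L2_inner_self complex_add_cnj complex_norm_square[symmetric]) simp
  finally show ?thesis
    by (simp only: of_real_eq_iff)
qed

text \<open>Choosing the scalar as a real multiple \<open>t\<close> of \<open>L2_inner f g\<close>
  makes the cross term real, leaving a nonnegative real quadratic in \<open>t\<close>.\<close>

lemma L2_Cauchy_Schwarz:
  assumes "f \<in> L2" "g \<in> L2"
  shows "cmod (L2_inner f g) \<le> L2_norm f * L2_norm g"
proof -
  define a where "a = (cmod (L2_inner f g))\<^sup>2"
  have key: "0 \<le> (L2_norm f)\<^sup>2 - 2 * t * a + t\<^sup>2 * a * (L2_norm g)\<^sup>2" for t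
  proof -
    have "0 \<le> (L2_norm (\<lambda>z. f z - (of_real t * L2_inner f g) * g z))\<^sup>2"
      by simp
    also have "\<dots> = (L2_norm f)\<^sup>2 - 2 * Re (of_real t * (L2_inner f g * cnj (L2_inner f g))) + t\<^sup>2 * a * (L2_norm g)\<^sup>2"
      unfolding L2_norm_diff_scaled[OF assms] by (simp add: a_def norm_mult power_mult_distrib mult_ac)
    also have "of_real t * (L2_inner f g * cnj (L2_inner f g)) = complex_of_real (t * a)"
      unfolding a_def of_real_mult complex_norm_square ..
    finally show ?thesis
      by simp
  qed
  have "a \<le> (L2_norm f)\<^sup>2 * (L2_norm g)\<^sup>2"
  proof (cases "L2_norm g = 0")
    case True
    have "a = 0"
    proof (rule ccontr)
      assume "a \<noteq> 0"
      then have "a > 0"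
        by (simp add: a_def)
      \<comment> \<open>For \<open>L2_norm g = 0\<close> the quadratic is linear in
        \<open>t\<close>; this value of \<open>t\<close> makes it equal to -1.\<close>
      then show False
        using key[of "((L2_norm f)\<^sup>2 + 1) / (2 * a)"] True by (simp add: field_simps)
    qed
    then show ?thesis
      by simp
  next
    case False
    then have pos: "(L2_norm g)\<^sup>2 > 0"
      by simp
    \<comment> \<open>The value \<open>1 / (L2_norm g)\<^sup>2\<close> of \<open>t\<close> minimises
      the quadratic when \<open>a\<close> is positive.\<close>
    have "0 \<le> (L2_norm f)\<^sup>2 - 2 * (1 / (L2_norm g)\<^sup>2) * a + (1 / (L2_norm g)\<^sup>2)\<^sup>2 * a * (L2_norm g)\<^sup>2"
      by (rule key)
    also have "(1 / (L2_norm g)\<^sup>2)\<^sup>2 * a * (L2_norm g)\<^sup>2 = a / (L2_norm g)\<^sup>2"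
    proof -
      have "(1 / N)\<^sup>2 * a * N = a / N" if "N \<noteq> 0" for N :: real
        using that by (simp add: power2_eq_square)
      then show ?thesis
        using False by simp
    qed
    finally have "0 \<le> (L2_norm f)\<^sup>2 - a / (L2_norm g)\<^sup>2"
      by simp
    then show ?thesis
      using pos by (simp add: field_simps)
  qed
  then have "(cmod (L2_inner f g))\<^sup>2 \<le> (L2_norm f * L2_norm g)\<^sup>2"
    by (simp add: a_def power_mult_distrib)
  then show ?thesis
    by (rule power2_le_imp_le) simp
qed

section \<open>Orthonormality of the sine basis\<close>

text \<open>The frequency is an integer because the product-to-sum formula produces differences of
  frequencies of either sign.\<close>

lemma integral_cos_int: "(LBINT x:{0<..<1}. cos (pi * of_int j * x)) = (if j = 0 then 1 else 0)"
proof -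
  have *: "(LBINT x:{0<..<1}. f x) = F 1 - F 0"
    if "\<And>x. (F has_vector_derivative f x) (at x)" "continuous_on UNIV f" for f F :: "real \<Rightarrow> real"
  proof -
    have "(LBINT x=ereal 0..ereal 1. f x) = F 1 - F 0"
    proof (rule interval_integral_FTC_finite)
      show "continuous_on {min 0 1..max 0 1} f"
        using that(2) continuous_on_subset by blast
      show "(F has_vector_derivative f x) (at x within {min 0 1..max 0 1})" for x
        using that(1) has_vector_derivative_at_within by blast
    qed
    then show ?thesis
      by (simp add: interval_integral_Ioo)
  qed
  show ?thesis
  proof (cases "j = 0")
    case True
    have "(LBINT x:{0<..<1::real}. 1::real) = 1 - 0"
      by (rule *[where F = "\<lambda>x. x" and f = "\<lambda>_. 1"]) (auto intro!: derivative_eq_intros)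
    then show ?thesis
      using True by simp
  next
    case False
    let ?F = "\<lambda>x. sin (pi * of_int j * x) / (pi * of_int j)"
    have "(LBINT x:{0<..<1}. cos (pi * of_int j * x)) = ?F 1 - ?F 0"
    proof (rule *)
      show "(?F has_vector_derivative cos (pi * of_int j * x)) (at x)" for x
        unfolding has_real_derivative_iff_has_vector_derivative[symmetric]
        using False by (auto intro!: derivative_eq_intros)
    qed (intro continuous_intros)
    then show ?thesis
      using False by (simp add: sin_npi_int)
  qed
qed

lemma integrable_Ioo_continuous: "continuous_on UNIV f \<Longrightarrow> set_integrable lborel {0<..<1::real} (f :: real \<Rightarrow> real)"
  by (rule set_integrable_subset[of _ "{0..1}"])
    (auto intro!: borel_integrable_atLeastAtMost' continuous_on_subset[of UNIV f])

lemma integral_sin_sin: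
  assumes "0 < m" "0 < (k::nat)"
  shows "(LBINT x:{0<..<1}. (sqrt 2 * sin (pi * real m * x)) * (sqrt 2 * sin (pi * real k * x)))
    = (if m = k then 1 else 0)"
proof -
  have "(sqrt 2 * sin (pi * real m * x)) * (sqrt 2 * sin (pi * real k * x))
      = cos (pi * of_int (int m - int k) * x) - cos (pi * of_int (int m + int k) * x)" for x
    unfolding sqrt_2_mult
    using sin_times_sin[of "pi * real m * x" "pi * real k * x"] by (simp add: algebra_simps)
  then have "(LBINT x:{0<..<1}. (sqrt 2 * sin (pi * real m * x)) * (sqrt 2 * sin (pi * real k * x)))
    = (LBINT x:{0<..<1}. cos (pi * of_int (int m - int k) * x)) - (LBINT x:{0<..<1}. cos (pi * of_int (int m + int k) * x))"
    by (simp only:) (intro set_integral_diff integrable_Ioo_continuous continuous_intros)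
  then show ?thesis
    using assms unfolding integral_cos_int by auto
qed

lemma integral_MI_product:
  assumes "continuous_on UNIV u" "continuous_on UNIV v" "\<And>x. \<bar>u x\<bar> \<le> C" "\<And>x. \<bar>v x\<bar> \<le> D"
  shows "(LINT z|MI. u (fst z) * v (snd z) :: real) = (LBINT x:{0<..<1}. u x) * (LBINT y:{0<..<1}. v y)"
proof -
  have [measurable]: "u \<in> borel_measurable borel" "v \<in> borel_measurable borel"
    using assms by (auto intro: borel_measurable_continuous_onI)
  have m: "(\<lambda>z::real\<times>real. u (fst z) * v (snd z)) \<in> borel_measurable borel"
    by (simp add: borel_prod[symmetric])
  have b: "\<bar>u (fst z) * v (snd z)\<bar> \<le> C * D" for z
    using assms(3)[of "fst z"] assms(4)[of "snd z"] order_trans[OF abs_ge_zero assms(3)]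
    unfolding abs_mult by (intro mult_mono) auto
  have "integrable MI (\<lambda>z. u (fst z) * v (snd z))"
    by (rule MI.integrable_const_bound[where B = "C * D"])
      (use m b in \<open>auto intro: measurable_restrict_space1\<close>)
  then have *: "integrable lborel (\<lambda>z. indicator I2 z *\<^sub>R (u (fst z) * v (snd z)))"
    by (simp add: integrable_restrict_space)
  let ?U = "\<lambda>x. indicator {0<..<1} x *\<^sub>R u x" and ?V = "\<lambda>x. indicator {0<..<1} x *\<^sub>R v x"
  have eq: "indicator I2 (x, y) *\<^sub>R (u x * v y) = ?U x * ?V y" for x y
    by (auto simp: I2_def indicator_def)
  have "(LINT z|MI. u (fst z) * v (snd z)) = (LINT z|lborel. indicator I2 z *\<^sub>R (u (fst z) * v (snd z)))"
    by (simp add: integral_restrict_space)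
  also have "\<dots> = (LINT x|lborel. LINT y|lborel. indicator I2 (x, y) *\<^sub>R (u x * v y))"
    using * unfolding lborel_prod[symmetric]
    by (subst lborel_pair.integral_fst'[symmetric]) simp_all
  also have "\<dots> = (LINT x|lborel. LINT y|lborel. ?U x * ?V y)"
    by (simp only: eq)
  also have "\<dots> = (LINT x|lborel. ?U x) * (LINT y|lborel. ?V y)"
    by simp
  finally show ?thesis
    by (simp add: set_lebesgue_integral_def)
qed

abbreviation basis_at :: "nat \<times> nat \<Rightarrow> real \<times> real \<Rightarrow> complex" where
  "basis_at p \<equiv> basis_fun (fst p) (snd p)"

lemma continuous_basis_fun: "continuous_on UNIV (basis_fun m n)"
  unfolding basis_fun_def case_prod_unfold by (intro continuous_intros)

lemma basis_fun_L2: "basis_fun m n \<in> L2"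
proof (rule L2_bounded[where C = 2])
  show "basis_fun m n \<in> borel_measurable MI"
    using continuous_basis_fun
    by (intro measurable_restrict_space1) (simp add: borel_measurable_continuous_onI)
  fix z
  have "\<bar>sin (pi * real m * fst z)\<bar> * \<bar>sin (pi * real n * snd z)\<bar> \<le> 1 * 1"
    by (intro mult_mono) auto
  then show "cmod (basis_fun m n z) \<le> 2"
    by (simp add: basis_fun_def case_prod_unfold sqrt_2_mult norm_mult abs_mult flip: of_real_mult)
qed

lemma basis_fun_orthonormal:
  assumes "p \<in> pos_pairs" "q \<in> pos_pairs"
  shows "L2_inner (basis_at p) (basis_at q) = (if p = q then 1 else 0)"
proof -
  let ?s = "\<lambda>k x. sqrt 2 * sin (pi * real k * x)"
  have b: "\<bar>?s m x * ?s k x\<bar> \<le> 2" for m k x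
  proof -
    have "\<bar>sin (pi * real m * x)\<bar> * \<bar>sin (pi * real k * x)\<bar> \<le> 1 * 1"
      by (intro mult_mono) auto
    then show ?thesis
      by (simp add: sqrt_2_mult abs_mult)
  qed
  have "L2_inner (basis_at p) (basis_at q)
      = (LINT z|MI. complex_of_real ((?s (fst p) (fst z) * ?s (fst q) (fst z)) * (?s (snd p) (snd z) * ?s (snd q) (snd z))))"
    unfolding L2_inner_def basis_fun_def case_prod_unfold
    by (intro Bochner_Integration.integral_cong refl) (simp only: complex_cnj_complex_of_real complex_cnj_mult of_real_mult mult_ac)
  also have "\<dots> = complex_of_real (LINT z|MI. (?s (fst p) (fst z) * ?s (fst q) (fst z)) * (?s (snd p) (snd z) * ?s (snd q) (snd z)))"
    by (rule integral_complex_of_real)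
  also have "(LINT z|MI. (?s (fst p) (fst z) * ?s (fst q) (fst z)) * (?s (snd p) (snd z) * ?s (snd q) (snd z)))
      = (if p = q then 1 else 0)"
    using assms b by (subst integral_MI_product[where C = 2 and D = 2])
      (auto intro!: continuous_intros simp: integral_sin_sin mem_pos_pairs prod_eq_iff)
  finally show ?thesis
    by simp
qed

definition fourier :: "(real \<times> real \<Rightarrow> complex) \<Rightarrow> nat \<times> nat \<Rightarrow> complex" where
  "fourier f p = L2_inner f (basis_at p)"

lemma fourier_basis_fun: "p \<in> pos_pairs \<Longrightarrow> q \<in> pos_pairs \<Longrightarrow> fourier (basis_at p) q = (if p = q then 1 else 0)"
  by (simp add: fourier_def basis_fun_orthonormal)

lemma fourier_diff: "f \<in> L2 \<Longrightarrow> g \<in> L2 \<Longrightarrow> fourier (\<lambda>z. f z - g z) p = fourier f p - fourier g p"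
  by (simp add: fourier_def L2_inner_diff_left basis_fun_L2)

lemma fourier_sum:
  "(\<And>i. i \<in> A \<Longrightarrow> f i \<in> L2) \<Longrightarrow> fourier (\<lambda>z. \<Sum>i\<in>A. c i * f i z) p = (\<Sum>i\<in>A. c i * fourier (f i) p)"
  by (simp add: fourier_def L2_inner_sum_left basis_fun_L2)

lemma fourier_sum_basis:
  assumes "finite A" "A \<subseteq> pos_pairs" "q \<in> pos_pairs"
  shows "fourier (\<lambda>z. \<Sum>p\<in>A. c p * basis_at p z) q = (if q \<in> A then c q else 0)"
proof -
  have "fourier (\<lambda>z. \<Sum>p\<in>A. c p * basis_at p z) q = (\<Sum>p\<in>A. c p * fourier (basis_at p) q)"
    by (rule fourier_sum) (simp add: basis_fun_L2)
  also have "\<dots> = (\<Sum>p\<in>A. if q = p then c q else 0)"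
    using assms by (intro sum.cong) (auto simp: fourier_basis_fun subsetD)
  finally show ?thesis
    using assms by simp
qed

lemma L2_sum_basis: "finite A \<Longrightarrow> (\<lambda>z. \<Sum>p\<in>A. c p * basis_at p z) \<in> L2"
  by (intro L2_sum L2_cmult basis_fun_L2)

lemma L2_inner_sum_basis:
  "f \<in> L2 \<Longrightarrow> L2_inner f (\<lambda>z. \<Sum>p\<in>A. c p * basis_at p z) = (\<Sum>p\<in>A. fourier f p * cnj (c p))"
  by (subst L2_inner_sum_right) (auto simp: basis_fun_L2 fourier_def mult.commute)

lemma L2_norm_sum_basis:
  assumes "finite A" "A \<subseteq> pos_pairs"
  shows "L2_norm (\<lambda>z. \<Sum>p\<in>A. c p * basis_at p z) = norm_on c A"
proof -
  let ?h = "\<lambda>z. \<Sum>p\<in>A. c p * basis_at p z"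
  have "L2_inner ?h ?h = (\<Sum>p\<in>A. fourier ?h p * cnj (c p))"
    using assms by (intro L2_inner_sum_basis L2_sum_basis)
  also have "\<dots> = (\<Sum>p\<in>A. c p * cnj (c p))"
    using assms by (intro sum.cong) (auto simp: fourier_sum_basis subsetD)
  finally have "(L2_norm ?h)\<^sup>2 = (norm_on c A)\<^sup>2"
    unfolding L2_inner_self sum_mult_cnj of_real_eq_iff .
  then show ?thesis
    by (simp add: power2_eq_iff_nonneg)
qed

lemma Bessel_inequality:
  assumes "f \<in> L2" "finite A" "A \<subseteq> pos_pairs"
  shows "norm_on (fourier f) A \<le> L2_norm f"
proof (rule norm_on_le_of_pairing)
  have "(\<Sum>p\<in>A. fourier f p * cnj (fourier f p)) = L2_inner f (\<lambda>z. \<Sum>p\<in>A. fourier f p * basis_at p z)"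
    using assms by (simp add: L2_inner_sum_basis)
  also have "cmod \<dots> \<le> L2_norm f * norm_on (fourier f) A"
    using L2_Cauchy_Schwarz[OF assms(1) L2_sum_basis[OF assms(2)]] assms by (simp add: L2_norm_sum_basis)
  finally show "cmod (\<Sum>p\<in>A. fourier f p * cnj (fourier f p)) \<le> L2_norm f * norm_on (fourier f) A" .
qed simp

section \<open>Completeness of the sine basis\<close>

text \<open>Completeness is expressed by the sesquilinear identity against all \<open>g\<close>. As
  this property is linear in \<open>f\<close> and survives limits, it can be carried from the sines
  to all of \<open>L2\<close>.\<close>

definition Parseval :: "(real \<times> real \<Rightarrow> complex) set" where
  "Parseval = {f \<in> L2. \<forall>g\<in>L2. ((\<lambda>p. fourier f p * cnj (fourier g p)) has_sum L2_inner f g) pos_pairs}"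

lemma Parseval_L2: "f \<in> Parseval \<Longrightarrow> f \<in> L2"
  by (simp add: Parseval_def)

lemma Parseval_basis_fun:
  assumes "p \<in> pos_pairs"
  shows "basis_at p \<in> Parseval"
  unfolding Parseval_def
proof (intro CollectI conjI ballI)
  fix g assume g: "g \<in> L2"
  have "((\<lambda>q. fourier (basis_at p) q * cnj (fourier g q)) has_sum (\<Sum>q\<in>{p}. fourier (basis_at p) q * cnj (fourier g q))) pos_pairs"
    by (rule has_sum_finite_neutralI[of "{p}"]) (use assms in \<open>auto simp: fourier_basis_fun\<close>)
  also have "(\<Sum>q\<in>{p}. fourier (basis_at p) q * cnj (fourier g q)) = L2_inner (basis_at p) g"
    using assms by (simp add: fourier_basis_fun) (simp add: fourier_def flip: L2_inner_cnj)
  finally show "((\<lambda>q. fourier (basis_at p) q * cnj (fourier g q)) has_sum L2_inner (basis_at p) g) pos_pairs" .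
qed (rule basis_fun_L2)

lemma Parseval_add:
  assumes "f \<in> Parseval" "g \<in> Parseval"
  shows "(\<lambda>z. f z + g z) \<in> Parseval"
  unfolding Parseval_def
proof (intro CollectI conjI ballI)
  have L: "f \<in> L2" "g \<in> L2"
    using assms by (simp_all add: Parseval_L2)
  then show "(\<lambda>z. f z + g z) \<in> L2"
    by (rule L2_add)
  fix h assume h: "h \<in> L2"
  then have "((\<lambda>p. fourier f p * cnj (fourier h p) + fourier g p * cnj (fourier h p)) has_sum (L2_inner f h + L2_inner g h)) pos_pairs"
    using assms by (intro has_sum_add) (simp_all add: Parseval_def)
  then show "((\<lambda>p. fourier (\<lambda>z. f z + g z) p * cnj (fourier h p)) has_sum L2_inner (\<lambda>z. f z + g z) h) pos_pairs"
    using L h by (simp add: fourier_def L2_inner_add_left basis_fun_L2 distrib_right)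
qed

lemma Parseval_cmult: "f \<in> Parseval \<Longrightarrow> (\<lambda>z. c * f z) \<in> Parseval"
  unfolding Parseval_def
  by (auto simp: fourier_def L2_cmult L2_inner_cmult_left mult.assoc intro: has_sum_cmult_right)

lemma Parseval_sum:
  "finite A \<Longrightarrow> A \<noteq> {} \<Longrightarrow> (\<And>i. i \<in> A \<Longrightarrow> f i \<in> Parseval) \<Longrightarrow> (\<lambda>z. \<Sum>i\<in>A. f i z) \<in> Parseval"
  by (induction A rule: finite_ne_induct) (simp_all add: Parseval_add)

text \<open>Bessel's inequality bounds the error of the finite partial sums independently of
  \<open>F\<close>, so the usual three-part estimate applies.\<close>

lemma Parseval_closed:
  assumes "f \<in> L2" and approx: "\<And>\<delta>. \<delta> > 0 \<Longrightarrow> \<exists>h\<in>Parseval. L2_norm (\<lambda>z. f z - h z) < \<delta>"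
  shows "f \<in> Parseval"
  unfolding Parseval_def
proof (intro CollectI conjI ballI assms(1))
  fix g assume g: "g \<in> L2"
  show "((\<lambda>p. fourier f p * cnj (fourier g p)) has_sum L2_inner f g) pos_pairs"
    unfolding has_sum_def
  proof (rule tendstoI)
    fix e :: real assume "e > 0"
    \<comment> \<open>One third of \<open>e\<close> for each error; the \<open>+ 1\<close> covers
      the case \<open>L2_norm g = 0\<close>.\<close>
    define \<delta> where "\<delta> = e / (3 * (L2_norm g + 1))"
    have pos: "L2_norm g + 1 > 0"
      by (simp add: add_nonneg_pos)
    then have "\<delta> > 0"
      using \<open>e > 0\<close> by (simp add: \<delta>_def)
    then obtain h where h: "h \<in> Parseval" "L2_norm (\<lambda>z. f z - h z) < \<delta>"
      using approx by blast
    let ?d = "\<lambda>z. f z - h z"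
    have hL: "h \<in> L2" "?d \<in> L2"
      using h assms by (auto simp: Parseval_L2 L2_diff)
    have "L2_norm ?d * L2_norm g \<le> \<delta> * (L2_norm g + 1)"
      using h(2) \<open>\<delta> > 0\<close> by (intro mult_mono) auto
    also have "\<dots> = e / 3"
      using pos by (simp add: \<delta>_def field_simps)
    finally have small: "L2_norm ?d * L2_norm g \<le> e / 3" .
    have "((\<lambda>p. fourier h p * cnj (fourier g p)) has_sum L2_inner h g) pos_pairs"
      using h(1) g by (simp add: Parseval_def)
    then have "\<forall>\<^sub>F F in finite_subsets_at_top pos_pairs.
        dist (\<Sum>p\<in>F. fourier h p * cnj (fourier g p)) (L2_inner h g) < e / 3"
      unfolding has_sum_def using \<open>e > 0\<close> by (intro tendstoD) auto
    moreover have "\<forall>\<^sub>F F in finite_subsets_at_top pos_pairs. finite F \<and> F \<subseteq> pos_pairs"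
      by (rule eventually_finite_subsets_at_top_weakI) simp
    ultimately show "\<forall>\<^sub>F F in finite_subsets_at_top pos_pairs.
        dist (\<Sum>p\<in>F. fourier f p * cnj (fourier g p)) (L2_inner f g) < e"
    proof eventually_elim
      case (elim F)
      let ?S = "\<lambda>f. \<Sum>p\<in>F. fourier f p * cnj (fourier g p)"
      have "cmod (?S ?d) \<le> norm_on (fourier ?d) F * norm_on (\<lambda>p. cnj (fourier g p)) F"
        by (rule norm_on_mult_ineq)
      also have "\<dots> = norm_on (fourier ?d) F * norm_on (fourier g) F"
        by simp
      also have "\<dots> \<le> L2_norm ?d * L2_norm g"
        using elim hL g by (intro mult_mono Bessel_inequality) auto
      finally have 1: "cmod (?S ?d) \<le> e / 3"
        using small by simp
      have 2: "cmod (L2_inner ?d g) \<le> e / 3"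
        using L2_Cauchy_Schwarz[OF hL(2) g] small by simp
      have "?S f - L2_inner f g = (?S h - L2_inner h g) + ?S ?d - L2_inner ?d g"
        using assms hL g by (simp add: fourier_diff L2_inner_diff_left left_diff_distrib sum_subtractf)
      then have "cmod (?S f - L2_inner f g) = cmod ((?S h - L2_inner h g) + ?S ?d - L2_inner ?d g)"
        by (rule arg_cong)
      also have "\<dots> \<le> cmod (?S h - L2_inner h g) + cmod (?S ?d) + cmod (L2_inner ?d g)"
        by (intro order_trans[OF norm_triangle_ineq4] add_right_mono norm_triangle_ineq)
      also have "\<dots> < e"
        using 1 2 elim by (simp add: dist_norm)
      finally show ?case
        by (simp add: dist_norm)
    qed
  qed
qed

lemma Parseval_dominated_limit:
  assumes F: "\<And>k. F k \<in> Parseval" and f: "f \<in> borel_measurable MI"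
    and w: "integrable MI (\<lambda>z. (w z)\<^sup>2)" "\<And>k z. z \<in> I2 \<Longrightarrow> cmod (F k z) \<le> w z"
    and lim: "\<And>z. z \<in> I2 \<Longrightarrow> (\<lambda>k. F k z) \<longlonglongrightarrow> f z"
  shows "f \<in> Parseval"
proof (rule Parseval_closed)
  have fw: "cmod (f z) \<le> w z" if "z \<in> I2" for z
    using LIMSEQ_le_const2[OF tendsto_norm[OF lim[OF that]]] w(2)[OF that] by blast
  then show "f \<in> L2"
    using f w(1) by (intro L2_dominated[of f w])
  have "(\<lambda>k. LINT z|MI. (cmod (f z - F k z))\<^sup>2) \<longlonglongrightarrow> (LINT z|MI. 0)"
  proof (rule integral_dominated_convergence)
    show "integrable MI (\<lambda>z. 4 * (w z)\<^sup>2)"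
      using w(1) by simp
    show "(\<lambda>z. (cmod (f z - F k z))\<^sup>2) \<in> borel_measurable MI" for k
      using f L2D(1)[OF Parseval_L2[OF F]] by measurable
    show "AE z in MI. (\<lambda>k. (cmod (f z - F k z))\<^sup>2) \<longlonglongrightarrow> 0"
    proof (rule AE_I2)
      fix z assume "z \<in> space MI"
      then have "(\<lambda>k. (cmod (f z - F k z))\<^sup>2) \<longlonglongrightarrow> (cmod (f z - f z))\<^sup>2"
        by (intro tendsto_intros lim) simp
      then show "(\<lambda>k. (cmod (f z - F k z))\<^sup>2) \<longlonglongrightarrow> 0"
        by simp
    qed
    show "AE z in MI. norm ((cmod (f z - F k z))\<^sup>2) \<le> 4 * (w z)\<^sup>2" for k
    proof (rule AE_I2)
      fix z assume z: "z \<in> space MI"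
      have "cmod (f z - F k z) \<le> 2 * w z"
        using norm_triangle_ineq4[of "f z" "F k z"] fw[of z] w(2)[of z k] z by simp
      then have "(cmod (f z - F k z))\<^sup>2 \<le> (2 * w z)\<^sup>2"
        by (intro power_mono) auto
      then show "norm ((cmod (f z - F k z))\<^sup>2) \<le> 4 * (w z)\<^sup>2"
        by (simp add: power_mult_distrib)
    qed
  qed simp
  then have "(\<lambda>k. L2_norm (\<lambda>z. f z - F k z)) \<longlonglongrightarrow> sqrt (LINT z|MI. 0)"
    unfolding L2_norm_def by (rule tendsto_real_sqrt)
  then have lim0: "(\<lambda>k. L2_norm (\<lambda>z. f z - F k z)) \<longlonglongrightarrow> 0"
    by simp
  show "\<exists>h\<in>Parseval. L2_norm (\<lambda>z. f z - h z) < \<delta>" if "\<delta> > 0" for \<delta>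
    using eventually_happens'[OF _ order_tendstoD(2)[OF lim0 that]] F by auto
qed

lemma Parseval_bounded_limit:
  assumes "\<And>k. F k \<in> Parseval" "f \<in> borel_measurable MI"
    "\<And>k z. z \<in> I2 \<Longrightarrow> cmod (F k z) \<le> C"
    "\<And>z. z \<in> I2 \<Longrightarrow> (\<lambda>k. F k z) \<longlonglongrightarrow> f z"
  shows "f \<in> Parseval"
  by (rule Parseval_dominated_limit[of F f "\<lambda>_. C"]) (use assms in auto)

section \<open>Products of sines and the Stone-Weierstrass theorem\<close>

definition sine_prod :: "nat \<Rightarrow> nat \<Rightarrow> real \<times> real \<Rightarrow> real" where
  "sine_prod m n z = sin (pi * real m * fst z) * sin (pi * real n * snd z)"

text \<open>Real-valued, since the Stone-Weierstrass theorem is applied to an algebra of real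
  functions; \<open>sine_span_Parseval\<close> passes to complex values.\<close>

inductive_set sine_span :: "(real \<times> real \<Rightarrow> real) set" where
  base: "0 < m \<Longrightarrow> 0 < n \<Longrightarrow> sine_prod m n \<in> sine_span"
| add: "u \<in> sine_span \<Longrightarrow> v \<in> sine_span \<Longrightarrow> (\<lambda>z. u z + v z) \<in> sine_span"
| scale: "u \<in> sine_span \<Longrightarrow> (\<lambda>z. c * u z) \<in> sine_span"

text \<open>Frequency 0 gives the zero function. It appears when multiplication by a cosine lowers
  frequency 1.\<close>

lemma sine_prod_in_sine_span: "sine_prod m n \<in> sine_span"
proof (cases "0 < m \<and> 0 < n")
  case False
  then have "sine_prod m n = (\<lambda>z. 0 * sine_prod 1 1 z)"
    by (auto simp: sine_prod_def)
  then show ?thesis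
    using sine_span.scale[OF sine_span.base[of 1 1], of 0] by simp
qed (simp add: sine_span.base)

lemma sine_span_Parseval: "v \<in> sine_span \<Longrightarrow> (\<lambda>z. complex_of_real (v z)) \<in> Parseval"
proof (induction rule: sine_span.induct)
  case (base m n)
  have eq: "(\<lambda>z. complex_of_real (sine_prod m n z)) = (\<lambda>z. (1 / 2) * basis_at (m, n) z)"
    unfolding sine_prod_def basis_fun_def case_prod_unfold fst_conv snd_conv sqrt_2_mult by simp
  show ?case
    unfolding eq by (rule Parseval_cmult[OF Parseval_basis_fun]) (use base in \<open>simp add: mem_pos_pairs\<close>)
next
  case (add u v)
  then show ?case
    using Parseval_add by fastforce
next
  case (scale u c)
  then show ?case
    using Parseval_cmult[of _ "complex_of_real c"] by fastforce
qed

lemma sin_cos_pi: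
  assumes "0 < m"
  shows "sin (pi * real m * x) * cos (pi * x) = (sin (pi * real (m + 1) * x) + sin (pi * real (m - 1) * x)) / 2"
proof -
  have "sin (pi * real m * x) * cos (pi * x) = (sin (pi * real m * x + pi * x) + sin (pi * real m * x - pi * x)) / 2"
    by (rule sin_times_cos)
  then show ?thesis
    using assms by (simp add: of_nat_diff algebra_simps)
qed

text \<open>The multipliers of the span of the sines form a function algebra, which contains
  \<open>cos (\<pi>x)\<close> and \<open>cos (\<pi>y)\<close>; so Stone-Weierstrass applies to it.\<close>

definition sine_span_mult :: "(real \<times> real \<Rightarrow> real) set" where
  "sine_span_mult = {h. continuous_on UNIV h \<and> (\<forall>v\<in>sine_span. (\<lambda>z. h z * v z) \<in> sine_span)}"

lemma sine_span_multI:
  assumes "\<And>m n. 0 < m \<Longrightarrow> 0 < n \<Longrightarrow> (\<lambda>z. h z * sine_prod m n z) \<in> sine_span" "continuous_on UNIV h"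
  shows "h \<in> sine_span_mult"
  unfolding sine_span_mult_def
proof (intro CollectI conjI ballI assms(2))
  fix v assume "v \<in> sine_span"
  then show "(\<lambda>z. h z * v z) \<in> sine_span"
  proof induction
    case (add u v)
    then show ?case
      using sine_span.add[OF add.IH] by (simp add: distrib_left)
  next
    case (scale u c)
    then show ?case
      using sine_span.scale[OF scale.IH, of c] by (simp add: mult.left_commute)
  qed (rule assms)
qed

lemma cos_fst_sine_span_mult: "(\<lambda>z. cos (pi * fst z)) \<in> sine_span_mult"
proof (rule sine_span_multI)
  fix m n :: nat assume mn: "0 < m" "0 < n"
  have "(\<lambda>z. cos (pi * fst z) * sine_prod m n z) = (\<lambda>z. (1 / 2) * (sine_prod (m + 1) n z + sine_prod (m - 1) n z))"
  proof
    fix z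
    have "cos (pi * fst z) * sine_prod m n z = (sin (pi * real m * fst z) * cos (pi * fst z)) * sin (pi * real n * snd z)"
      by (simp add: sine_prod_def)
    then show "cos (pi * fst z) * sine_prod m n z = (1 / 2) * (sine_prod (m + 1) n z + sine_prod (m - 1) n z)"
      unfolding sin_cos_pi[OF mn(1)] by (simp add: sine_prod_def distrib_right)
  qed
  then show "(\<lambda>z. cos (pi * fst z) * sine_prod m n z) \<in> sine_span"
    by (simp only:) (intro sine_span.scale sine_span.add sine_prod_in_sine_span)
qed (intro continuous_intros)

lemma cos_snd_sine_span_mult: "(\<lambda>z. cos (pi * snd z)) \<in> sine_span_mult"
proof (rule sine_span_multI)
  fix m n :: nat assume mn: "0 < m" "0 < n"
  have "(\<lambda>z. cos (pi * snd z) * sine_prod m n z) = (\<lambda>z. (1 / 2) * (sine_prod m (n + 1) z + sine_prod m (n - 1) z))"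
  proof
    fix z
    have "cos (pi * snd z) * sine_prod m n z = sin (pi * real m * fst z) * (sin (pi * real n * snd z) * cos (pi * snd z))"
      by (simp add: sine_prod_def)
    then show "cos (pi * snd z) * sine_prod m n z = (1 / 2) * (sine_prod m (n + 1) z + sine_prod m (n - 1) z)"
      unfolding sin_cos_pi[OF mn(2)] by (simp add: sine_prod_def distrib_left)
  qed
  then show "(\<lambda>z. cos (pi * snd z) * sine_prod m n z) \<in> sine_span"
    by (simp only:) (intro sine_span.scale sine_span.add sine_prod_in_sine_span)
qed (intro continuous_intros)

lemma cos_pi_inj: "x \<in> {0..1} \<Longrightarrow> y \<in> {0..1} \<Longrightarrow> cos (pi * x) = cos (pi * y) \<Longrightarrow> x = y"
  using cos_inj_pi[of "pi * x" "pi * y"] by (simp add: mult_left_le)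

lemma sine_span_mult_dense:
  assumes "continuous_on ({0..1} \<times> {0..1}) h" "0 < e"
  obtains g where "g \<in> sine_span_mult" "\<And>z. z \<in> {0..1} \<times> {0..1} \<Longrightarrow> \<bar>h z - g z\<bar> < e"
proof -
  interpret function_ring_on sine_span_mult "{0..1} \<times> {0..1}"
  proof
    show "compact ({0..1::real} \<times> {0..1::real})"
      by (intro compact_Times compact_Icc)
    show "continuous_on ({0..1} \<times> {0..1}) f" if "f \<in> sine_span_mult" for f
      using that continuous_on_subset by (auto simp: sine_span_mult_def)
    show "(\<lambda>z. f z + g z) \<in> sine_span_mult" if "f \<in> sine_span_mult" "g \<in> sine_span_mult" for f g
      using that by (auto simp: sine_span_mult_def distrib_right intro!: continuous_intros sine_span.add)
    show "(\<lambda>z. f z * g z) \<in> sine_span_mult" if "f \<in> sine_span_mult" "g \<in> sine_span_mult" for f g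
      using that by (auto simp: sine_span_mult_def mult.assoc intro!: continuous_intros)
    show "(\<lambda>_. c) \<in> sine_span_mult" for c
      by (auto simp: sine_span_mult_def intro!: sine_span.scale)
    show "\<exists>f\<in>sine_span_mult. f x \<noteq> f y"
      if "x \<in> {0..1} \<times> {0..1}" "y \<in> {0..1} \<times> {0..1}" "x \<noteq> y" for x y
    proof (cases "fst x = fst y")
      case True
      then have "cos (pi * snd x) \<noteq> cos (pi * snd y)"
        using that cos_pi_inj[of "snd x" "snd y"] by (auto simp: prod_eq_iff mem_Times_iff)
      then show ?thesis
        by (rule bexI[OF _ cos_snd_sine_span_mult])
    next
      case False
      then have "cos (pi * fst x) \<noteq> cos (pi * fst y)"
        using that cos_pi_inj[of "fst x" "fst y"] by (auto simp: mem_Times_iff)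
      then show ?thesis
        by (rule bexI[OF _ cos_fst_sine_span_mult])
    qed
  qed
  show thesis
    using Stone_Weierstrass_basic[OF assms] that by blast
qed

lemma I2_subset_Icc: "I2 \<subseteq> {0..1} \<times> {0..1}"
  by (auto simp: I2_def)

lemma abs_sine_prod_le_1: "\<bar>sine_prod m n z\<bar> \<le> 1"
proof -
  have "\<bar>sin (pi * real m * fst z)\<bar> * \<bar>sin (pi * real n * snd z)\<bar> \<le> 1 * 1"
    by (intro mult_mono) auto
  then show ?thesis
    by (simp add: sine_prod_def abs_mult)
qed

lemma continuous_on_sine_prod: "continuous_on A (sine_prod m n)"
  unfolding sine_prod_def by (intro continuous_intros)

lemma borel_measurable_MI: "f \<in> borel_measurable borel \<Longrightarrow> f \<in> borel_measurable MI"
  by (rule measurable_restrict_space1) simp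

text \<open>The sines vanish on the boundary of the square, so their span is not uniformly dense in
  the continuous functions. Density holds for its multipliers, and the factor
  \<open>sine_prod 1 1\<close> brings a multiplier back into the span.\<close>

lemma sine_prod_times_continuous_Parseval:
  assumes h: "continuous_on UNIV h"
  shows "(\<lambda>z. complex_of_real (sine_prod 1 1 z * h z)) \<in> Parseval"
proof -
  let ?S = "{0..1::real} \<times> {0..1::real}"
  have "continuous_on ?S h"
    using h continuous_on_subset by blast
  then have "\<exists>g\<in>sine_span_mult. \<forall>z\<in>?S. \<bar>h z - g z\<bar> < 1 / real (Suc k)" for k
    using sine_span_mult_dense[of h "1 / real (Suc k)"] by (metis of_nat_0_less_iff zero_less_Suc zero_less_divide_1_iff)
  then obtain g where g: "\<And>k. g k \<in> sine_span_mult"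
    "\<And>k z. z \<in> ?S \<Longrightarrow> \<bar>h z - g k z\<bar> < 1 / real (Suc k)"
    by metis
  have "compact (h ` ?S)"
    using \<open>continuous_on ?S h\<close> by (intro compact_continuous_image compact_Times compact_Icc)
  then have "bounded (h ` ?S)"
    by (rule compact_imp_bounded)
  then obtain B where B: "\<And>z. z \<in> ?S \<Longrightarrow> \<bar>h z\<bar> \<le> B"
    unfolding bounded_iff real_norm_def by blast
  show ?thesis
  proof (rule Parseval_bounded_limit[of "\<lambda>k z. complex_of_real (sine_prod 1 1 z * g k z)" _ "B + 1"])
    show "(\<lambda>z. complex_of_real (sine_prod 1 1 z * g k z)) \<in> Parseval" for k
    proof (rule sine_span_Parseval)
      have "(\<lambda>z. g k z * sine_prod 1 1 z) \<in> sine_span"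
        using g(1) sine_prod_in_sine_span by (auto simp: sine_span_mult_def)
      then show "(\<lambda>z. sine_prod 1 1 z * g k z) \<in> sine_span"
        by (simp add: mult.commute)
    qed
    show "(\<lambda>z. complex_of_real (sine_prod 1 1 z * h z)) \<in> borel_measurable MI"
      by (intro borel_measurable_MI borel_measurable_continuous_onI continuous_intros h continuous_on_sine_prod)
    fix z assume "z \<in> I2"
    then have z: "z \<in> ?S"
      using I2_subset_Icc by blast
    show "cmod (complex_of_real (sine_prod 1 1 z * g k z)) \<le> B + 1" for k
    proof -
      have "1 / real (Suc k) \<le> 1"
        by simp
      then have "\<bar>g k z\<bar> \<le> B + 1"
        using g(2)[OF z, of k] B[OF z] by linarith
      then have "\<bar>sine_prod 1 1 z\<bar> * \<bar>g k z\<bar> \<le> 1 * (B + 1)"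
        by (intro mult_mono abs_sine_prod_le_1) auto
      then show ?thesis
        by (simp add: norm_mult abs_mult)
    qed
    have "(\<lambda>k. g k z) \<longlonglongrightarrow> h z"
    proof (rule LIM_zero_cancel, rule Lim_null_comparison)
      show "\<forall>\<^sub>F k in sequentially. norm (g k z - h z) \<le> 1 / real (Suc k)"
        using g(2)[OF z] by (intro always_eventually allI) (simp add: abs_minus_commute less_imp_le)
      show "(\<lambda>k. 1 / real (Suc k)) \<longlonglongrightarrow> 0"
        using LIMSEQ_inverse_real_of_nat by (simp add: inverse_eq_divide)
    qed
    then show "(\<lambda>k. complex_of_real (sine_prod 1 1 z * g k z)) \<longlonglongrightarrow> complex_of_real (sine_prod 1 1 z * h z)"
      by (intro tendsto_intros)
  qed
qed

section \<open>From continuous functions to all square-integrable ones\<close>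

lemma sine_prod_1_1_pos: "z \<in> I2 \<Longrightarrow> 0 < sine_prod 1 1 z"
  by (auto simp: sine_prod_def I2_def intro!: mult_pos_pos sin_gt_zero)

text \<open>The factor \<open>sine_prod 1 1\<close> is positive on \<open>I2\<close> and can be
  divided out in the limit; only its zeros on the boundary force a regularised quotient.\<close>

lemma indicator_open_Parseval:
  assumes "open U"
  shows "(\<lambda>z. indicator U z) \<in> Parseval"
proof -
  define V where "V = - (U \<inter> I2)"
  have V: "closed V" "V \<noteq> {}"
  proof -
    show "closed V"
      unfolding V_def using assms open_I2 by blast
    \<comment> \<open>\<open>I2\<close> misses the origin, so \<open>V\<close> is nonempty even for
      \<open>U = UNIV\<close>, and zero distance to \<open>V\<close> characterises
      membership.\<close>
    have "(0, 0) \<in> V"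
      by (simp add: V_def I2_def)
    then show "V \<noteq> {}"
      by blast
  qed
  \<comment> \<open>The numerator increases to the indicator of \<open>U \<inter> I2\<close>. The
    lower cutoff in the denominator keeps the quotient continuous and is eventually inactive at each
    point of \<open>I2\<close>.\<close>
  define h where "h k z = min 1 (real k * infdist z V) / max (sine_prod 1 1 z) (1 / real (Suc k))" for k z
  have pos: "0 < max (sine_prod 1 1 z) (1 / real (Suc k))" for z k
    by (simp add: less_max_iff_disj)
  have cont: "continuous_on UNIV (h k)" for k
    unfolding h_def using pos less_imp_neq[OF pos]
    by (intro continuous_intros continuous_on_sine_prod continuous_on_infdist) (auto simp: V)
  show ?thesis
  proof (rule Parseval_bounded_limit[of "\<lambda>k z. complex_of_real (sine_prod 1 1 z * h k z)" _ 1])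
    show "(\<lambda>z. complex_of_real (sine_prod 1 1 z * h k z)) \<in> Parseval" for k
      by (rule sine_prod_times_continuous_Parseval[OF cont])
    show "indicator U \<in> borel_measurable MI"
      using assms by (intro borel_measurable_MI borel_measurable_indicator) auto
    fix z assume z: "z \<in> I2"
    show "cmod (complex_of_real (sine_prod 1 1 z * h k z)) \<le> 1" for k
    proof -
      let ?m = "max (sine_prod 1 1 z) (1 / real (Suc k))" and ?i = "min 1 (real k * infdist z V)"
      have i: "0 \<le> ?i" "?i \<le> 1"
        by (simp_all add: infdist_nonneg)
      have "sine_prod 1 1 z * ?i \<le> ?m * 1"
        using i sine_prod_1_1_pos[OF z] by (intro mult_mono) auto
      then have "sine_prod 1 1 z * ?i / ?m \<le> 1"
        using pos[of z k] by (simp add: divide_le_eq)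
      moreover have "0 \<le> sine_prod 1 1 z * ?i / ?m"
        using i sine_prod_1_1_pos[OF z] pos[of z k] by (intro divide_nonneg_nonneg mult_nonneg_nonneg) auto
      ultimately show ?thesis
        unfolding norm_of_real h_def times_divide_eq_right by (simp only: abs_of_nonneg)
    qed
    have "(\<lambda>k. sine_prod 1 1 z * h k z) \<longlonglongrightarrow> indicator U z"
    proof (cases "z \<in> U")
      case True
      then have "z \<notin> V"
        using z by (simp add: V_def)
      then have d: "infdist z V > 0"
        using V infdist_nonneg[of z V] in_closed_iff_infdist_zero[OF V] by fastforce
      obtain N1 where N1: "1 / infdist z V < real N1"
        using reals_Archimedean2 by blast
      obtain N2 where N2: "1 / sine_prod 1 1 z < real N2"
        using reals_Archimedean2 by blast
      have "sine_prod 1 1 z * h k z = 1" if "k \<ge> max N1 N2" for k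
      proof -
        have "1 / infdist z V < real k" "1 / sine_prod 1 1 z < real (Suc k)"
          using that N1 N2 by linarith+
        then have "1 < real k * infdist z V" "1 / real (Suc k) < sine_prod 1 1 z"
          using d sine_prod_1_1_pos[OF z] by (simp_all add: field_simps)
        then show ?thesis
          using sine_prod_1_1_pos[OF z] by (simp add: h_def)
      qed
      then have "\<forall>\<^sub>F k in sequentially. sine_prod 1 1 z * h k z = indicator U z"
        using True unfolding eventually_sequentially by (intro exI[of _ "max N1 N2"]) auto
      then show ?thesis
        by (rule tendsto_eventually)
    next
      case False
      then have "infdist z V = 0"
        by (simp add: V_def)
      then show ?thesis
        using False by (simp add: h_def)
    qed
    then have "(\<lambda>k. complex_of_real (sine_prod 1 1 z * h k z)) \<longlonglongrightarrow> complex_of_real (indicator U z)"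
      by (rule tendsto_of_real)
    then show "(\<lambda>k. complex_of_real (sine_prod 1 1 z * h k z)) \<longlonglongrightarrow> indicator U z"
      by (cases "z \<in> U") simp_all
  qed
qed

text \<open>Dynkin's argument: open sets are closed under intersection, linearity gives complements,
  and bounded limits give disjoint unions.\<close>

lemma indicator_borel_Parseval:
  assumes "A \<in> sets borel"
  shows "(\<lambda>z. indicator A z) \<in> Parseval"
proof -
  have sets: "sets borel = sigma_sets UNIV {S :: (real \<times> real) set. open S}"
    unfolding borel_def by (rule sets_measure_of) auto
  have "Int_stable {S :: (real \<times> real) set. open S}"
    by (auto simp: Int_stable_def)
  moreover have "{S :: (real \<times> real) set. open S} \<subseteq> Pow UNIV"
    by simp
  moreover have "A \<in> sigma_sets UNIV {S. open S}"
    using assms by (simp add: sets)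
  ultimately show ?thesis
  proof (induction rule: sigma_sets_induct_disjoint)
    case (basic A)
    then show ?case
      by (simp add: indicator_open_Parseval)
  next
    case empty
    show ?case
      using indicator_open_Parseval[of "{}"] by simp
  next
    case (compl A)
    have "(\<lambda>z. indicator UNIV z + (-1) * indicator A z) \<in> Parseval"
      by (intro Parseval_add Parseval_cmult compl indicator_open_Parseval) simp
    moreover have "(\<lambda>z. indicator UNIV z + (-1) * indicator A z) = (\<lambda>z. indicator (UNIV - A) z :: complex)"
      by (auto simp: indicator_def fun_eq_iff)
    ultimately show ?case
      by simp
  next
    case (union A)
    then have meas: "A i \<in> sets borel" for i
      unfolding sets by blast
    show ?case
    proof (rule Parseval_bounded_limit[where C = 1])
      \<comment> \<open>The bound \<open>Suc k\<close> keeps the index set nonempty, as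
        \<open>Parseval_sum\<close> asks.\<close>
      show "(\<lambda>z. indicator (\<Union>i<Suc k. A i) z) \<in> Parseval" for k
      proof -
        have "(\<lambda>z. indicator (\<Union>i<Suc k. A i) z :: complex) = (\<lambda>z. \<Sum>i<Suc k. indicator (A i) z)"
          using union(1) by (intro ext indicator_UN_disjoint) (auto simp: disjoint_family_on_def)
        moreover have "(\<lambda>z. \<Sum>i<Suc k. indicator (A i) z) \<in> Parseval"
          by (rule Parseval_sum) (use union in auto)
        ultimately show ?thesis
          by simp
      qed
      show "indicator (\<Union>i. A i) \<in> borel_measurable MI"
        using meas by (intro borel_measurable_MI borel_measurable_indicator) auto
      show "cmod (indicator (\<Union>i<Suc k. A i) z) \<le> 1" for k z
        by (simp add: indicator_def)
      show "(\<lambda>k. indicator (\<Union>i<Suc k. A i) z :: complex) \<longlonglongrightarrow> indicator (\<Union>i. A i) z" for z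
        by (rule LIMSEQ_Suc[OF LIMSEQ_indicator_UN])
    qed
  qed
qed

text \<open>Simple functions dominated by twice the modulus of \<open>f\<close> converge to it
  pointwise on \<open>I2\<close>, and they are combinations of indicators of Borel sets.\<close>

lemma L2_subset_Parseval:
  assumes f: "f \<in> L2"
  shows "f \<in> Parseval"
proof -
  \<comment> \<open>Values of \<open>f\<close> off \<open>I2\<close> are arbitrary; extending by
    zero gives a function that is Borel on the whole plane.\<close>
  define f' where "f' z = indicator I2 z *\<^sub>R f z" for z
  have "f' \<in> borel_measurable lborel"
    unfolding f'_def using L2D(1)[OF f] by (subst (asm) borel_measurable_restrict_space_iff) auto
  then have f': "f' \<in> borel_measurable borel"
    by simp
  obtain s where s: "\<And>i. simple_function borel (s i)" "\<And>z. (\<lambda>i. s i z) \<longlonglongrightarrow> f' z"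
    "\<And>i z. norm (s i z) \<le> 2 * norm (f' z)"
    using borel_measurable_implies_sequence_metric[OF f', of 0] unfolding norm_conv_dist
    by (auto simp: space_borel)
  have eq: "f' z = f z" if "z \<in> I2" for z
    using that by (simp add: f'_def)
  show ?thesis
  proof (rule Parseval_dominated_limit[of s _ "\<lambda>z. 2 * cmod (f z)"])
    show "s i \<in> Parseval" for i
    proof -
      have "s i = (\<lambda>z. \<Sum>y\<in>range (s i). y * indicator (s i -` {y}) z)"
      proof
        fix z
        have "z \<in> space (borel :: (real \<times> real) measure)"
          by simp
        from simple_function_indicator_representation_banach[OF s(1) this, of i]
        have "s i z = (\<Sum>y\<in>range (s i). indicator (s i -` {y}) z *\<^sub>R y)"
          unfolding space_borel Int_UNIV_right .
        also have "\<dots> = (\<Sum>y\<in>range (s i). y * indicator (s i -` {y}) z)"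
          by (intro sum.cong) (auto simp: indicator_def)
        finally show "s i z = (\<Sum>y\<in>range (s i). y * indicator (s i -` {y}) z)" .
      qed
      moreover have "(\<lambda>z. \<Sum>y\<in>range (s i). y * indicator (s i -` {y}) z) \<in> Parseval"
      proof (intro Parseval_sum Parseval_cmult indicator_borel_Parseval)
        show "finite (range (s i))"
          using simple_functionD(1)[OF s(1)[of i]] by simp
        show "s i -` {y} \<in> sets borel" for y
          using simple_functionD(2)[OF s(1), of i "{y}"] by simp
      qed auto
      ultimately show ?thesis
        by simp
    qed
    show "f \<in> borel_measurable MI"
      using f by (rule L2D)
    show "integrable MI (\<lambda>z. (2 * cmod (f z))\<^sup>2)"
      using L2D(2)[OF f] by (simp add: power_mult_distrib)
  qed (use s(2,3) eq in \<open>metis\<close>)+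
qed

theorem Parseval_identity:
  "f \<in> L2 \<Longrightarrow> g \<in> L2 \<Longrightarrow> ((\<lambda>p. fourier f p * cnj (fourier g p)) has_sum L2_inner f g) pos_pairs"
  using L2_subset_Parseval by (simp add: Parseval_def)

lemma Parseval_norm:
  assumes "f \<in> L2"
  shows "((\<lambda>p. (cmod (fourier f p))\<^sup>2) has_sum (L2_norm f)\<^sup>2) pos_pairs"
proof -
  have "((\<lambda>p. complex_of_real ((cmod (fourier f p))\<^sup>2)) has_sum complex_of_real ((L2_norm f)\<^sup>2)) pos_pairs"
    using Parseval_identity[OF assms assms] unfolding L2_inner_self
    by (simp only: complex_norm_square)
  then show ?thesis
    by (simp only: has_sum_of_real_iff)
qed

section \<open>Dilations\<close>

lemma borel_measurable_red2 [measurable]: "red2 \<in> borel_measurable borel"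
  unfolding red2_def by measurable

lemma red2_add_even: "red2 (2 * real k + x) = red2 x"
proof (induction k)
  case (Suc k)
  have "red2 (2 * real (Suc k) + x) = red2 ((2 * real k + x) + 2)"
    by (simp add: algebra_simps)
  then show ?case
    using Suc by (simp only: red2_periodic)
qed simp

text \<open>The absolute value of \<open>red2\<close> is a triangle wave: it carries each open unit
  interval isometrically onto \<open>(0, 1)\<close>, reversing those that start at an odd
  integer.\<close>

lemma abs_red2_add:
  assumes "0 < t" "t < 1"
  shows "\<bar>red2 (real k + t)\<bar> = (if even k then t else 1 - t)"
proof (cases "even k")
  case True
  then obtain j where "k = 2 * j" ..
  then show ?thesis
    using red2_add_even[of j t] red2_eq[of t] assms by simp
next
  case False
  then obtain j where j: "k = 2 * j + 1"
    using oddE by blast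
  have "red2 (1 + t) = red2 ((t - 1) + 2)"
    by (simp add: algebra_simps)
  also have "\<dots> = t - 1"
    unfolding red2_periodic using assms by (intro red2_eq) auto
  finally show ?thesis
    using j red2_add_even[of j "1 + t"] assms by (simp add: algebra_simps)
qed

lemma nn_integral_Ioo_abs_red2:
  fixes h :: "real \<Rightarrow> ennreal"
  assumes [measurable]: "h \<in> borel_measurable borel"
  shows "(\<integral>\<^sup>+u. indicator {0<..<real m} u * h \<bar>red2 u\<bar> \<partial>lborel)
    = of_nat m * (\<integral>\<^sup>+t. indicator {0<..<1} t * h t \<partial>lborel)"
proof (induction m)
  case 0
  show ?case
    by simp
next
  case (Suc m)
  let ?I = "\<integral>\<^sup>+t. indicator {0<..<1} t * h t \<partial>lborel"
  have piece: "(\<integral>\<^sup>+u. indicator {real m<..<real (Suc m)} u * h \<bar>red2 u\<bar> \<partial>lborel) = ?I"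
  proof -
    have "(\<integral>\<^sup>+u. indicator {real m<..<real (Suc m)} u * h \<bar>red2 u\<bar> \<partial>lborel)
        = (\<integral>\<^sup>+t. indicator {real m<..<real (Suc m)} (real m + 1 * t) * h \<bar>red2 (real m + 1 * t)\<bar> \<partial>lborel)"
      by (subst nn_integral_real_affine[where c = 1 and t = "real m"]) auto
    also have "\<dots> = (\<integral>\<^sup>+t. indicator {0<..<1} t * h (if even m then t else 1 - t) \<partial>lborel)"
      by (intro nn_integral_cong) (auto simp: indicator_def abs_red2_add)
    also have "\<dots> = ?I"
    proof (cases "even m")
      case False
      have "?I = (\<integral>\<^sup>+t. indicator {0<..<1} (1 + (-1) * t) * h (1 + (-1) * t) \<partial>lborel)"
        by (subst nn_integral_real_affine[where c = "-1" and t = 1]) auto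
      also have "\<dots> = (\<integral>\<^sup>+t. indicator {0<..<1} t * h (1 - t) \<partial>lborel)"
        by (intro nn_integral_cong) (auto simp: indicator_def)
      finally show ?thesis
        using False by simp
    qed simp
    finally show ?thesis .
  qed
  have "(\<integral>\<^sup>+u. indicator {0<..<real (Suc m)} u * h \<bar>red2 u\<bar> \<partial>lborel)
      = (\<integral>\<^sup>+u. indicator {0<..<real m} u * h \<bar>red2 u\<bar> + indicator {real m<..<real (Suc m)} u * h \<bar>red2 u\<bar> \<partial>lborel)"
  proof (rule nn_integral_cong_AE)
    show "AE u in lborel. indicator {0<..<real (Suc m)} u * h \<bar>red2 u\<bar>
      = indicator {0<..<real m} u * h \<bar>red2 u\<bar> + indicator {real m<..<real (Suc m)} u * h \<bar>red2 u\<bar>"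
      using AE_lborel_singleton[of "real m"]
      by eventually_elim (auto simp: indicator_def)
  qed
  also have "\<dots> = (\<integral>\<^sup>+u. indicator {0<..<real m} u * h \<bar>red2 u\<bar> \<partial>lborel)
      + (\<integral>\<^sup>+u. indicator {real m<..<real (Suc m)} u * h \<bar>red2 u\<bar> \<partial>lborel)"
    by (rule nn_integral_add) measurable
  also have "\<dots> = of_nat m * ?I + ?I"
    by (simp only: Suc piece)
  finally show ?case
    by (simp add: distrib_right add.commute)
qed

text \<open>The map runs through the interval \<open>m\<close> times at speed \<open>m\<close>, so
  it preserves Lebesgue measure.\<close>

lemma nn_integral_red2_dilation:
  fixes h :: "real \<Rightarrow> ennreal"
  assumes [measurable]: "h \<in> borel_measurable borel" and m: "0 < m"
  shows "(\<integral>\<^sup>+x. indicator {0<..<1} x * h \<bar>red2 (real m * x)\<bar> \<partial>lborel)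
    = (\<integral>\<^sup>+x. indicator {0<..<1} x * h x \<partial>lborel)"
proof -
  let ?I = "\<integral>\<^sup>+t. indicator {0<..<1} t * h t \<partial>lborel"
  let ?J = "\<integral>\<^sup>+x. indicator {0<..<1} x * h \<bar>red2 (real m * x)\<bar> \<partial>lborel"
  have "of_nat m * ?I = (\<integral>\<^sup>+u. indicator {0<..<real m} u * h \<bar>red2 u\<bar> \<partial>lborel)"
    by (simp add: nn_integral_Ioo_abs_red2)
  also have "\<dots> = ennreal (real m) * (\<integral>\<^sup>+x. indicator {0<..<real m} (0 + real m * x) * h \<bar>red2 (0 + real m * x)\<bar> \<partial>lborel)"
    using m by (subst nn_integral_real_affine[where c = "real m" and t = 0]) auto
  also have "(\<integral>\<^sup>+x. indicator {0<..<real m} (0 + real m * x) * h \<bar>red2 (0 + real m * x)\<bar> \<partial>lborel) = ?J"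
    using m by (intro nn_integral_cong) (auto simp: indicator_def zero_less_mult_iff)
  finally have "of_nat m * ?I = of_nat m * ?J"
    by (simp add: ennreal_of_nat_eq_real_of_nat)
  then show ?thesis
    using m by (auto simp: ennreal_mult_cancel_left ennreal_of_nat_eq_real_of_nat)
qed

text \<open>Folding the dilated square back onto the unit square. Up to a sign, a dilation is
  composition with this measure-preserving map.\<close>

definition fold2 :: "nat \<times> nat \<Rightarrow> real \<times> real \<Rightarrow> real \<times> real" where
  "fold2 p z = (\<bar>red2 (real (fst p) * fst z)\<bar>, \<bar>red2 (real (snd p) * snd z)\<bar>)"

lemma borel_measurable_fold2 [measurable]: "fold2 p \<in> borel_measurable borel"
proof -
  have "fold2 p \<in> borel \<Otimes>\<^sub>M borel \<rightarrow>\<^sub>M borel \<Otimes>\<^sub>M borel"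
    unfolding fold2_def by measurable
  then show ?thesis
    by (simp add: borel_prod)
qed

lemma nn_integral_MI_iterated:
  assumes "h \<in> borel_measurable borel"
  shows "(\<integral>\<^sup>+z. h z \<partial>MI) = (\<integral>\<^sup>+x. indicator {0<..<1} x * (\<integral>\<^sup>+y. indicator {0<..<1} y * h (x, y) \<partial>lborel) \<partial>lborel)"
proof -
  have [measurable]: "h \<in> borel_measurable (borel \<Otimes>\<^sub>M borel)"
    using assms by (simp add: borel_prod)
  have "(\<integral>\<^sup>+z. h z \<partial>MI) = (\<integral>\<^sup>+z. h z * indicator I2 z \<partial>lborel)"
    by (simp add: nn_integral_restrict_space)
  also have "\<dots> = (\<integral>\<^sup>+z. indicator {0<..<1} (fst z) * (indicator {0<..<1} (snd z) * h z) \<partial>(lborel \<Otimes>\<^sub>M lborel))"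
    unfolding lborel_prod by (intro nn_integral_cong) (auto simp: I2_def indicator_def)
  also have "\<dots> = (\<integral>\<^sup>+x. \<integral>\<^sup>+y. indicator {0<..<1} x * (indicator {0<..<1} y * h (x, y)) \<partial>lborel \<partial>lborel)"
    by (subst lborel.nn_integral_fst[symmetric]) simp_all
  also have "\<dots> = (\<integral>\<^sup>+x. indicator {0<..<1} x * (\<integral>\<^sup>+y. indicator {0<..<1} y * h (x, y) \<partial>lborel) \<partial>lborel)"
    by (intro nn_integral_cong nn_integral_cmult) simp
  finally show ?thesis .
qed

lemma nn_integral_fold2:
  assumes "p \<in> pos_pairs" "h \<in> borel_measurable borel"
  shows "(\<integral>\<^sup>+z. h (fold2 p z) \<partial>MI) = (\<integral>\<^sup>+z. h z \<partial>MI)"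
proof -
  have [measurable]: "h \<in> borel_measurable (borel \<Otimes>\<^sub>M borel)"
    using assms by (simp add: borel_prod)
  define H where "H x = (\<integral>\<^sup>+y. indicator {0<..<1} y * h (x, y) \<partial>lborel)" for x
  have [measurable]: "H \<in> borel_measurable borel"
    unfolding H_def by measurable
  have m: "0 < fst p" "0 < snd p"
    using assms by (auto simp: mem_pos_pairs)
  have "(\<integral>\<^sup>+z. h (fold2 p z) \<partial>MI) = (\<integral>\<^sup>+x. indicator {0<..<1} x *
      (\<integral>\<^sup>+y. indicator {0<..<1} y * h (\<bar>red2 (real (fst p) * x)\<bar>, \<bar>red2 (real (snd p) * y)\<bar>) \<partial>lborel) \<partial>lborel)"
    using nn_integral_MI_iterated[OF measurable_compose[OF borel_measurable_fold2 assms(2)], of p]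
    by (simp add: fold2_def)
  also have "\<dots> = (\<integral>\<^sup>+x. indicator {0<..<1} x * H \<bar>red2 (real (fst p) * x)\<bar> \<partial>lborel)"
    unfolding H_def by (subst nn_integral_red2_dilation[OF _ m(2)]) auto
  also have "\<dots> = (\<integral>\<^sup>+x. indicator {0<..<1} x * H x \<partial>lborel)"
    by (rule nn_integral_red2_dilation) (use m in auto)
  also have "\<dots> = (\<integral>\<^sup>+z. h z \<partial>MI)"
    unfolding H_def using assms(2) by (rule nn_integral_MI_iterated[symmetric])
  finally show ?thesis .
qed

lemma id_measurable_MI: "(\<lambda>z. z) \<in> MI \<rightarrow>\<^sub>M borel" "fold2 p \<in> MI \<rightarrow>\<^sub>M borel"
  by (simp_all add: measurable_restrict_space1)

lemma distr_fold2:
  assumes "p \<in> pos_pairs"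
  shows "distr MI borel (fold2 p) = distr MI borel (\<lambda>z. z)"
proof (rule measure_eqI)
  fix A assume "A \<in> sets (distr MI borel (fold2 p))"
  then have A: "A \<in> sets borel"
    by simp
  have "emeasure (distr MI borel g) A = (\<integral>\<^sup>+z. indicator A (g z) \<partial>MI)" if "g \<in> MI \<rightarrow>\<^sub>M borel" for g
  proof -
    have "emeasure (distr MI borel g) A = (\<integral>\<^sup>+z. indicator A z \<partial>(distr MI borel g))"
      using A by simp
    also have "\<dots> = (\<integral>\<^sup>+z. indicator A (g z) \<partial>MI)"
      using A that by (intro nn_integral_distr) auto
    finally show ?thesis .
  qed
  then show "emeasure (distr MI borel (fold2 p)) A = emeasure (distr MI borel (\<lambda>z. z)) A"
    using A nn_integral_fold2[OF assms, of "indicator A"] by (simp add: id_measurable_MI)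
qed simp

lemma integral_fold2:
  fixes H :: "real \<times> real \<Rightarrow> 'a::{banach, second_countable_topology}"
  assumes "p \<in> pos_pairs" "H \<in> borel_measurable borel"
  shows "(LINT z|MI. H (fold2 p z)) = (LINT z|MI. H z)"
    and "integrable MI (\<lambda>z. H (fold2 p z)) \<longleftrightarrow> integrable MI H"
  using integral_distr[OF id_measurable_MI(2)[of p] assms(2)] integral_distr[OF id_measurable_MI(1) assms(2)]
    integrable_distr_eq[OF id_measurable_MI(2)[of p] assms(2)] integrable_distr_eq[OF id_measurable_MI(1) assms(2)]
  by (simp_all add: distr_fold2[OF assms(1)])

definition zero_ext :: "(real \<times> real \<Rightarrow> complex) \<Rightarrow> real \<times> real \<Rightarrow> complex" where
  "zero_ext f z = (if z \<in> I2 then f z else 0)"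

lemma borel_measurable_zero_ext:
  assumes "f \<in> L2"
  shows "zero_ext f \<in> borel_measurable borel"
proof -
  have "(\<lambda>z. indicator I2 z *\<^sub>R f z) \<in> borel_measurable lborel"
    using L2D(1)[OF assms] by (subst (asm) borel_measurable_restrict_space_iff) auto
  moreover have "(\<lambda>z. indicator I2 z *\<^sub>R f z) = zero_ext f"
    by (auto simp: zero_ext_def)
  ultimately show ?thesis
    by simp
qed

section \<open>Dilations as isometries and their action on the sine basis\<close>

definition fold2_sign :: "nat \<times> nat \<Rightarrow> real \<times> real \<Rightarrow> complex" where
  "fold2_sign p z = complex_of_real (sgn (red2 (real (fst p) * fst z)) * sgn (red2 (real (snd p) * snd z)))"

lemma dilation_eq: "dilation f p z = fold2_sign p z * zero_ext f (fold2 p z)"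
  by (simp add: dilation_def odd_periodic_ext_def fold2_sign_def zero_ext_def fold2_def case_prod_unfold)

lemma fold2_sign_square: "fold2 p z \<in> I2 \<Longrightarrow> fold2_sign p z * cnj (fold2_sign p z) = 1"
  by (auto simp: fold2_sign_def fold2_def I2_def sgn_if)

text \<open>The signs cancel where the folding lands in \<open>I2\<close>, and both sides vanish
  elsewhere. Inner products of dilations thus only involve the folding.\<close>

lemma dilation_mult_cnj:
  "dilation f p z * cnj (dilation g p z) = zero_ext f (fold2 p z) * cnj (zero_ext g (fold2 p z))"
proof (cases "fold2 p z \<in> I2")
  case True
  have "dilation f p z * cnj (dilation g p z)
      = (fold2_sign p z * cnj (fold2_sign p z)) * (zero_ext f (fold2 p z) * cnj (zero_ext g (fold2 p z)))"
    by (simp add: dilation_eq)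
  then show ?thesis
    using fold2_sign_square[OF True] by simp
qed (simp add: dilation_eq zero_ext_def)

lemma dilation_L2:
  assumes "f \<in> L2" "p \<in> pos_pairs"
  shows "dilation f p \<in> L2"
proof -
  have z: "zero_ext f \<in> borel_measurable borel"
    using assms(1) by (rule borel_measurable_zero_ext)
  have "(\<lambda>z. sgn (red2 (real (fst p) * fst z)) * sgn (red2 (real (snd p) * snd z))) \<in> borel_measurable (borel \<Otimes>\<^sub>M borel)"
    by measurable
  then have "fold2_sign p \<in> borel_measurable borel"
    unfolding fold2_sign_def borel_prod by measurable
  moreover have "(\<lambda>z. zero_ext f (fold2 p z)) \<in> borel_measurable borel"
    using z by measurable
  ultimately have "dilation f p \<in> borel_measurable borel"
    unfolding dilation_eq[abs_def] by (rule borel_measurable_times)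
  then have "dilation f p \<in> borel_measurable MI"
    by (rule borel_measurable_MI)
  moreover have "(\<lambda>z. (cmod (dilation f p z))\<^sup>2) = (\<lambda>z. (cmod (zero_ext f (fold2 p z)))\<^sup>2)"
    using dilation_mult_cnj[of f p _ f] unfolding complex_norm_square[symmetric] of_real_eq_iff by simp
  moreover have "integrable MI (\<lambda>z. (cmod (zero_ext f z))\<^sup>2) \<longleftrightarrow> integrable MI (\<lambda>z. (cmod (f z))\<^sup>2)"
    by (intro Bochner_Integration.integrable_cong) (auto simp: zero_ext_def)
  moreover have "integrable MI (\<lambda>z. (cmod (zero_ext f (fold2 p z)))\<^sup>2) \<longleftrightarrow> integrable MI (\<lambda>z. (cmod (zero_ext f z))\<^sup>2)"
    using z by (intro integral_fold2(2)[OF assms(2), of "\<lambda>z. (cmod (zero_ext f z))\<^sup>2"]) measurable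
  ultimately show ?thesis
    using L2D(2)[OF assms(1)] by (simp add: L2_def)
qed

lemma L2_inner_dilation:
  assumes "f \<in> L2" "g \<in> L2" "p \<in> pos_pairs"
  shows "L2_inner (dilation f p) (dilation g p) = L2_inner f g"
proof -
  have [measurable]: "zero_ext f \<in> borel_measurable borel" "zero_ext g \<in> borel_measurable borel"
    using assms by (simp_all add: borel_measurable_zero_ext)
  have "L2_inner (dilation f p) (dilation g p) = (LINT z|MI. zero_ext f (fold2 p z) * cnj (zero_ext g (fold2 p z)))"
    by (simp add: L2_inner_def dilation_mult_cnj)
  also have "\<dots> = (LINT z|MI. zero_ext f z * cnj (zero_ext g z))"
    by (intro integral_fold2(1)[OF assms(3), of "\<lambda>z. zero_ext f z * cnj (zero_ext g z)"]) measurable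
  also have "\<dots> = L2_inner f g"
    unfolding L2_inner_def by (intro Bochner_Integration.integral_cong) (auto simp: zero_ext_def)
  finally show ?thesis .
qed

lemma L2_norm_dilation: "f \<in> L2 \<Longrightarrow> p \<in> pos_pairs \<Longrightarrow> L2_norm (dilation f p) = L2_norm f"
  using L2_inner_dilation[of f f p] unfolding L2_inner_self of_real_eq_iff
  by (simp add: power2_eq_iff_nonneg)

lemma sin_red2: "sin (pi * real k * red2 x) = sin (pi * real k * x)"
proof -
  have "pi * real k * red2 x = pi * real k * x - (2 * pi) * of_int (int k * \<lfloor>(x + 1) / 2\<rfloor>)"
    by (simp add: red2_def algebra_simps)
  moreover have "sin (a - (2 * pi) * of_int j) = sin a" for a j
    by (simp add: sin_diff)
  ultimately show ?thesis
    by (simp only:)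
qed

lemma sgn_sin_abs: "sgn r * sin (pi * real k * \<bar>r\<bar>) = sin (pi * real k * r)"
  by (auto simp: sgn_if abs_if)

text \<open>A sine of integer frequency is its own odd periodic extension, including the lines where
  the extension is set to 0.\<close>

lemma dilation_basis_fun:
  "dilation (basis_at q) p z = basis_at (mult2 p q) z"
proof -
  let ?r = "red2 (real (fst p) * fst z)" and ?s = "red2 (real (snd p) * snd z)"
  have b: "basis_at (mult2 p q) z = complex_of_real (2 * (sin (pi * real (fst q) * ?r) * sin (pi * real (snd q) * ?s)))"
    unfolding sin_red2 basis_fun_def case_prod_unfold sqrt_2_mult by (simp add: mult2_def mult_ac)
  show ?thesis
  proof (cases "fold2 p z \<in> I2")
    case True
    then have "dilation (basis_at q) p z
        = complex_of_real (2 * ((sgn ?r * sin (pi * real (fst q) * \<bar>?r\<bar>)) * (sgn ?s * sin (pi * real (snd q) * \<bar>?s\<bar>))))"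
      unfolding dilation_eq zero_ext_def fold2_sign_def basis_fun_def case_prod_unfold sqrt_2_mult
      by (simp add: fold2_def mult_ac)
    then show ?thesis
      by (simp only: b sgn_sin_abs)
  next
    case False
    \<comment> \<open>Outside \<open>I2\<close> some reduced coordinate is 0 or -1, and there every
      sine in question vanishes.\<close>
    have "sin (pi * real k * r) = 0" if "\<not> (0 < \<bar>r\<bar> \<and> \<bar>r\<bar> < 1)" "- 1 \<le> r" "r < 1" for k r
    proof -
      have "r = 0 \<or> r = - 1"
        using that by linarith
      then show ?thesis
        by (auto simp: mult.commute[of pi])
    qed
    then have "sin (pi * real (fst q) * ?r) = 0 \<or> sin (pi * real (snd q) * ?s) = 0"
      using False red2_bounds[of "real (fst p) * fst z"] red2_bounds[of "real (snd p) * snd z"]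
      by (simp add: fold2_def I2_def) blast
    then have "basis_at (mult2 p q) z = 0"
      unfolding b by auto
    then show ?thesis
      using False by (simp add: dilation_eq zero_ext_def)
  qed
qed

text \<open>The basis function at \<open>mult2 p q\<close> is itself a dilation by \<open>p\<close>,
  so the isometry removes \<open>p\<close> from both arguments.\<close>

lemma fourier_dilation_mult2:
  assumes "f \<in> L2" "p \<in> pos_pairs"
  shows "fourier (dilation f p) (mult2 p q) = fourier f q"
proof -
  have "basis_at (mult2 p q) = dilation (basis_at q) p"
    by (rule ext) (simp add: dilation_basis_fun)
  then show ?thesis
    using L2_inner_dilation[OF assms(1) basis_fun_L2 assms(2)] by (simp add: fourier_def)
qed

text \<open>The coefficients at multiples of \<open>p\<close> already exhaust the norm.\<close>

lemma fourier_dilation_not_dvd2: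
  assumes f: "f \<in> L2" and p: "p \<in> pos_pairs" and r: "r \<in> pos_pairs" "\<not> dvd2 p r"
  shows "fourier (dilation f p) r = 0"
proof -
  let ?c = "\<lambda>q. (cmod (fourier (dilation f p) q))\<^sup>2"
  have "(L2_norm f)\<^sup>2 \<le> (L2_norm f)\<^sup>2 - ?c r"
  proof (rule has_sum_le_finite_sums[OF Parseval_norm[OF f]])
    fix A assume A: "finite A" "A \<subseteq> pos_pairs"
    have "r \<notin> mult2 p ` A"
      using r by auto
    have "?c r + (\<Sum>q\<in>A. (cmod (fourier f q))\<^sup>2) = ?c r + (\<Sum>q\<in>mult2 p ` A. ?c q)"
      using f p by (subst sum.reindex) (simp_all add: inj_on_mult2 fourier_dilation_mult2)
    also have "\<dots> = (norm_on (fourier (dilation f p)) (insert r (mult2 p ` A)))\<^sup>2"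
      using A \<open>r \<notin> _\<close> by (simp only: norm_on_power2) (simp add: sum.insert)
    also have "\<dots> \<le> (L2_norm (dilation f p))\<^sup>2"
      using A p r f by (intro power_mono Bessel_inequality dilation_L2) (auto intro!: mult2_in_pos_pairs)
    also have "\<dots> = (L2_norm f)\<^sup>2"
      using f p by (simp add: L2_norm_dilation)
    finally show "(\<Sum>q\<in>A. (cmod (fourier f q))\<^sup>2) \<le> (L2_norm f)\<^sup>2 - ?c r"
      by simp
  qed
  then show ?thesis
    by simp
qed

lemma coeff_at_S_map: "p \<in> pos_pairs \<Longrightarrow> coeff_at (S_map f) p = fourier f p"
  by (auto simp: mem_pos_pairs coeff_at_def S_map.rep_eq fourier_def)

lemma fourier_dilation:
  assumes "f \<in> L2" "p \<in> pos_pairs" "q \<in> pos_pairs"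
  shows "fourier (dilation f q) p = dmat (S_map f) p q"
proof (cases "dvd2 q p")
  case True
  then show ?thesis
    using fourier_dilation_mult2[OF assms(1,3), of "quot2 p q"] assms quot2_in_pos_pairs[OF True]
    by (simp add: mult2_quot2 dmat_def coeff_at_S_map)
next
  case False
  then show ?thesis
    using assms by (simp add: fourier_dilation_not_dvd2 dmat_def)
qed

section \<open>Weak convergence of coefficients\<close>

lemma L2_norm_le_of_fourier:
  assumes "g \<in> L2" "0 \<le> L" "\<And>A. finite A \<Longrightarrow> A \<subseteq> pos_pairs \<Longrightarrow> norm_on (fourier g) A \<le> L"
  shows "L2_norm g \<le> L"
proof -
  have "(L2_norm g)\<^sup>2 \<le> L\<^sup>2"
  proof (rule has_sum_le_finite_sums[OF Parseval_norm[OF assms(1)]])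
    fix A assume A: "finite A" "A \<subseteq> pos_pairs"
    show "(\<Sum>p\<in>A. (cmod (fourier g p))\<^sup>2) \<le> L\<^sup>2"
      using power_mono[OF assms(3)[OF A], of 2] by (simp add: norm_on_power2)
  qed
  then show ?thesis
    using assms(2) by (rule power2_le_imp_le)
qed

lemma L2_norm_diff_triangle:
  assumes "g \<in> L2" "h \<in> L2"
  shows "L2_norm (\<lambda>z. g z - h z) \<le> L2_norm g + L2_norm h"
proof (rule L2_norm_le_of_fourier[OF L2_diff[OF assms]])
  fix A :: "(nat \<times> nat) set" assume A: "finite A" "A \<subseteq> pos_pairs"
  have "norm_on (fourier (\<lambda>z. g z - h z)) A = norm_on (\<lambda>p. fourier g p - fourier h p) A"
    using assms by (simp add: fourier_diff)
  also have "\<dots> \<le> norm_on (fourier g) A + norm_on (fourier h) A"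
    by (rule norm_on_diff)
  also have "\<dots> \<le> L2_norm g + L2_norm h"
    using assms A by (intro add_mono Bessel_inequality)
  finally show "norm_on (fourier (\<lambda>z. g z - h z)) A \<le> L2_norm g + L2_norm h" .
qed simp

lemma finite_section_approximation:
  assumes "f \<in> L2" "0 < \<delta>"
  obtains F where "finite F" "F \<subseteq> pos_pairs" "L2_norm (\<lambda>z. f z - (\<Sum>p\<in>F. fourier f p * basis_at p z)) \<le> \<delta>"
proof -
  obtain F where F: "finite F" "F \<subseteq> pos_pairs" "dist (\<Sum>p\<in>F. (cmod (fourier f p))\<^sup>2) ((L2_norm f)\<^sup>2) \<le> \<delta>\<^sup>2"
    using has_sum_finite_approximation[OF Parseval_norm[OF assms(1)], of "\<delta>\<^sup>2"] assms(2) by auto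
  let ?g = "\<lambda>z. \<Sum>p\<in>F. fourier f p * basis_at p z"
  have "L2_inner f ?g = complex_of_real ((norm_on (fourier f) F)\<^sup>2)"
    using assms(1) by (simp only: L2_inner_sum_basis sum_mult_cnj)
  then have "(L2_norm (\<lambda>z. f z - ?g z))\<^sup>2 = (L2_norm f)\<^sup>2 - (norm_on (fourier f) F)\<^sup>2"
    using L2_norm_diff_scaled[OF assms(1) L2_sum_basis[OF F(1)], where c = 1] F
    by (simp add: L2_norm_sum_basis)
  also have "\<dots> \<le> \<delta>\<^sup>2"
    using F(3) by (simp add: norm_on_power2 dist_real_def)
  finally have "(L2_norm (\<lambda>z. f z - ?g z))\<^sup>2 \<le> \<delta>\<^sup>2" .
  then have "L2_norm (\<lambda>z. f z - ?g z) \<le> \<delta>"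
    by (rule power2_le_imp_le) (rule less_imp_le[OF assms(2)])
  then show thesis
    by (rule that[OF F(1,2)])
qed

text \<open>For a norm-bounded sequence, coefficientwise convergence is weak convergence: replacing
  \<open>f\<close> by a finite section costs at most half of \<epsilon> uniformly in
  \<open>k\<close>, and on the section only finitely many coefficients matter.\<close>

lemma L2_inner_weak_limit:
  assumes f: "f \<in> L2" and g: "\<And>k. g k \<in> L2" and e: "e \<in> L2"
    and bound: "\<And>k. L2_norm (g k) \<le> L"
    and lim: "\<And>p. p \<in> pos_pairs \<Longrightarrow> (\<lambda>k. fourier (g k) p) \<longlonglongrightarrow> fourier e p"
  shows "(\<lambda>k. L2_inner f (g k)) \<longlonglongrightarrow> L2_inner f e"
proof (rule tendstoI)
  fix \<epsilon> :: real assume "\<epsilon> > 0"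
  let ?h = "\<lambda>k z. g k z - e z"
  define M where "M = L + L2_norm e"
  have h: "?h k \<in> L2" "L2_norm (?h k) \<le> M" for k
    using L2_diff[OF g e, of k] L2_norm_diff_triangle[OF g e, of k] bound[of k] by (simp_all add: M_def)
  have "0 \<le> M"
    using h(2)[of 0] L2_norm_nonneg order_trans by blast
  then have \<delta>: "0 < \<epsilon> / (2 * (M + 1))"
    using \<open>\<epsilon> > 0\<close> by simp
  obtain F where F: "finite F" "F \<subseteq> pos_pairs"
    "L2_norm (\<lambda>z. f z - (\<Sum>p\<in>F. fourier f p * basis_at p z)) \<le> \<epsilon> / (2 * (M + 1))"
    using finite_section_approximation[OF f \<delta>] .
  let ?f = "\<lambda>z. \<Sum>p\<in>F. fourier f p * basis_at p z"
  have fL: "?f \<in> L2"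
    using F by (intro L2_sum_basis)
  have inner_f: "L2_inner ?f h = (\<Sum>p\<in>F. fourier f p * cnj (fourier h p))" if "h \<in> L2" for h
    using that by (subst L2_inner_cnj) (simp add: L2_inner_sum_basis mult.commute)
  have "(\<lambda>k. \<Sum>p\<in>F. fourier f p * cnj (fourier (g k) p - fourier e p)) \<longlonglongrightarrow> (\<Sum>p\<in>F. fourier f p * cnj (fourier e p - fourier e p))"
    using F by (intro tendsto_intros lim) auto
  then have "(\<lambda>k. \<Sum>p\<in>F. fourier f p * cnj (fourier (g k) p - fourier e p)) \<longlonglongrightarrow> 0"
    by simp
  then have "\<forall>\<^sub>F k in sequentially. dist (\<Sum>p\<in>F. fourier f p * cnj (fourier (g k) p - fourier e p)) 0 < \<epsilon> / 2"
    using \<open>\<epsilon> > 0\<close> by (intro tendstoD) auto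
  then show "\<forall>\<^sub>F k in sequentially. dist (L2_inner f (g k)) (L2_inner f e) < \<epsilon>"
  proof eventually_elim
    case (elim k)
    have inner_h: "L2_inner u (?h k) = L2_inner u (g k) - L2_inner u e" if "u \<in> L2" for u
      using that g e by (subst (1 2 3) L2_inner_cnj) (simp add: L2_inner_diff_left)
    have "L2_inner f (g k) - L2_inner f e = L2_inner f (?h k)"
      by (simp add: inner_h f)
    also have "\<dots> = L2_inner ?f (?h k) + L2_inner (\<lambda>z. f z - ?f z) (?h k)"
      using f fL h g e by (simp add: L2_inner_diff_left)
    finally have "cmod (L2_inner f (g k) - L2_inner f e)
        \<le> cmod (L2_inner ?f (?h k)) + cmod (L2_inner (\<lambda>z. f z - ?f z) (?h k))"
      using norm_triangle_ineq by simp
    moreover have "cmod (L2_inner ?f (?h k)) < \<epsilon> / 2"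
      using elim g e h by (simp add: inner_f fourier_diff)
    moreover have "cmod (L2_inner (\<lambda>z. f z - ?f z) (?h k)) \<le> \<epsilon> / 2"
    proof -
      have "cmod (L2_inner (\<lambda>z. f z - ?f z) (?h k)) \<le> L2_norm (\<lambda>z. f z - ?f z) * L2_norm (?h k)"
        by (intro L2_Cauchy_Schwarz L2_diff[OF f fL] h(1))
      also have "\<dots> \<le> \<epsilon> / (2 * (M + 1)) * (M + 1)"
        using F(3) h(2)[of k] \<delta> by (intro mult_mono) auto
      also have "\<dots> = \<epsilon> / 2"
        using \<open>0 \<le> M\<close> by (simp add: field_simps)
      finally show ?thesis .
    qed
    ultimately show ?case
      by (simp add: dist_norm)
  qed
qed

section \<open>Synthesis and analysis for the dilated system\<close>

text \<open>The sum is cut off by the support of \<open>G\<close>, independently of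
  \<open>p\<close>, to match the sum that defines a synthesis.\<close>

lemma coeff_at_times_support:
  assumes "p \<in> pos_pairs" "finite A" "\<And>q. q \<in> pos_pairs \<Longrightarrow> q \<notin> A \<Longrightarrow> coeff_at G q = 0"
  shows "coeff_at (D * G) p = (\<Sum>q\<in>A. dmat D p q * coeff_at G q)"
proof -
  have "coeff_at (D * G) p = (\<Sum>q\<in>A \<union> {q. dvd2 q p}. dmat D p q * coeff_at G q)"
    using assms finite_dvd2 by (intro coeff_at_times) auto
  also have "\<dots> = (\<Sum>q\<in>A. dmat D p q * coeff_at G q)"
    using assms(2,3) finite_dvd2[OF assms(1)] dvd2_in_pos_pairs[OF _ assms(1)]
    by (intro sum.mono_neutral_right) (auto simp: dmat_def)
  finally show ?thesis .
qed

lemma infsum_ennreal_le_iff: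
  assumes "\<And>j. 0 \<le> f j" "0 \<le> M"
  shows "(\<Sum>\<^sub>\<infinity>j\<in>J. ennreal (f j)) \<le> ennreal M \<longleftrightarrow> (\<forall>A. finite A \<longrightarrow> A \<subseteq> J \<longrightarrow> sum f A \<le> M)"
  using assms by (subst nonneg_infsum_complete) (auto simp: SUP_le_iff sum_ennreal sum_nonneg)

locale dilated_system =
  fixes \<phi> :: "real \<times> real \<Rightarrow> complex"
  assumes phi_L2: "\<phi> \<in> L2"
begin

abbreviation a :: dirichlet2 where
  "a \<equiv> S_map \<phi>"

abbreviation analysis :: "(real \<times> real \<Rightarrow> complex) \<Rightarrow> nat \<times> nat \<Rightarrow> complex" where
  "analysis f q \<equiv> L2_inner f (dilation \<phi> q)"

text \<open>Formally adjoint to \<open>analysis\<close>; on coefficients it is multiplication by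
  \<open>a\<close>, as \<open>fourier_synthesis\<close> shows.\<close>

definition synthesis :: "(nat \<times> nat) set \<Rightarrow> (nat \<times> nat \<Rightarrow> complex) \<Rightarrow> real \<times> real \<Rightarrow> complex" where
  "synthesis A c z = (\<Sum>q\<in>A. c q * dilation \<phi> q z)"

lemma synthesis_L2: "finite A \<Longrightarrow> A \<subseteq> pos_pairs \<Longrightarrow> synthesis A c \<in> L2"
  unfolding synthesis_def by (intro L2_sum L2_cmult dilation_L2 phi_L2) auto

lemma fourier_synthesis:
  assumes "finite A" "A \<subseteq> pos_pairs" "p \<in> pos_pairs" "\<And>q. q \<in> pos_pairs \<Longrightarrow> q \<notin> A \<Longrightarrow> coeff_at G q = 0"
  shows "fourier (synthesis A (coeff_at G)) p = coeff_at (a * G) p"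
proof -
  have "fourier (synthesis A (coeff_at G)) p = (\<Sum>q\<in>A. coeff_at G q * fourier (dilation \<phi> q) p)"
    unfolding synthesis_def using assms by (intro fourier_sum dilation_L2 phi_L2) auto
  also have "\<dots> = (\<Sum>q\<in>A. dmat a p q * coeff_at G q)"
    using assms by (intro sum.cong) (auto simp: fourier_dilation phi_L2 subsetD mult.commute)
  finally show ?thesis
    using assms by (simp add: coeff_at_times_support)
qed

lemma L2_inner_synthesis:
  "f \<in> L2 \<Longrightarrow> A \<subseteq> pos_pairs \<Longrightarrow> L2_inner f (synthesis A c) = (\<Sum>q\<in>A. cnj (c q) * analysis f q)"
  unfolding synthesis_def by (intro L2_inner_sum_right dilation_L2 phi_L2) auto

section \<open>Duality between analysis and multiplication\<close>

lemma analysis_sum_basis: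
  assumes "finite B" "B \<subseteq> pos_pairs" "q \<in> pos_pairs"
  shows "analysis (\<lambda>z. \<Sum>p\<in>B. y p * basis_at p z) q = (\<Sum>p\<in>B. y p * cnj (dmat a p q))"
proof -
  have "analysis (\<lambda>z. \<Sum>p\<in>B. y p * basis_at p z) q = cnj (\<Sum>p\<in>B. fourier (dilation \<phi> q) p * cnj (y p))"
    using assms by (subst L2_inner_cnj) (simp only: L2_inner_sum_basis dilation_L2 phi_L2)
  also have "\<dots> = (\<Sum>p\<in>B. y p * cnj (dmat a p q))"
    using assms by (auto simp: fourier_dilation phi_L2 subsetD mult.commute intro!: sum.cong)
  finally show ?thesis .
qed

text \<open>Moves the multiplication to the other side of the pairing. The adjoint of a vector
  supported on \<open>S\<close> lives on the divisors of \<open>S\<close>, so no convergence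
  question arises.\<close>

lemma pairing_times:
  assumes "finite S" "S \<subseteq> pos_pairs"
  shows "(\<Sum>p\<in>S. y p * cnj (coeff_at (D * E) p))
    = (\<Sum>q\<in>divisors2 S. cnj (coeff_at E q) * (\<Sum>p\<in>S. y p * cnj (dmat D p q)))"
proof -
  have "coeff_at (D * E) p = (\<Sum>q\<in>divisors2 S. dmat D p q * coeff_at E q)" if "p \<in> S" for p
    using assms that finite_divisors2[OF assms] by (intro coeff_at_times) (auto simp: divisors2_def)
  then have "(\<Sum>p\<in>S. y p * cnj (coeff_at (D * E) p)) = (\<Sum>p\<in>S. \<Sum>q\<in>divisors2 S. cnj (coeff_at E q) * (y p * cnj (dmat D p q)))"
    by (intro sum.cong) (auto simp: sum_distrib_left mult_ac)
  also have "\<dots> = (\<Sum>q\<in>divisors2 S. cnj (coeff_at E q) * (\<Sum>p\<in>S. y p * cnj (dmat D p q)))"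
    by (subst sum.swap) (simp add: sum_distrib_left)
  finally show ?thesis .
qed

text \<open>Pairing \<open>a * E\<close> with itself on \<open>A\<close> and moving \<open>a\<close>
  across yields the analysis of a finite sine sum, to which the assumed bound applies.\<close>

lemma analysis_bound_imp_mult_bound:
  assumes "0 \<le> C" and bd: "\<And>f A. f \<in> L2 \<Longrightarrow> finite A \<Longrightarrow> A \<subseteq> pos_pairs \<Longrightarrow> norm_on (analysis f) A \<le> C * L2_norm f"
  shows "mult_bound a C"
  unfolding mult_bound_def norm_le_def[of "_ * _"]
proof (intro conjI allI impI assms(1))
  fix E K and A :: "(nat \<times> nat) set"
  assume E: "norm_le E K" and A: "finite A" "A \<subseteq> pos_pairs"
  let ?y = "coeff_at (a * E)" and ?B = "divisors2 A"
  let ?f = "\<lambda>z. \<Sum>p\<in>A. ?y p * basis_at p z"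
  have B: "finite ?B" "?B \<subseteq> pos_pairs"
    using A by (simp_all add: finite_divisors2 divisors2_subset_pos_pairs)
  have "(\<Sum>p\<in>A. ?y p * cnj (?y p)) = (\<Sum>q\<in>?B. cnj (coeff_at E q) * analysis ?f q)"
    unfolding pairing_times[OF A] using A B by (intro sum.cong) (auto simp: analysis_sum_basis subsetD)
  also have "cmod \<dots> \<le> norm_on (\<lambda>q. cnj (coeff_at E q)) ?B * norm_on (analysis ?f) ?B"
    by (rule norm_on_mult_ineq)
  also have "\<dots> \<le> K * (C * norm_on ?y A)"
    using norm_leD[OF E B] bd[OF L2_sum_basis[OF A(1)] B] norm_le_nonneg[OF E] A
    by (intro mult_mono) (simp_all add: L2_norm_sum_basis)
  finally show "norm_on ?y A \<le> C * K"
    using assms(1) norm_le_nonneg[OF E] by (intro norm_on_le_of_pairing) (simp_all add: mult_ac)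
qed

text \<open>Pairing the analysis sequence with itself gives the inner product of \<open>f\<close>
  with a synthesis, whose norm the multiplier bound controls through its coefficients
  \<open>a * G\<close>.\<close>

lemma mult_bound_imp_analysis_bound:
  assumes C: "mult_bound a C" and f: "f \<in> L2" and A: "finite A" "A \<subseteq> pos_pairs"
  shows "norm_on (analysis f) A \<le> C * L2_norm f"
proof (rule norm_on_le_of_pairing)
  define G where "G = dseries (\<lambda>q. if q \<in> A then analysis f q else 0)"
  have G: "coeff_at G q = 0" if "q \<in> pos_pairs" "q \<notin> A" for q
    using that by (simp add: G_def)
  have eq: "coeff_at G q = analysis f q" if "q \<in> A" for q
    using that A by (simp add: G_def subsetD)
  have "norm_le (a * G) (C * norm_on (coeff_at G) A)"
    using C norm_le_finite_support[OF A(1) G] by (simp add: mult_bound_def)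
  then have "norm_on (fourier (synthesis A (coeff_at G))) B \<le> C * norm_on (analysis f) A"
    if "finite B" "B \<subseteq> pos_pairs" for B
    using that A norm_leD[of "a * G" _ B] by (simp add: fourier_synthesis G eq subsetD cong: L2_set_cong)
  then have norm: "L2_norm (synthesis A (coeff_at G)) \<le> C * norm_on (analysis f) A"
    using A C by (intro L2_norm_le_of_fourier synthesis_L2) (auto simp: mult_bound_def)
  have "(\<Sum>q\<in>A. analysis f q * cnj (analysis f q)) = L2_inner f (synthesis A (coeff_at G))"
    using f A by (simp add: L2_inner_synthesis eq mult.commute)
  also have "cmod \<dots> \<le> L2_norm f * L2_norm (synthesis A (coeff_at G))"
    using A by (intro L2_Cauchy_Schwarz f synthesis_L2)
  also have "\<dots> \<le> L2_norm f * (C * norm_on (analysis f) A)"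
    using norm by (intro mult_left_mono) auto
  finally show "cmod (\<Sum>q\<in>A. analysis f q * cnj (analysis f q)) \<le> C * L2_norm f * norm_on (analysis f) A"
    by (simp add: mult_ac)
qed (use C in \<open>simp add: mult_bound_def\<close>)

theorem bessel_sequence_iff: "bessel_sequence pos_pairs (dilation \<phi>) \<longleftrightarrow> a \<in> multipliers2"
proof
  assume "bessel_sequence pos_pairs (dilation \<phi>)"
  then obtain B where B: "B > 0"
    "\<And>f. f \<in> L2 \<Longrightarrow> (\<Sum>\<^sub>\<infinity>q\<in>pos_pairs. ennreal ((cmod (analysis f q))\<^sup>2)) \<le> ennreal (B * (L2_norm f)\<^sup>2)"
    by (auto simp: bessel_sequence_def)
  have "mult_bound a (sqrt B)"
  proof (rule analysis_bound_imp_mult_bound)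
    fix f and A :: "(nat \<times> nat) set" assume "f \<in> L2" and A: "finite A" "A \<subseteq> pos_pairs"
    then have "(norm_on (analysis f) A)\<^sup>2 \<le> B * (L2_norm f)\<^sup>2"
      using B(1) B(2)[OF \<open>f \<in> L2\<close>] unfolding norm_on_power2 by (subst (asm) infsum_ennreal_le_iff) auto
    also have "\<dots> = (sqrt B * L2_norm f)\<^sup>2"
      using B(1) by (simp add: power_mult_distrib)
    finally show "norm_on (analysis f) A \<le> sqrt B * L2_norm f"
      by (rule power2_le_imp_le) (use B(1) in simp)
  qed (use B(1) in simp)
  then show "a \<in> multipliers2"
    by (rule mult_bound_imp_multipliers2)
next
  assume "a \<in> multipliers2"
  then obtain C where C: "mult_bound a C"
    by (rule multipliers2_mult_bound)
  then have "0 \<le> C"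
    by (simp add: mult_bound_def)
  \<comment> \<open>The constant carries \<open>+ 1\<close> because a Bessel bound is strictly
    positive, while \<open>C\<close> may be 0.\<close>
  have "(\<Sum>\<^sub>\<infinity>q\<in>pos_pairs. ennreal ((cmod (analysis f q))\<^sup>2)) \<le> ennreal ((C\<^sup>2 + 1) * (L2_norm f)\<^sup>2)"
    if f: "f \<in> L2" for f
  proof (subst infsum_ennreal_le_iff, simp, simp, intro allI impI)
    fix A :: "(nat \<times> nat) set" assume A: "finite A" "A \<subseteq> pos_pairs"
    have "(norm_on (analysis f) A)\<^sup>2 \<le> (C * L2_norm f)\<^sup>2"
      using mult_bound_imp_analysis_bound[OF C f A] by (intro power_mono) auto
    also have "\<dots> \<le> (C\<^sup>2 + 1) * (L2_norm f)\<^sup>2"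
      by (simp add: power_mult_distrib distrib_right)
    finally show "(\<Sum>q\<in>A. (cmod (analysis f q))\<^sup>2) \<le> (C\<^sup>2 + 1) * (L2_norm f)\<^sup>2"
      by (simp add: norm_on_power2)
  qed
  moreover have "C\<^sup>2 + 1 > 0"
    by (simp add: add_nonneg_pos)
  ultimately show "bessel_sequence pos_pairs (dilation \<phi>)"
    using dilation_L2[OF phi_L2] unfolding bessel_sequence_def by blast
qed

section \<open>The lower frame bound\<close>

lemma lower_bound_imp_inverse_multiplier:
  assumes "A > 0" and low: "\<And>f. f \<in> L2 \<Longrightarrow>
    ennreal (A * (L2_norm f)\<^sup>2) \<le> (\<Sum>\<^sub>\<infinity>q\<in>pos_pairs. ennreal ((cmod (analysis f q))\<^sup>2))"
  shows "\<exists>D. a * D = 1 \<and> D \<in> multipliers2"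
proof -
  have low': "sqrt A * L2_norm f \<le> M"
    if f: "f \<in> L2" "0 \<le> M" "\<And>S. finite S \<Longrightarrow> S \<subseteq> pos_pairs \<Longrightarrow> norm_on (analysis f) S \<le> M" for f M
  proof -
    have "(\<Sum>\<^sub>\<infinity>q\<in>pos_pairs. ennreal ((cmod (analysis f q))\<^sup>2)) \<le> ennreal (M\<^sup>2)"
    proof (subst infsum_ennreal_le_iff, simp, simp, intro allI impI)
      fix S :: "(nat \<times> nat) set" assume S: "finite S" "S \<subseteq> pos_pairs"
      show "(\<Sum>q\<in>S. (cmod (analysis f q))\<^sup>2) \<le> M\<^sup>2"
        using power_mono[OF f(3)[OF S], of 2] by (simp add: norm_on_power2)
    qed
    then have "ennreal (A * (L2_norm f)\<^sup>2) \<le> ennreal (M\<^sup>2)"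
      using low[OF f(1)] by (rule order_trans[rotated])
    then have "(sqrt A * L2_norm f)\<^sup>2 \<le> M\<^sup>2"
      using assms(1) by (simp add: power_mult_distrib)
    then show ?thesis
      using f(2) by (rule power2_le_imp_le)
  qed
  have one: "(1, 1) \<in> pos_pairs"
    by (simp add: mem_pos_pairs)
  \<comment> \<open>Otherwise the basis function at \<open>(1, 1)\<close> would be orthogonal to all
    dilations, against the lower bound.\<close>
  have "coeff_at a (1, 1) \<noteq> 0"
  proof
    assume zero: "coeff_at a (1, 1) = 0"
    have "analysis (basis_at (1, 1)) q = 0" if "q \<in> pos_pairs" for q
    proof -
      have "dmat a (1, 1) q = 0"
        using zero by (auto simp: dmat_def dvd2_def quot2_def)
      then show ?thesis
        using analysis_sum_basis[of "{(1, 1)}" q "\<lambda>_. 1"] one that by simp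
    qed
    then have "norm_on (analysis (basis_at (1, 1))) S = 0" if "S \<subseteq> pos_pairs" for S
      using that by (intro L2_set_0') auto
    then have "sqrt A * L2_norm (basis_at (1, 1)) \<le> 0"
      by (intro low' basis_fun_L2) auto
    moreover have "(L2_norm (basis_at (1, 1)))\<^sup>2 = 1"
      using basis_fun_orthonormal[OF one one] unfolding L2_inner_self by (simp flip: of_real_power)
    then have "L2_norm (basis_at (1, 1)) = 1"
      by (metis L2_norm_nonneg one_power2 power2_eq_iff_nonneg zero_le_one)
    ultimately show False
      using assms(1) by simp
  qed
  then obtain D where D: "a * D = 1"
    by (rule formal_inverse_exists)
  have "mult_bound D (1 / sqrt A)"
    unfolding mult_bound_def norm_le_def[of "_ * _"]
  proof (intro conjI allI impI)
    fix E K and S :: "(nat \<times> nat) set"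
    assume E: "norm_le E K" and S: "finite S" "S \<subseteq> pos_pairs"
    let ?y = "coeff_at (D * E)" and ?B = "divisors2 S"
    \<comment> \<open>The adjoint of multiplication by \<open>D\<close> applied to \<open>?y\<close>
      restricted to \<open>S\<close>; by \<open>pairing_times\<close>, bounding its norm bounds
      \<open>D * E\<close>.\<close>
    define z where "z q = (\<Sum>p\<in>S. ?y p * cnj (dmat D p q))" for q
    let ?f = "\<lambda>x. \<Sum>q\<in>?B. z q * basis_at q x"
    have B: "finite ?B" "?B \<subseteq> pos_pairs"
      using S by (simp_all add: finite_divisors2 divisors2_subset_pos_pairs)
    \<comment> \<open>The adjoint of \<open>a\<close> undoes that of \<open>D\<close>, since
      \<open>D * a = 1\<close>. Restricting the inner sum to \<open>?B\<close> loses nothing because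
      it contains all divisors of each row index.\<close>
    have an: "analysis ?f r = (if r \<in> S then ?y r else 0)" if r: "r \<in> pos_pairs" for r
    proof -
      have "analysis ?f r = (\<Sum>q\<in>?B. \<Sum>p\<in>S. ?y p * cnj (dmat D p q * dmat a q r))"
        unfolding analysis_sum_basis[OF B r] z_def by (simp add: sum_distrib_right mult.assoc)
      also have "\<dots> = (\<Sum>p\<in>S. ?y p * cnj (\<Sum>q\<in>?B. dmat D p q * dmat a q r))"
        by (subst sum.swap) (simp add: sum_distrib_left)
      also have "\<dots> = (\<Sum>p\<in>S. ?y p * cnj (dmat (D * a) p r))"
      proof (intro sum.cong refl)
        fix p assume "p \<in> S"
        then have "dmat (D * a) p r = (\<Sum>q\<in>?B. dmat D p q * dmat a q r)"
          using S B r by (intro dmat_times) (auto simp: divisors2_def)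
        then show "?y p * cnj (\<Sum>q\<in>?B. dmat D p q * dmat a q r) = ?y p * cnj (dmat (D * a) p r)"
          by simp
      qed
      also have "\<dots> = (\<Sum>p\<in>S. if r = p then ?y r else 0)"
        using S D by (intro sum.cong) (auto simp: mult.commute[of D] dmat_one subsetD)
      also have "\<dots> = (if r \<in> S then ?y r else 0)"
        using S by simp
      finally show ?thesis .
    qed
    have "sqrt A * norm_on z ?B \<le> norm_on ?y S"
      unfolding L2_norm_sum_basis[OF B, symmetric]
    proof (rule low')
      fix T :: "(nat \<times> nat) set" assume T: "finite T" "T \<subseteq> pos_pairs"
      have "(\<Sum>r\<in>T. (cmod (analysis ?f r))\<^sup>2) = (\<Sum>r\<in>T \<inter> S. (cmod (?y r))\<^sup>2)"
        using T by (intro sum.mono_neutral_cong_right) (auto simp: an subsetD)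
      then have "norm_on (analysis ?f) T = norm_on ?y (T \<inter> S)"
        by (simp add: L2_set_def)
      also have "\<dots> \<le> norm_on ?y S"
        using S by (intro norm_on_subset) auto
      finally show "norm_on (analysis ?f) T \<le> norm_on ?y S" .
    qed (use B in \<open>simp_all add: L2_sum_basis\<close>)
    then have z: "norm_on z ?B \<le> norm_on ?y S / sqrt A"
      using assms(1) by (simp add: field_simps)
    have "cmod (\<Sum>p\<in>S. ?y p * cnj (?y p)) = cmod (\<Sum>q\<in>?B. cnj (coeff_at E q) * z q)"
      unfolding pairing_times[OF S] z_def ..
    also have "\<dots> \<le> norm_on (\<lambda>q. cnj (coeff_at E q)) ?B * norm_on z ?B"
      by (rule norm_on_mult_ineq)
    also have "\<dots> \<le> K * (norm_on ?y S / sqrt A)"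
      using norm_leD[OF E B] z norm_le_nonneg[OF E] by (intro mult_mono) simp_all
    finally show "norm_on ?y S \<le> 1 / sqrt A * K"
      using assms(1) norm_le_nonneg[OF E] by (intro norm_on_le_of_pairing) (simp_all add: mult_ac)
  qed (use assms(1) in simp)
  then show ?thesis
    using D mult_bound_imp_multipliers2 by blast
qed

text \<open>Formally \<open>f\<close> is recovered from its analysis sequence by the adjoint of multiplication by \<open>D\<close>, but
  the double series involved need not converge absolutely. Replacing \<open>D\<close> by its finitely supported
  Fejer means makes all sums finite, and the uniform multiplier bound allows a weak limit.\<close>

lemma inverse_multiplier_imp_norm_bound:
  assumes D: "a * D = 1" "mult_bound D C" and f: "f \<in> L2" and "0 \<le> \<kappa>"
    and bd: "\<And>A. finite A \<Longrightarrow> A \<subseteq> pos_pairs \<Longrightarrow> norm_on (analysis f) A \<le> \<kappa>"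
  shows "L2_norm f \<le> C * \<kappa>"
proof (rule L2_norm_le_of_fourier[OF f])
  have C: "0 \<le> C"
    using D(2) by (simp add: mult_bound_def)
  then show "0 \<le> C * \<kappa>"
    using \<open>0 \<le> \<kappa>\<close> by simp
  fix S :: "(nat \<times> nat) set" assume S: "finite S" "S \<subseteq> pos_pairs"
  let ?N = "norm_on (fourier f) S"
  define E where "E = dseries (\<lambda>p. if p \<in> S then fourier f p else 0)"
  have E0: "coeff_at E p = 0" if "p \<in> pos_pairs" "p \<notin> S" for p
    using that by (simp add: E_def)
  have ES: "coeff_at E p = fourier f p" if "p \<in> S" for p
    using that S by (simp add: E_def subsetD)
  have E: "norm_le E ?N"
    using norm_le_finite_support[OF S(1) E0] by (simp add: ES cong: L2_set_cong)
  \<comment> \<open>Multiplication by \<open>a\<close> need not be bounded, but \<open>E\<close> has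
    finite support, so \<open>a * E\<close> is the coefficient series of a finite combination of
    dilations.\<close>
  have aE: "norm_le (a * E) (L2_norm (synthesis S (coeff_at E)))"
    unfolding norm_le_def
  proof (intro allI impI)
    fix A :: "(nat \<times> nat) set" assume A: "finite A" "A \<subseteq> pos_pairs"
    have "norm_on (coeff_at (a * E)) A = norm_on (fourier (synthesis S (coeff_at E))) A"
      using A S by (intro L2_set_cong) (auto simp: fourier_synthesis E0 subsetD)
    then show "norm_on (coeff_at (a * E)) A \<le> L2_norm (synthesis S (coeff_at E))"
      using Bessel_inequality[OF synthesis_L2[OF S] A] by simp
  qed
  define G where "G R = fejer (Suc R) D * E" for R
  \<comment> \<open>The Fejer mean has weights below \<open>Suc R\<close> and \<open>E\<close> has
    weights at most the maximum over \<open>S\<close>; additivity bounds the weights in the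
    product.\<close>
  define Z where "Z R = {p \<in> pos_pairs. weight2 p \<le> Suc R + Max (weight2 ` S)}" for R
  have Z: "finite (Z R)" "Z R \<subseteq> pos_pairs" for R
    by (auto simp: Z_def finite_weight2_le)
  have G0: "coeff_at (G R) p = 0" if p: "p \<in> pos_pairs" "p \<notin> Z R" for R p
    unfolding G_def coeff_at_times_divisors[OF p(1)]
  proof (intro sum.neutral ballI)
    fix q assume "q \<in> {q. dvd2 q p}"
    then have q: "dvd2 q p" "q \<in> pos_pairs" "quot2 p q \<in> pos_pairs"
      using p dvd2_in_pos_pairs quot2_in_pos_pairs by auto
    show "dmat (fejer (Suc R) D) p q * coeff_at E q = 0"
    proof (cases "q \<in> S")
      case True
      then have "weight2 q \<le> Max (weight2 ` S)"
        using S by simp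
      then have "Suc R \<le> weight2 (quot2 p q)"
        using p weight2_quot2[OF p(1) q(1)] by (simp add: Z_def)
      then show ?thesis
        using q by (simp add: dmat_def fejer_support)
    qed (use E0 q in simp)
  qed
  have G: "norm_le (G R) (C * ?N)" for R
    using mult_bound_fejer[OF D(2), of "Suc R"] E by (simp add: G_def mult_bound_def)
  \<comment> \<open>Commuting the factors lets the Fejer mean act on the fixed series
    \<open>a * E\<close>, which gives both a norm bound independent of \<open>R\<close> and the
    coefficientwise limit.\<close>
  have aG: "a * G R = fejer (Suc R) D * (a * E)" for R
    by (simp add: G_def mult_ac)
  define g where "g R = synthesis (Z R) (coeff_at (G R))" for R
  have g: "g R \<in> L2" for R
    unfolding g_def by (rule synthesis_L2[OF Z])
  have fourier_g: "fourier (g R) p = coeff_at (fejer (Suc R) D * (a * E)) p" if "p \<in> pos_pairs" for R p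
    unfolding g_def aG[symmetric] using Z that G0 by (rule fourier_synthesis)
  have norm_g: "L2_norm (g R) \<le> C * L2_norm (synthesis S (coeff_at E))" for R
  proof (rule L2_norm_le_of_fourier[OF g])
    fix A :: "(nat \<times> nat) set" assume A: "finite A" "A \<subseteq> pos_pairs"
    have "norm_le (fejer (Suc R) D * (a * E)) (C * L2_norm (synthesis S (coeff_at E)))"
      using mult_bound_fejer[OF D(2), of "Suc R"] aE by (simp add: mult_bound_def)
    moreover have "norm_on (fourier (g R)) A = norm_on (coeff_at (fejer (Suc R) D * (a * E))) A"
      using A by (intro L2_set_cong) (auto simp: fourier_g subsetD)
    ultimately show "norm_on (fourier (g R)) A \<le> C * L2_norm (synthesis S (coeff_at E))"
      using norm_leD A by simp
  qed (use C in simp)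
  define e where "e = (\<lambda>z. \<Sum>p\<in>S. fourier f p * basis_at p z)"
  have lim: "(\<lambda>R. fourier (g R) p) \<longlonglongrightarrow> fourier e p" if p: "p \<in> pos_pairs" for p
  proof -
    have "D * (a * E) = E"
      using D(1) by (metis mult.assoc mult.commute mult_1)
    then have "(\<lambda>R. coeff_at (fejer (Suc R) D * (a * E)) p) \<longlonglongrightarrow> coeff_at E p"
      using LIMSEQ_Suc[OF coeff_at_fejer_times_tendsto[OF p, of D "a * E"]] by simp
    moreover have "coeff_at E p = fourier e p"
      unfolding e_def fourier_sum_basis[OF S p] using E0[OF p] ES by auto
    ultimately show ?thesis
      by (simp add: fourier_g p)
  qed
  have "(\<lambda>R. L2_inner f (g R)) \<longlonglongrightarrow> L2_inner f e"
    using f g L2_sum_basis[OF S(1)] norm_g lim unfolding e_def by (intro L2_inner_weak_limit) auto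
  \<comment> \<open>Here the other grouping is used: \<open>G R\<close> has norm at most
    \<open>C * ?N\<close>, and it is paired with the analysis sequence of \<open>f\<close>. The
    possibly large norm of \<open>a * E\<close> does not enter the final constant.\<close>
  moreover have "cmod (L2_inner f (g R)) \<le> C * \<kappa> * ?N" for R
  proof -
    have "cmod (L2_inner f (g R)) = cmod (\<Sum>q\<in>Z R. cnj (coeff_at (G R) q) * analysis f q)"
      unfolding g_def by (simp only: L2_inner_synthesis[OF f Z(2)])
    also have "\<dots> \<le> norm_on (\<lambda>q. cnj (coeff_at (G R) q)) (Z R) * norm_on (analysis f) (Z R)"
      by (rule norm_on_mult_ineq)
    also have "\<dots> \<le> (C * ?N) * \<kappa>"
      using norm_leD[OF G Z] bd[OF Z] C by (intro mult_mono) simp_all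
    finally show ?thesis
      by (simp add: mult_ac)
  qed
  ultimately have "cmod (L2_inner f e) \<le> C * \<kappa> * ?N"
    using LIMSEQ_le_const2[OF tendsto_norm] by blast
  then show "?N \<le> C * \<kappa>"
    unfolding e_def L2_inner_sum_basis[OF f] using C \<open>0 \<le> \<kappa>\<close> by (intro norm_on_le_of_pairing) auto
qed

theorem lower_frame_bound_iff:
  "lower_frame_bound pos_pairs (dilation \<phi>) \<longleftrightarrow> (\<exists>D. a * D = 1 \<and> D \<in> multipliers2)"
proof
  assume "lower_frame_bound pos_pairs (dilation \<phi>)"
  then show "\<exists>D. a * D = 1 \<and> D \<in> multipliers2"
    unfolding lower_frame_bound_def using lower_bound_imp_inverse_multiplier by blast
next
  assume "\<exists>D. a * D = 1 \<and> D \<in> multipliers2"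
  then obtain D C where D: "a * D = 1" "mult_bound D C"
    using multipliers2_mult_bound by blast
  then have C: "0 \<le> C"
    by (simp add: mult_bound_def)
  \<comment> \<open>The estimate gives \<open>L2_norm f \<le> C * sqrt s\<close>; the
    \<open>+ 1\<close> avoids a separate argument that \<open>C\<close> is positive.\<close>
  define A where "A = 1 / (C + 1)\<^sup>2"
  have "A > 0"
    using C by (simp add: A_def)
  \<comment> \<open>If the analysis sum is infinite the inequality is immediate; otherwise its
    square root is the bound \<kappa> of the preceding lemma.\<close>
  moreover have "ennreal (A * (L2_norm f)\<^sup>2) \<le> (\<Sum>\<^sub>\<infinity>q\<in>pos_pairs. ennreal ((cmod (analysis f q))\<^sup>2))"
    if f: "f \<in> L2" for f
  proof (cases "\<Sum>\<^sub>\<infinity>q\<in>pos_pairs. ennreal ((cmod (analysis f q))\<^sup>2)")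
    case (real s)
    have "norm_on (analysis f) S \<le> sqrt s" if S: "finite S" "S \<subseteq> pos_pairs" for S
    proof -
      have "(\<Sum>q\<in>S. (cmod (analysis f q))\<^sup>2) \<le> s"
        using real S infsum_ennreal_le_iff[of "\<lambda>q. (cmod (analysis f q))\<^sup>2" s pos_pairs] by simp
      then show ?thesis
        unfolding L2_set_def by simp
    qed
    then have "L2_norm f \<le> C * sqrt s"
      using real by (intro inverse_multiplier_imp_norm_bound[OF D f]) auto
    also have "\<dots> \<le> (C + 1) * sqrt s"
      using real by (intro mult_right_mono) auto
    finally have "(L2_norm f)\<^sup>2 \<le> ((C + 1) * sqrt s)\<^sup>2"
      by (intro power_mono) auto
    also have "\<dots> = (C + 1)\<^sup>2 * s"
      using real by (simp add: power_mult_distrib)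
    finally have "A * (L2_norm f)\<^sup>2 \<le> s"
      using C by (simp add: A_def field_simps)
    then show ?thesis
      using real by (simp add: ennreal_leI)
  qed simp
  ultimately show "lower_frame_bound pos_pairs (dilation \<phi>)"
    using dilation_L2[OF phi_L2] unfolding lower_frame_bound_def by blast
qed

end

theorem theorem6p2:
  fixes \<phi> :: "real \<times> real \<Rightarrow> complex"
  assumes "\<phi> \<in> L2"
  shows "(bessel_sequence ({1..} \<times> {1..}) (dilation \<phi>) \<longleftrightarrow> S_map \<phi> \<in> multipliers2) \<and>
         (lower_frame_bound ({1..} \<times> {1..}) (dilation \<phi>) \<longleftrightarrow>
           (\<exists>D. S_map \<phi> * D = 1 \<and> D \<in> multipliers2))"
proof -
  interpret dilated_system \<phi>
    by (standard) (rule assms)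
  show ?thesis
    using bessel_sequence_iff lower_frame_bound_iff by (simp add: pos_pairs_def)
qed

end
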